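(* Every parabolic rotational surface of constant mean curvature $H$ (with $H\ge0$) satisfying $H^2>1$ in $\mathbb{H}^3\subset\mathbb{R}^{3,1}$ is given, with respect to a suitable pseudo-orthonormal basis $(\mathfrak v,\mathfrak e_1,\mathfrak o,\mathfrak e_2)$ of $\mathbb{R}^{3,1}$, by $$(\theta,t)\mapsto\left(\frac{1+r^2(t)(\psi^2(t)+\theta^2)}{2r(t)},\ r(t)\theta,\ r(t),\ r(t)\psi(t)\right)$$ with the functions $$r(t)=\sqrt{C^-}\,\operatorname{dn}_p(\Xi t),\qquad p^2=\frac{2}{H+1}\in(0,1),$$ $$\psi(t)=Ht-\frac{C}{C^-}\,\frac1\Xi\,\Pi_p(p^2;\,\Xi t),$$ where $C>0$ is a constant, $\Xi=\sqrt{C(H+1)}$ and $C^{\pm}=\frac{C}{H\pm1}$.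
   Context: $\mathbb{R}^{3,1}$ is Minkowski space (signature $(+++-)$) and $\mathbb{H}^3$ is hyperbolic space of curvature $-1$, realized as (one sheet of) $\{x\in\mathbb{R}^{3,1}:(x,x)=-1\}$. A pseudo-orthonormal basis $(\mathfrak v,\mathfrak e_1,\mathfrak o,\mathfrak e_2)$ satisfies: $\mathfrak v,\mathfrak o$ lightlike with $(\mathfrak v,\mathfrak o)=-1$, $\mathfrak e_1,\mathfrak e_2$ unit spacelike, and all other inner products vanish. Coordinates in the parametrization are with respect to this ordered basis. Mean curvature is the mean of the principal curvatures; the orientation of the unit normal is always chosen such that $H\ge0$. A surface in $\mathbb{H}^3$ is parabolic rotational if it is invariant under a 1-parameter group of isometries acting as the identity on the orthogonal complement of a 2-plane $\Pi_1$ of signature $(+0)$; for $\Pi_1=\langle\mathfrak v,\mathfrak e_1\rangle$ this group is $\mathfrak v\mapsto\mathfrak v$, $\mathfrak e_1\mapsto\mathfrak e_1+\theta\mathfrak v$, $\mathfrak o\mapsto\mathfrak o+\theta\mathfrak e_1+\frac{\theta^2}{2}\mathfrak v$, $\mathfrak e_2\mapsto\mathfrak e_2$. $\operatorname{sn}_p,\operatorname{cn}_p,\operatorname{dn}_p$ denote the Jacobi elliptic functions with modulus $p$, and $\Pi_p(k;s)=\int_0^s\frac{du}{1-k\,\operatorname{sn}_p^2(u)}$. *)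

theory Defs
  imports "HOL-Analysis.Analysis"
begin

section \<open>Minkowski space and hyperbolic space\<close>

definition mink :: "real^4 \<Rightarrow> real^4 \<Rightarrow> real" where
  "mink x y = x $ 1 * y $ 1 + x $ 2 * y $ 2 + x $ 3 * y $ 3 - x $ 4 * y $ 4"

definition hyperbolic_space :: "(real^4) set" where
  "hyperbolic_space = {x. mink x x = -1 \<and> x $ 4 > 0}"

definition pseudo_orthonormal_basis :: "real^4 \<Rightarrow> real^4 \<Rightarrow> real^4 \<Rightarrow> real^4 \<Rightarrow> bool" where
  "pseudo_orthonormal_basis v e1 w e2 \<longleftrightarrow>
     mink v v = 0 \<and> mink w w = 0 \<and> mink v w = -1 \<and>
     mink e1 e1 = 1 \<and> mink e2 e2 = 1 \<and> mink e1 e2 = 0 \<and>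
     mink v e1 = 0 \<and> mink v e2 = 0 \<and> mink w e1 = 0 \<and> mink w e2 = 0"

definition mink_orthogonal :: "(real^4) set \<Rightarrow> (real^4) set" where
  "mink_orthogonal P = {x. \<forall>y\<in>P. mink x y = 0}"

text \<open>The induced form on the plane has a basis with Gram matrix diag(1, 0).\<close>

definition plane_signature_plus_zero :: "(real^4) set \<Rightarrow> bool" where
  "plane_signature_plus_zero P \<longleftrightarrow> dim P = 2 \<and>
     (\<exists>v e. P = span {v, e} \<and> mink v v = 0 \<and> mink v e = 0 \<and> mink e e = 1)"

text \<open>A continuous one-parameter group of Lorentz transformations; the last conjunct excludes the
  trivial group. Continuity and \<open>G 0 = id\<close> force each \<open>G s\<close> to preserve \<open>hyperbolic_space\<close>.\<close>

definition one_parameter_isometry_group :: "(real \<Rightarrow> real^4 \<Rightarrow> real^4) \<Rightarrow> bool" where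
  "one_parameter_isometry_group G \<longleftrightarrow>
     (\<forall>s. linear (G s) \<and> (\<forall>x y. mink (G s x) (G s y) = mink x y)) \<and>
     G 0 = id \<and> (\<forall>s t. G (s + t) = G s \<circ> G t) \<and>
     (\<forall>x. continuous_on UNIV (\<lambda>s. G s x)) \<and>
     (\<exists>s. G s \<noteq> id)"

section \<open>Immersed surfaces\<close>

definition pderiv_at :: "(real^2 \<Rightarrow> real^4) \<Rightarrow> 2 \<Rightarrow> real^2 \<Rightarrow> real^4" where
  "pderiv_at g i u = frechet_derivative g (at u) (axis i 1)"

definition C1_on :: "(real^2 \<Rightarrow> real^4) \<Rightarrow> (real^2) set \<Rightarrow> bool" where
  "C1_on g U \<longleftrightarrow> (\<forall>u\<in>U. g differentiable (at u)) \<and> (\<forall>i. continuous_on U (pderiv_at g i))"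

definition C2_on :: "(real^2 \<Rightarrow> real^4) \<Rightarrow> (real^2) set \<Rightarrow> bool" where
  "C2_on g U \<longleftrightarrow> C1_on g U \<and> (\<forall>i. C1_on (pderiv_at g i) U)"

definition immersion_on :: "(real^2 \<Rightarrow> real^4) \<Rightarrow> (real^2) set \<Rightarrow> bool" where
  "immersion_on g U \<longleftrightarrow> C2_on g U \<and> (\<forall>u\<in>U. inj (frechet_derivative g (at u)))"

text \<open>A surface is a map \<open>f\<close> from a topological surface \<open>X\<close>. No atlas is part of the data: a local
  parametrization is a local homeomorphism that turns \<open>f\<close> into an immersion of an open subset of
  the plane. As immersions are locally injective with a differentiable local inverse on their image,
  any two local parametrizations are related by a change of coordinates of class C2.\<close>

definition local_parametrization ::
    "'a topology \<Rightarrow> ('a \<Rightarrow> real^4) \<Rightarrow> (real^2) set \<Rightarrow> (real^2 \<Rightarrow> 'a) \<Rightarrow> bool" where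
  "local_parametrization X f U \<phi> \<longleftrightarrow> open U \<and>
     openin X (\<phi> ` U) \<and>
     homeomorphic_map (top_of_set U) (subtopology X (\<phi> ` U)) \<phi> \<and>
     immersion_on (f \<circ> \<phi>) U"

definition hyperbolic_surface :: "'a topology \<Rightarrow> ('a \<Rightarrow> real^4) \<Rightarrow> bool" where
  "hyperbolic_surface X f \<longleftrightarrow>
     connected_space X \<and> Hausdorff_space X \<and> second_countable X \<and>
     f ` topspace X \<subseteq> hyperbolic_space \<and>
     (\<forall>x\<in>topspace X. \<exists>U \<phi>. local_parametrization X f U \<phi> \<and> x \<in> \<phi> ` U)"

section \<open>Mean curvature\<close>

definition first_fundamental_form :: "(real^2 \<Rightarrow> real^4) \<Rightarrow> real^2 \<Rightarrow> real^2^2" where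
  "first_fundamental_form g u = (\<chi> i j. mink (pderiv_at g i u) (pderiv_at g j u))"

text \<open>Since the normal \<open>n\<close> is orthogonal to the position vector, the part of the second derivatives
  normal to hyperbolic space does not contribute.\<close>

definition second_fundamental_form :: "(real^2 \<Rightarrow> real^4) \<Rightarrow> real^4 \<Rightarrow> real^2 \<Rightarrow> real^2^2" where
  "second_fundamental_form g n u = (\<chi> i j. mink (pderiv_at (pderiv_at g i) j u) n)"

definition unit_normal :: "(real^2 \<Rightarrow> real^4) \<Rightarrow> real^2 \<Rightarrow> real^4 \<Rightarrow> bool" where
  "unit_normal g u n \<longleftrightarrow>
     mink n n = 1 \<and> mink n (g u) = 0 \<and> (\<forall>i. mink n (pderiv_at g i u) = 0)"

definition shape_operator :: "(real^2 \<Rightarrow> real^4) \<Rightarrow> real^4 \<Rightarrow> real^2 \<Rightarrow> real^2^2" where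
  "shape_operator g n u =
     matrix_inv (first_fundamental_form g u) ** second_fundamental_form g n u"

text \<open>The eigenvalues of the shape operator, listed with multiplicity.\<close>

definition principal_curvatures ::
    "(real^2 \<Rightarrow> real^4) \<Rightarrow> real^4 \<Rightarrow> real^2 \<Rightarrow> real \<Rightarrow> real \<Rightarrow> bool" where
  "principal_curvatures g n u k1 k2 \<longleftrightarrow>
     (\<forall>x. det (shape_operator g n u - mat x) = (k1 - x) * (k2 - x))"

text \<open>The unit normal is only required pointwise: its sign is the one that makes the mean curvature
  equal to \<open>H\<close> (\<open>H \<ge> 0\<close> in the applications); for \<open>H > 0\<close> this determines it
  uniquely, and continuously in the point.\<close>

definition constant_mean_curvature :: "'a topology \<Rightarrow> ('a \<Rightarrow> real^4) \<Rightarrow> real \<Rightarrow> bool" where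
  "constant_mean_curvature X f H \<longleftrightarrow>
     (\<forall>U \<phi>. local_parametrization X f U \<phi> \<longrightarrow>
        (\<forall>u\<in>U. \<exists>n k1 k2. unit_normal (f \<circ> \<phi>) u n \<and>
           principal_curvatures (f \<circ> \<phi>) n u k1 k2 \<and> H = (k1 + k2) / 2))"

section \<open>Parabolic rotational surfaces\<close>

definition parabolic_rotational :: "'a topology \<Rightarrow> ('a \<Rightarrow> real^4) \<Rightarrow> bool" where
  "parabolic_rotational X f \<longleftrightarrow>
     (\<exists>P G. plane_signature_plus_zero P \<and> one_parameter_isometry_group G \<and>
        (\<forall>s. \<forall>x\<in>mink_orthogonal P. G s x = x) \<and>
        (\<forall>s. G s ` (f ` topspace X) = f ` topspace X))"

definition parabolic_parametrization ::
    "real^4 \<Rightarrow> real^4 \<Rightarrow> real^4 \<Rightarrow> real^4 \<Rightarrow> (real \<Rightarrow> real) \<Rightarrow> (real \<Rightarrow> real) \<Rightarrow> real \<times> real \<Rightarrow> real^4" where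
  "parabolic_parametrization v e1 w e2 r \<psi> = (\<lambda>(\<theta>, t).
     ((1 + (r t)\<^sup>2 * ((\<psi> t)\<^sup>2 + \<theta>\<^sup>2)) / (2 * r t)) *\<^sub>R v + (r t * \<theta>) *\<^sub>R e1 +
     r t *\<^sub>R w + (r t * \<psi> t) *\<^sub>R e2)"

section \<open>Jacobi elliptic functions with modulus p\<close>

text \<open>Incomplete elliptic integral of the first kind, for \<open>0 < p < 1\<close>; the interval integral is signed.
  The amplitude is its inverse function.\<close>

definition ellF :: "real \<Rightarrow> real \<Rightarrow> real" where
  "ellF p \<phi> = (LBINT \<alpha>=0..\<phi>. 1 / sqrt (1 - p\<^sup>2 * (sin \<alpha>)\<^sup>2))"

definition jacobi_am :: "real \<Rightarrow> real \<Rightarrow> real" where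
  "jacobi_am p s = (THE \<phi>. ellF p \<phi> = s)"

definition jacobi_sn :: "real \<Rightarrow> real \<Rightarrow> real" where
  "jacobi_sn p s = sin (jacobi_am p s)"

definition jacobi_dn :: "real \<Rightarrow> real \<Rightarrow> real" where
  "jacobi_dn p s = sqrt (1 - p\<^sup>2 * (jacobi_sn p s)\<^sup>2)"

definition ellPi :: "real \<Rightarrow> real \<Rightarrow> real \<Rightarrow> real" where
  "ellPi p k s = (LBINT u=0..s. 1 / (1 - k * (jacobi_sn p u)\<^sup>2))"

end

theory Submission
  imports Defs
begin

text \<open>In the half-space coordinates \<open>th = b / c\<close>, \<open>ps = d / c\<close>, \<open>y = 1 / c\<close> of
  \<open>x = a v + b e1 + c w + d e2\<close> the parabolic group translates \<open>th\<close>. The image of the surface is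
  therefore a cylinder over a set in the half-plane \<open>(ps, y)\<close>; being a null set in space, it is tangent
  to the rulings. So \<open>(ps, y)\<close> has rank one and runs through a curve with direction \<open>(cos a, sin a)\<close>
  whose curvature \<open>\<kappa>\<close> satisfies \<open>\<kappa> y = 2 (H - cos a)\<close>. Hence \<open>(H - cos a) / y\<^sup>2\<close> is
  locally constant and the angle \<open>a\<close> determines the point of the curve up to one translation constant.
  For \<open>H > 1\<close> the curve bends strictly to one side, which fixes \<open>a\<close> modulo \<open>2 pi\<close> independently of the
  chart; because one turn of \<open>a\<close> moves \<open>ps\<close> by a nonzero period, \<open>a\<close> extends to a continuous real
  function on the whole surface. A parabolic change of basis normalizes both constants (to \<open>C = 1\<close>), and
  along the Jacobi parametrization the angle is an increasing homeomorphism of the line.\<close>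

text \<open>The half-space metric is the Euclidean one divided by \<open>y\<^sup>2\<close>, so mean
  curvatures obey the conformal law \<open>H = n + y * h\<close>, where \<open>h\<close> is the
  Euclidean mean curvature and \<open>n\<close> the vertical component of the Euclidean unit normal.
  For the cylinder, \<open>n = cos a\<close> and \<open>h = \<kappa> / 2\<close>; this is the origin
  of the equation for \<open>\<kappa>\<close>. Along arc length \<open>a\<close> grows at rate
  \<open>\<kappa>\<close> and \<open>y\<close> at rate \<open>sin a\<close>, so
  \<open>H - cos a\<close> and \<open>y\<^sup>2\<close> have the same logarithmic derivative
  \<open>2 * sin a / y\<close>. Two obstacles shape the argument. Invariance concerns only the image
  of \<open>f\<close>: the translate of a point may come from another sheet, and no action on
  \<open>X\<close> is available, hence the detour through null sets. The unit normal is given only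
  pointwise, so a continuous direction has to be built from the derivatives and its sign shown to be
  constant. A homothety of the half-space is an isometry and rescales \<open>C\<close>; together
  with a rescaling of \<open>t\<close> it relates the formulas for any two values of
  \<open>C\<close>.\<close>

section \<open>Linear algebra of Minkowski space\<close>

lemma mink_commute: "mink x y = mink y x"
  by (simp add: mink_def)

lemma mink_bilinear [simp]:
  "mink (x + y) z = mink x z + mink y z" "mink z (x + y) = mink z x + mink z y"
  "mink (x - y) z = mink x z - mink y z" "mink z (x - y) = mink z x - mink z y"
  "mink (a *\<^sub>R x) z = a * mink x z" "mink z (a *\<^sub>R x) = a * mink z x"
  "mink 0 z = 0" "mink z 0 = 0" "mink (- x) z = - mink x z" "mink z (- x) = - mink z x"
  by (simp_all add: mink_def algebra_simps)

lemma bounded_linear_mink [simp]: "bounded_linear (\<lambda>x. mink x z)"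
proof -
  have "linear (\<lambda>x. mink x z)" by (rule linearI) simp_all
  then show ?thesis by (simp add: linear_conv_bounded_linear)
qed

lemma lightlike_4_nonzero:
  assumes "mink v v = 0" "v \<noteq> 0"
  shows "v $ 4 \<noteq> 0"
proof
  assume "v $ 4 = 0"
  then have "(v$1)\<^sup>2 + (v$2)\<^sup>2 + (v$3)\<^sup>2 = 0" using assms(1) by (simp add: mink_def power2_eq_square)
  then have "(v$1)\<^sup>2 = 0 \<and> (v$2)\<^sup>2 = 0 \<and> (v$3)\<^sup>2 = 0"
    using zero_le_power2[of "v$1"] zero_le_power2[of "v$2"] zero_le_power2[of "v$3"] by linarith
  with \<open>v $ 4 = 0\<close> have "v = 0" by (simp add: vec_eq_iff forall_4)
  with assms(2) show False ..
qed

lemma vector_4: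
  "(vector [a, b, c, d] :: real^4) $ 1 = a" "(vector [a, b, c, d] :: real^4) $ 2 = b"
  "(vector [a, b, c, d] :: real^4) $ 3 = c" "(vector [a, b, c, d] :: real^4) $ 4 = d"
  by (simp_all add: vector_def)

text \<open>Subtracting a multiple of \<open>v\<close> makes \<open>e1\<close> purely spatial
  without leaving the plane of \<open>v\<close> and \<open>e\<close>. Then \<open>w\<close> is
  \<open>v\<close> with reversed spatial part, scaled to \<open>mink v w = -1\<close>, and
  \<open>e2\<close> is the spatial cross product of \<open>v\<close> and \<open>e1\<close> divided
  by \<open>v $ 4\<close>; its length comes from the Lagrange identity. Orthogonality of
  \<open>e2\<close> to \<open>e\<close> puts \<open>e2\<close> into the orthogonal complement of
  that plane.\<close>

lemma pseudo_orthonormal_basis_exists: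
  assumes v: "mink v v = 0" "v $ 4 > 0" and e: "mink v e = 0" "mink e e = 1"
  shows "\<exists>e1 w e2. pseudo_orthonormal_basis v e1 w e2 \<and> mink e2 e = 0"
proof -
  define e1 where "e1 = e - (e $ 4 / v $ 4) *\<^sub>R v"
  have e1: "mink v e1 = 0" "mink e1 e1 = 1" using v e by (simp_all add: e1_def mink_commute[of e v])
  have e14: "e1 $ 4 = 0" using v by (simp add: e1_def)
  define w :: "real^4" where "w = (1 / (2 * (v$4)\<^sup>2)) *\<^sub>R vector [- v$1, - v$2, - v$3, v$4]"
  define e2 :: "real^4" where "e2 = (1 / v$4) *\<^sub>R
    vector [v$2 * e1$3 - v$3 * e1$2, v$3 * e1$1 - v$1 * e1$3, v$1 * e1$2 - v$2 * e1$1, 0]"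
  have v2: "v$1 * v$1 + v$2 * v$2 + v$3 * v$3 = v$4 * v$4" using v by (simp add: mink_def)
  have e2': "e1$1 * e1$1 + e1$2 * e1$2 + e1$3 * e1$3 = 1" using e1 e14 by (simp add: mink_def)
  have ve: "v$1 * e1$1 + v$2 * e1$2 + v$3 * e1$3 = 0" using e1 e14 by (simp add: mink_def)
  have vw: "mink v w = -1"
  proof -
    have "mink v w = (1 / (2 * (v$4)\<^sup>2)) * (- (v$1 * v$1 + v$2 * v$2 + v$3 * v$3) - v$4 * v$4)"
      by (simp add: w_def) (simp add: mink_def vector_4 algebra_simps)
    then show ?thesis unfolding v2 using v(2) by (simp add: power2_eq_square field_simps)
  qed
  have ww: "mink w w = 0"
    using v2 by (simp add: w_def) (simp add: mink_def vector_4)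
  have we: "mink w e1 = 0"
    using ve e14 by (simp add: w_def) (simp add: mink_def vector_4)
  have e2e2: "mink e2 e2 = 1"
  proof -
    have "mink e2 e2 = (1 / v$4)\<^sup>2 * ((v$1 * v$1 + v$2 * v$2 + v$3 * v$3) * (e1$1 * e1$1 + e1$2 * e1$2 + e1$3 * e1$3)
        - (v$1 * e1$1 + v$2 * e1$2 + v$3 * e1$3)\<^sup>2)"
      by (simp add: e2_def power2_eq_square) (simp add: mink_def vector_4 algebra_simps)
    then show ?thesis unfolding v2 e2' ve using v(2) by (simp add: power2_eq_square field_simps)
  qed
  have o: "mink v e2 = 0" "mink e1 e2 = 0" "mink w e2 = 0"
    by (simp_all add: e2_def w_def) (simp_all add: mink_def vector_4 e14 algebra_simps)
  have "mink e2 e = mink e2 (e1 + (e $ 4 / v $ 4) *\<^sub>R v)" by (simp add: e1_def)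
  then have "mink e2 e = 0" using o by (simp add: mink_commute)
  moreover have "pseudo_orthonormal_basis v e1 w e2"
    unfolding pseudo_orthonormal_basis_def using v e1 vw ww we e2e2 o by simp
  ultimately show ?thesis by blast
qed

lemma pseudo_orthonormal_basis_mink:
  assumes "pseudo_orthonormal_basis v e1 w e2"
  shows "mink v v = 0" "mink w w = 0" "mink v w = -1" "mink w v = -1" "mink e1 e1 = 1"
    "mink e2 e2 = 1" "mink e1 e2 = 0" "mink e2 e1 = 0" "mink v e1 = 0" "mink e1 v = 0"
    "mink v e2 = 0" "mink e2 v = 0" "mink w e1 = 0" "mink e1 w = 0" "mink w e2 = 0" "mink e2 w = 0"
  using assms by (auto simp: pseudo_orthonormal_basis_def mink_commute)

text \<open>The Gram matrix is nondegenerate, so the combination map of \<open>real^4\<close> into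
  itself is injective and therefore onto. Pairing reads off the coefficients; those of
  \<open>v\<close> and \<open>w\<close> are exchanged because these vectors pair with each
  other.\<close>

lemma pseudo_orthonormal_expansion:
  assumes "pseudo_orthonormal_basis v e1 w e2"
  shows "x = (- mink x w) *\<^sub>R v + mink x e1 *\<^sub>R e1 + (- mink x v) *\<^sub>R w + mink x e2 *\<^sub>R e2"
proof -
  note B = pseudo_orthonormal_basis_mink[OF assms]
  let ?M = "\<lambda>c :: real^4. c$1 *\<^sub>R v + c$2 *\<^sub>R e1 + c$3 *\<^sub>R w + c$4 *\<^sub>R e2"
  have lin: "linear ?M" by (rule linearI) (simp_all add: algebra_simps)
  have "inj ?M"
    unfolding linear_injective_0[OF lin]
  proof (intro allI impI)
    fix c :: "real^4" assume "?M c = 0"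
    then have "mink (?M c) w = 0" "mink (?M c) e1 = 0" "mink (?M c) v = 0" "mink (?M c) e2 = 0"
      by simp_all
    then show "c = 0" by (simp add: B vec_eq_iff forall_4)
  qed
  with lin have "surj ?M" by (rule linear_inj_imp_surj)
  then obtain c where c: "x = ?M c" by (rule surjE)
  show ?thesis unfolding c by (simp add: B)
qed

text \<open>Cauchy-Schwarz for the spatial parts, strict because the spatial part of
  \<open>x\<close> is shorter than \<open>x $ 4\<close>. It makes the height coordinate positive, so
  that the half-space coordinates are defined on all of hyperbolic space.\<close>

lemma mink_hyperbolic_lightlike_neg:
  assumes x: "x \<in> hyperbolic_space" and v: "mink v v = 0" "v $ 4 > 0"
  shows "mink x v < 0"
proof -
  let ?p = "x$1 * v$1 + x$2 * v$2 + x$3 * v$3"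
  have x': "x$1 * x$1 + x$2 * x$2 + x$3 * x$3 = x$4 * x$4 - 1" "x$4 > 0"
    using x by (auto simp: hyperbolic_space_def mink_def)
  have v': "v$1 * v$1 + v$2 * v$2 + v$3 * v$3 = v$4 * v$4" using v by (simp add: mink_def)
  have "?p\<^sup>2 \<le> (x$1 * x$1 + x$2 * x$2 + x$3 * x$3) * (v$1 * v$1 + v$2 * v$2 + v$3 * v$3)"
  proof -
    have "(x$1 * x$1 + x$2 * x$2 + x$3 * x$3) * (v$1 * v$1 + v$2 * v$2 + v$3 * v$3) - ?p\<^sup>2
      = (x$1 * v$2 - x$2 * v$1)\<^sup>2 + (x$1 * v$3 - x$3 * v$1)\<^sup>2 + (x$2 * v$3 - x$3 * v$2)\<^sup>2"
      by (simp add: power2_eq_square algebra_simps)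
    then show ?thesis by (smt (verit) zero_le_power2)
  qed
  also have "\<dots> < (x$4 * v$4)\<^sup>2"
    unfolding x'(1) v' using v(2) by (simp add: power2_eq_square algebra_simps)
  finally have "?p < x$4 * v$4"
    using x'(2) v(2) by (meson mult_pos_pos less_le power2_less_imp_less)
  then show ?thesis by (simp add: mink_def)
qed

section \<open>One-parameter parabolic groups\<close>

text \<open>Natural multiples of a positive value exceed \<open>\<bar>d\<bar>\<close>, oddness gives
  values below \<open>- \<bar>d\<bar>\<close>, and the range is an interval.\<close>

lemma continuous_additive_surj:
  fixes g :: "real \<Rightarrow> real"
  assumes add: "\<And>s t. g (s + t) = g s + g t" and cont: "continuous_on UNIV g" and "g s0 \<noteq> 0"
  shows "\<exists>s. g s = d"
proof -
  have g0: "g 0 = 0" using add[of 0 0] by simp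
  have nat: "g (real n * s) = real n * g s" for n s
    by (induction n) (simp_all add: g0 add distrib_right)
  have neg: "g (- s) = - g s" for s using add[of s "-s"] g0 by simp
  obtain s1 where s1: "g s1 > 0" using assms(3) neg by (metis linorder_neqE_linordered_idom neg_0_less_iff_less)
  obtain n where n: "\<bar>d\<bar> < real n * g s1" using reals_Archimedean3[OF s1] by blast
  define s where "s = real n * s1"
  have s: "\<bar>d\<bar> < g s" using n nat by (simp add: s_def)
  have "is_interval (range g)"
    using connected_continuous_image[OF cont connected_UNIV] by (simp add: is_interval_connected_1)
  moreover have "g (- s) \<in> range g" "g s \<in> range g" by auto
  ultimately have "d \<in> range g" using s neg[of s] unfolding is_interval_1 by (smt (verit))
  then show ?thesis by auto
qed

text \<open>Fixing \<open>v\<close> and \<open>e2\<close> leaves only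
  \<open>G s e1 = g s *\<^sub>R v + k s *\<^sub>R e1\<close> with \<open>k s\<close> equal to 1 or
  -1. Continuity from \<open>G 0 = id\<close> gives \<open>k s = 1\<close>, and then
  \<open>g\<close> is additive. If \<open>g\<close> vanished, \<open>w\<close> would be fixed as
  well and the group would be trivial; so \<open>g\<close> takes every value \<open>d\<close>. In
  half-space coordinates the resulting map adds \<open>d\<close> to \<open>th\<close> and keeps
  \<open>ps\<close> and \<open>y\<close>.\<close>

lemma parabolic_group_translations:
  assumes B: "pseudo_orthonormal_basis v e1 w e2" and G: "one_parameter_isometry_group G"
    and fix_v: "\<And>s. G s v = v" and fix_e2: "\<And>s. G s e2 = e2"
  shows "\<exists>s. \<forall>x. mink (G s x) v = mink x v \<and> mink (G s x) e2 = mink x e2 \<and>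
    mink (G s x) e1 = mink x e1 - d * mink x v"
proof -
  note B' = pseudo_orthonormal_basis_mink[OF B]
  have lin: "linear (G s)" and iso: "mink (G s x) (G s y) = mink x y" and G0: "G 0 = id"
    and Gadd: "G (s + t) = G s \<circ> G t" and cont: "continuous_on UNIV (\<lambda>s. G s x)"
    and nontriv: "\<exists>s. G s \<noteq> id" for s t x y
    using G unfolding one_parameter_isometry_group_def by auto
  have iso_v: "mink (G s x) v = mink x v" and iso_e2: "mink (G s x) e2 = mink x e2" for s x
    using iso[of s x v] iso[of s x e2] by (simp_all add: fix_v fix_e2)
  define g where "g s = - mink (G s e1) w" for s
  define k where "k s = mink (G s e1) e1" for s
  have e1_exp: "G s e1 = g s *\<^sub>R v + k s *\<^sub>R e1" for s
    using pseudo_orthonormal_expansion[OF B, of "G s e1"] by (simp add: iso_v iso_e2 B' g_def k_def)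
  have "k s * k s = 1" for s using iso[of s e1 e1] by (simp add: e1_exp B')
  then have k1: "k s = 1 \<or> k s = -1" for s by (metis mult_cancel_left2 square_eq_1_iff)
  have contk: "continuous_on UNIV k" and contg: "continuous_on UNIV g"
    unfolding k_def[abs_def] g_def[abs_def]
    by (intro continuous_intros bounded_linear.continuous_on[OF bounded_linear_mink] cont)+
  have k: "k s = 1" for s
  proof (rule ccontr)
    assume "k s \<noteq> 1"
    then have "k s = -1" using k1 by blast
    moreover have "k 0 = 1" by (simp add: k_def G0 B')
    moreover have "is_interval (range k)"
      using connected_continuous_image[OF contk connected_UNIV] by (simp add: is_interval_connected_1)
    ultimately have "0 \<in> range k" unfolding is_interval_1 by (metis rangeI zero_le_one neg_le_0_iff_le)
    then obtain z where "k z = 0" by auto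
    then show False using k1[of z] by simp
  qed
  have Ge1: "G s e1 = e1 + g s *\<^sub>R v" for s by (simp add: e1_exp k)
  have gadd: "g (s + t) = g s + g t" for s t
  proof -
    have "G (s + t) e1 = G s e1 + g t *\<^sub>R v"
      unfolding Gadd by (simp add: Ge1[of t] linear_add[OF lin] linear_scale[OF lin] fix_v)
    then have "mink (G (s + t) e1) w = mink (G s e1) w - g t" by (simp add: B')
    then show ?thesis by (simp add: g_def)
  qed
  \<comment> \<open>Exhibits \<open>e1\<close> as an image under \<open>G s\<close>, so that the
    isometry property can strip \<open>G s\<close> from both arguments.\<close>
  have e1_eq: "e1 = G s (e1 - g s *\<^sub>R v)" for s
    by (simp add: Ge1 linear_diff[OF lin] linear_scale[OF lin] fix_v)
  have iso_e1: "mink (G s x) e1 = mink x e1 - g s * mink x v" for s x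
  proof -
    have "mink (G s x) e1 = mink (G s x) (G s (e1 - g s *\<^sub>R v))" by (simp only: e1_eq[symmetric])
    also have "\<dots> = mink x (e1 - g s *\<^sub>R v)" by (rule iso)
    finally show ?thesis by simp
  qed
  have "\<exists>s. g s \<noteq> 0"
  proof (rule ccontr)
    assume "\<not> ?thesis"
    then have g0: "g s = 0" for s by auto
    have "G s w = w" for s
    proof -
      define a where "a = - mink (G s w) w"
      have "G s w = a *\<^sub>R v + w"
        using pseudo_orthonormal_expansion[OF B, of "G s w"]
        by (simp add: iso_v iso_e2 iso_e1 g0 B' a_def)
      moreover from this have "a = 0" using iso[of s w w] by (simp add: B')
      ultimately show ?thesis by simp
    qed
    then have w: "mink (G s x) w = mink x w" for s x using iso[of s x w] by simp
    have "G s x = x" for s x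
      using pseudo_orthonormal_expansion[OF B, of "G s x"] pseudo_orthonormal_expansion[OF B, of x]
      by (simp add: iso_v iso_e2 iso_e1 g0 w)
    then show False using nontriv by (metis eq_id_iff)
  qed
  then obtain s0 where "g s0 \<noteq> 0" ..
  from continuous_additive_surj[of g, OF gadd contg this, of d] obtain s where "g s = d" by blast
  then show ?thesis using iso_v iso_e2 iso_e1 by blast
qed

section \<open>Antiderivatives and increasing homeomorphisms of the line\<close>

lemma LBINT_has_real_derivative:
  fixes f :: "real \<Rightarrow> real"
  assumes "continuous_on UNIV f"
  shows "((\<lambda>u. LBINT y=0..ereal u. f y) has_real_derivative f x) (at x)"
proof -
  define a where "a = min 0 x - 1"
  define b where "b = max 0 x + 1"
  have ab: "a \<le> 0" "0 \<le> b" "a \<le> x" "x \<le> b" "a < x" "x < b" by (auto simp: a_def b_def)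
  have "((\<lambda>u. LBINT y=ereal 0..ereal u. f y) has_vector_derivative f x) (at x within {a..b})"
    by (rule interval_integral_FTC2[OF ab(1,2) _ ab(3,4)]) (use assms continuous_on_subset in blast)
  then have "((\<lambda>u. LBINT y=ereal 0..ereal u. f y) has_vector_derivative f x) (at x)"
    using ab by (simp add: at_within_Icc_at)
  then show ?thesis
    by (simp add: has_real_derivative_iff_has_vector_derivative zero_ereal_def)
qed

text \<open>The uniform lower bound \<open>m\<close> on the derivative forces at least linear growth
  in both directions; this is what yields surjectivity, beyond the monotonicity that positivity
  alone gives.\<close>

lemma increasing_real_homeomorphism:
  fixes A :: "real \<Rightarrow> real"
  assumes d: "\<And>t. (A has_real_derivative A' t) (at t)" and m: "\<And>t. m \<le> A' t" and "0 < m"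
  shows "strict_mono A" "surj A" "continuous_on UNIV A" "continuous_on UNIV (inv A)"
proof -
  have cont: "isCont A t" for t using d DERIV_isCont by blast
  then show cA: "continuous_on UNIV A" by (simp add: continuous_at_imp_continuous_on)
  show mono: "strict_mono A"
  proof (rule strict_monoI)
    fix x y :: real assume "x < y"
    have "\<forall>z. x \<le> z \<and> z \<le> y \<longrightarrow> (\<exists>D. (A has_real_derivative D) (at z) \<and> 0 < D)"
      using d m \<open>0 < m\<close> by (meson less_le_trans)
    with \<open>x < y\<close> show "A x < A y" using DERIV_pos_imp_increasing by blast
  qed
  have grow: "m * (y - x) \<le> A y - A x" if "x \<le> y" for x y
  proof -
    have "\<exists>D. ((\<lambda>z. A z - m * z) has_real_derivative D) (at z) \<and> 0 \<le> D" for z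
    proof (intro exI conjI)
      show "((\<lambda>z. A z - m * z) has_real_derivative A' z - m) (at z)"
        by (auto intro!: derivative_eq_intros d)
      show "0 \<le> A' z - m" using m[of z] by simp
    qed
    from DERIV_nonneg_imp_nondecreasing[OF that this] show ?thesis by (simp add: algebra_simps)
  qed
  show sA: "surj A"
    unfolding surj_def
  proof
    fix z
    \<comment> \<open>With slope at least \<open>m\<close>, the value \<open>z\<close> is attained
      between 0 and \<open>(z - A 0) / m\<close>; the minimum and the maximum cover both signs of
      \<open>z - A 0\<close>.\<close>
    define l where "l = min 0 ((z - A 0) / m)"
    define u where "u = max 0 ((z - A 0) / m)"
    have "l \<le> 0" "0 \<le> u" by (auto simp: l_def u_def)
    have 1: "A l \<le> z"
    proof -
      have "m * (0 - l) \<le> A 0 - A l" using grow[of l 0] \<open>l \<le> 0\<close> by simp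
      moreover have "m * l \<le> z - A 0"
        using \<open>0 < m\<close> mult_left_mono[of l "(z - A 0)/m" m] by (simp add: l_def)
      ultimately show ?thesis by simp
    qed
    have 2: "z \<le> A u"
    proof -
      have "m * (u - 0) \<le> A u - A 0" using grow[of 0 u] \<open>0 \<le> u\<close> by simp
      moreover have "z - A 0 \<le> m * u"
        using \<open>0 < m\<close> mult_left_mono[of "(z - A 0)/m" u m] by (simp add: u_def)
      ultimately show ?thesis by simp
    qed
    obtain t where "A t = z"
      using IVT[of A l z u] 1 2 \<open>l \<le> 0\<close> \<open>0 \<le> u\<close> cont by auto
    then show "\<exists>t. z = A t" by auto
  qed
  have inj: "inj A" using mono by (simp add: strict_mono_imp_inj_on)
  show "continuous_on UNIV (inv A)"
  proof (rule continuous_at_imp_continuous_on, rule ballI)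
    fix z
    have "isCont (inv A) (A (inv A z))"
      by (rule isCont_inverse_function[where d = 1]) (use cont inj in auto)
    then show "isCont (inv A) z" by (simp add: surj_f_inv_f[OF sA])
  qed
qed

section \<open>The profile curve in terms of its direction angle\<close>

text \<open>Horizontal coordinate of the profile curve as a function of its direction angle,
  normalized so that the height is \<open>y = sqrt (H - cos a)\<close>. The curvature is then
  \<open>2 * y\<close>, so arc length grows at rate \<open>1 / (2 * y)\<close> per unit of angle and
  the abscissa at rate \<open>cos a / (2 * y)\<close>.\<close>

definition profile_abscissa :: "real \<Rightarrow> real \<Rightarrow> real" where
  "profile_abscissa H a = (LBINT b=0..ereal a. cos b / (2 * sqrt (H - cos b)))"

lemma profile_abscissa_0 [simp]: "profile_abscissa H 0 = 0"
  by (simp add: profile_abscissa_def zero_ereal_def[symmetric])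

lemma cos_less: "1 < H \<Longrightarrow> cos a < (H::real)"
  by (meson cos_le_one le_less_trans)

lemma profile_abscissa_deriv:
  assumes "1 < H"
  shows "(profile_abscissa H has_real_derivative cos a / (2 * sqrt (H - cos a))) (at a)"
proof -
  have "continuous_on UNIV (\<lambda>b. cos b / (2 * sqrt (H - cos b)))"
    using cos_less[OF assms] by (intro continuous_intros) (auto simp: less_le)
  from LBINT_has_real_derivative[OF this] show ?thesis
    unfolding profile_abscissa_def[abs_def] .
qed

lemma sqrt_profile_deriv:
  assumes "1 < H"
  shows "((\<lambda>a. sqrt (H - cos a)) has_real_derivative sin a / (2 * sqrt (H - cos a))) (at a)"
  using cos_less[OF assms, of a]
  by (auto intro!: derivative_eq_intros simp: field_simps)

definition profile_period :: "real \<Rightarrow> real" where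
  "profile_period H = profile_abscissa H (2 * pi)"

lemma profile_abscissa_shift:
  assumes "1 < H"
  shows "profile_abscissa H (a + 2 * pi) = profile_abscissa H a + profile_period H"
proof -
  let ?W = "profile_abscissa H"
  let ?g = "\<lambda>a. ?W (a + 2 * pi) - ?W a"
  have "(?g has_real_derivative 0) (at a)" for a
    by (auto intro!: derivative_eq_intros DERIV_chain2[OF profile_abscissa_deriv[OF assms]]
        profile_abscissa_deriv[OF assms])
  then have "?g a = ?g 0" using DERIV_isconst_all[of ?g a 0] by blast
  then show ?thesis by (simp add: profile_period_def)
qed

lemma profile_abscissa_shift_int:
  assumes "1 < H"
  shows "profile_abscissa H (a + 2 * pi * of_int k) = profile_abscissa H a + of_int k * profile_period H"
proof (induction k rule: int_induct[of _ 0])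
  case (step1 i)
  then show ?case
    using profile_abscissa_shift[OF assms, of "a + 2 * pi * of_int i"] by (simp add: algebra_simps)
next
  case (step2 i)
  then show ?case
    using profile_abscissa_shift[OF assms, of "a + 2 * pi * of_int (i - 1)"] by (simp add: algebra_simps)
qed simp

text \<open>Opposite directions are compared. For \<open>a\<close> between \<open>- pi/2\<close> and
  \<open>pi/2\<close> the curve runs forward at \<open>a\<close> and backward at
  \<open>a + pi\<close>; the forward part lies lower, is less curved and hence longer, so every pair
  contributes a positive displacement.\<close>

lemma profile_period_pos:
  assumes "1 < H"
  shows "0 < profile_period H"
proof -
  let ?W = "profile_abscissa H"
  let ?g = "\<lambda>a. ?W a + ?W (a + pi)"
  have d: "(?g has_real_derivative cos a / (2 * sqrt (H - cos a)) - cos a / (2 * sqrt (H + cos a))) (at a)" for a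
    by (auto intro!: derivative_eq_intros DERIV_chain2[OF profile_abscissa_deriv[OF assms]]
        profile_abscissa_deriv[OF assms])
  have pos: "0 < cos a / (2 * sqrt (H - cos a)) - cos a / (2 * sqrt (H + cos a))"
    if "- (pi/2) < a" "a < pi/2" for a
  proof -
    have "0 < cos a" using that by (intro cos_gt_zero_pi) auto
    then have "sqrt (H - cos a) < sqrt (H + cos a)" "0 < sqrt (H - cos a)"
      using cos_less[OF assms, of a] by auto
    then show ?thesis using \<open>0 < cos a\<close> by (auto intro!: divide_strict_left_mono)
  qed
  have "?g (-(pi/2)) < ?g (pi/2)"
  proof (rule DERIV_pos_imp_increasing_open[where f = "?g"])
    show "\<exists>y. DERIV ?g x :> y \<and> 0 < y" if "-(pi/2) < x" "x < pi/2" for x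
      using d pos that by blast
    show "continuous_on {-(pi/2)..pi/2} ?g"
      using d by (meson DERIV_isCont continuous_at_imp_continuous_on)
  qed auto
  \<comment> \<open>\<open>?W (pi/2)\<close> occurs at both ends of the comparison and cancels, so
    the increment of \<open>?g\<close> is exactly one period.\<close>
  moreover have "?W (pi/2 + pi) = ?W (- (pi/2)) + profile_period H"
    using profile_abscissa_shift[OF assms, of "-(pi/2)"] by (simp add: field_simps)
  ultimately show ?thesis by simp
qed

text \<open>The function is the coordinate of the curve point along the normal
  \<open>(- sin a1, cos a1)\<close> of the direction \<open>a1\<close>. All uses rest on the sign of
  \<open>sin (a - a1)\<close> in its derivative.\<close>

lemma support_function_deriv:
  assumes "1 < H"
  shows "((\<lambda>a. cos a1 * sqrt (H - cos a) - sin a1 * profile_abscissa H a)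
    has_real_derivative sin (a - a1) / (2 * sqrt (H - cos a))) (at a)"
  using DERIV_diff[OF DERIV_cmult[OF sqrt_profile_deriv[OF assms, of a], of "cos a1"]
      DERIV_cmult[OF profile_abscissa_deriv[OF assms, of a], of "sin a1"]]
  by (simp add: sin_diff diff_divide_distrib algebra_simps)

text \<open>Convexity of the curve: up to half a turn in either sense, \<open>sin (a - a1)\<close>
  has the sign of \<open>a - a1\<close>, so the curve stays on the left of its tangent at
  \<open>a1\<close>.\<close>

lemma support_function_min:
  assumes "1 < H" "\<bar>a - a1\<bar> < pi"
  shows "cos a1 * sqrt (H - cos a1) - sin a1 * profile_abscissa H a1
    \<le> cos a1 * sqrt (H - cos a) - sin a1 * profile_abscissa H a" (is "?h a1 \<le> ?h a")
proof (cases "a1 \<le> a")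
  case True
  show ?thesis
  proof (rule DERIV_nonneg_imp_nondecreasing[OF True, where f = "?h"])
    fix x assume "a1 \<le> x" "x \<le> a"
    then have "0 \<le> sin (x - a1)" using assms by (intro sin_ge_zero) auto
    then show "\<exists>y. (?h has_real_derivative y) (at x) \<and> 0 \<le> y"
      using support_function_deriv[OF assms(1)] cos_less[OF assms(1), of x]
      by (metis divide_nonneg_nonneg mult_nonneg_nonneg real_sqrt_ge_zero zero_le_numeral less_le diff_ge_0_iff_ge)
  qed
next
  case False
  then have le: "a \<le> a1" by simp
  show ?thesis
  proof (rule DERIV_nonpos_imp_nonincreasing[OF le, where f = "?h"])
    fix x assume "a \<le> x" "x \<le> a1"
    then have "0 \<le> sin (a1 - x)" using assms by (intro sin_ge_zero) auto
    then have "sin (x - a1) \<le> 0" by (metis minus_diff_eq neg_le_0_iff_le sin_minus)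
    then show "\<exists>y. (?h has_real_derivative y) (at x) \<and> y \<le> 0"
      using support_function_deriv[OF assms(1)] cos_less[OF assms(1), of x]
      by (metis divide_nonpos_nonneg mult_nonneg_nonneg real_sqrt_ge_zero zero_le_numeral less_le diff_ge_0_iff_ge)
  qed
qed

text \<open>A local minimum is a critical point, so \<open>a1\<close> and \<open>a2\<close> agree
  modulo \<open>pi\<close>; if they differed by an odd multiple of \<open>pi\<close>, the function
  would decrease strictly just after \<open>a1\<close>. Thus the direction at a point can be
  recovered from the position of nearby curve points, without reference to a
  parametrization.\<close>

lemma support_direction_unique:
  assumes "1 < H" and "0 < e"
    and min: "\<And>a. \<bar>a - a1\<bar> < e \<Longrightarrow>
      cos a2 * sqrt (H - cos a1) - sin a2 * profile_abscissa H a1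
      \<le> cos a2 * sqrt (H - cos a) - sin a2 * profile_abscissa H a"
  shows "cos a2 = cos a1 \<and> sin a2 = sin a1"
proof -
  let ?h = "\<lambda>a. cos a2 * sqrt (H - cos a) - sin a2 * profile_abscissa H a"
  have pos: "0 < 2 * sqrt (H - cos a)" for a using cos_less[OF assms(1), of a] by simp
  have "sin (a1 - a2) / (2 * sqrt (H - cos a1)) = 0"
    by (rule DERIV_local_min[OF support_function_deriv[OF assms(1)] \<open>0 < e\<close>])
      (use min in \<open>simp add: abs_minus_commute\<close>)
  then have s0: "sin (a1 - a2) = 0" using pos[of a1] by simp
  then have "(cos (a1 - a2))\<^sup>2 = 1" using sin_cos_squared_add[of "a1 - a2"] by simp
  then consider "cos (a1 - a2) = 1" | "cos (a1 - a2) = -1" by (auto simp: power2_eq_1_iff)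
  then show ?thesis
  proof cases
    case 1
    have "cos a2 = cos (a1 - (a1 - a2))" "sin a2 = sin (a1 - (a1 - a2))" by simp_all
    then show ?thesis unfolding cos_diff[of a1 "a1 - a2"] sin_diff[of a1 "a1 - a2"] using s0 1 by simp
  next
    case 2
    \<comment> \<open>Closer to \<open>a1\<close> than \<open>e\<close>, where minimality is
      assumed, and not further than 1, which is below \<open>pi\<close>, so that
      \<open>sin (x - a1)\<close> is positive in between.\<close>
    define z where "z = a1 + min (e/2) 1"
    have "z > a1" using \<open>0 < e\<close> by (simp add: z_def)
    have "?h z < ?h a1"
    proof (rule DERIV_neg_imp_decreasing_open[OF \<open>a1 < z\<close>, where f = "?h"])
      fix x assume "a1 < x" "x < z"
      then have "0 < sin (x - a1)" using pi_ge_two by (intro sin_gt_zero) (auto simp: z_def)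
      moreover have "sin (x - a2) = sin (x - a1) * cos (a1 - a2) + cos (x - a1) * sin (a1 - a2)"
        using sin_add[of "x - a1" "a1 - a2"] by simp
      ultimately have "sin (x - a2) < 0" using s0 2 by simp
      then show "\<exists>y. (?h has_real_derivative y) (at x) \<and> y < 0"
        using support_function_deriv[OF assms(1)] pos[of x] divide_neg_pos by blast
    next
      show "continuous_on {a1..z} ?h"
        using support_function_deriv[OF assms(1)] by (meson DERIV_isCont continuous_at_imp_continuous_on)
    qed
    moreover have "\<bar>z - a1\<bar> < e" using \<open>0 < e\<close> by (auto simp: z_def)
    ultimately show ?thesis using min[of z] by simp
  qed
qed

section \<open>Jacobi elliptic functions and the arc length parametrization\<close>

lemma ellF_deriv:
  assumes "0 < p" "p < 1"
  shows "(ellF p has_real_derivative 1 / sqrt (1 - p\<^sup>2 * (sin x)\<^sup>2)) (at x)"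
    and "1 \<le> 1 / sqrt (1 - p\<^sup>2 * (sin x)\<^sup>2)" and "0 < 1 - p\<^sup>2 * (sin x)\<^sup>2"
proof -
  have p2: "p\<^sup>2 < 1" using assms by (simp add: power_less_one_iff)
  have sq: "(sin z)\<^sup>2 \<le> 1" for z :: real using sin_cos_squared_add[of z] zero_le_power2[of "cos z"] by linarith
  have le: "p\<^sup>2 * (sin z)\<^sup>2 \<le> p\<^sup>2" for z
    using mult_left_mono[OF sq, of "p\<^sup>2" z] by simp
  have pos: "0 < 1 - p\<^sup>2 * (sin z)\<^sup>2" for z using le[of z] p2 by linarith
  then show "0 < 1 - p\<^sup>2 * (sin x)\<^sup>2" .
  have "1 - p\<^sup>2 * (sin z)\<^sup>2 \<noteq> 0" for z using pos[of z] by simp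
  then have "continuous_on UNIV (\<lambda>z. 1 / sqrt (1 - p\<^sup>2 * (sin z)\<^sup>2))"
    by (intro continuous_intros) auto
  from LBINT_has_real_derivative[OF this]
  show "(ellF p has_real_derivative 1 / sqrt (1 - p\<^sup>2 * (sin x)\<^sup>2)) (at x)"
    unfolding ellF_def[abs_def] .
  have "sqrt (1 - p\<^sup>2 * (sin x)\<^sup>2) \<le> 1" by simp
  then show "1 \<le> 1 / sqrt (1 - p\<^sup>2 * (sin x)\<^sup>2)" using pos[of x] by (simp add: field_simps)
qed

text \<open>The integrand of \<open>ellF\<close> is at least 1, so \<open>ellF p\<close> is an
  increasing homeomorphism of the line. The definite description in \<open>jacobi_am\<close>
  therefore denotes its inverse, and the inverse function rule gives the derivative.\<close>

lemma jacobi_am_deriv: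
  assumes "0 < p" "p < 1"
  shows "(jacobi_am p has_real_derivative jacobi_dn p s) (at s)" and "jacobi_am p 0 = 0"
proof -
  note ellF_hom = increasing_real_homeomorphism[OF ellF_deriv(1,2)[OF assms] zero_less_one]
  have inj: "inj (ellF p)" using ellF_hom(1) by (simp add: strict_mono_imp_inj_on)
  have am: "jacobi_am p s = inv (ellF p) s" for s
    unfolding jacobi_am_def
    by (rule the_equality) (use inj ellF_hom(2) in \<open>auto simp: surj_f_inv_f\<close>)
  have am': "jacobi_am p = inv (ellF p)" using am by auto
  have F: "ellF p (jacobi_am p s) = s" for s by (simp add: am surj_f_inv_f[OF ellF_hom(2)])
  have "(jacobi_am p has_real_derivative inverse (1 / sqrt (1 - p\<^sup>2 * (sin (jacobi_am p s))\<^sup>2))) (at s)"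
  proof (rule DERIV_inverse_function[where f = "ellF p" and a = "s - 1" and b = "s + 1"])
    show "isCont (jacobi_am p) s"
      using ellF_hom(4) unfolding am' by (simp add: continuous_on_eq_continuous_at)
    show "1 / sqrt (1 - p\<^sup>2 * (sin (jacobi_am p s))\<^sup>2) \<noteq> 0"
      using ellF_deriv(2)[OF assms, of "jacobi_am p s"] by linarith
  qed (use F ellF_deriv(1)[OF assms] in auto)
  then show "(jacobi_am p has_real_derivative jacobi_dn p s) (at s)"
    by (simp add: jacobi_dn_def jacobi_sn_def)
  have "ellF p 0 = 0" by (simp add: ellF_def zero_ereal_def[symmetric])
  then show "jacobi_am p 0 = 0" using inj unfolding am by (metis inv_f_f)
qed

lemma jacobi_dn_bounds:
  assumes "0 < p" "p < 1"
  shows "0 < jacobi_dn p s" "jacobi_dn p s \<le> 1"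
  using ellF_deriv(3)[OF assms, of "jacobi_am p s"] by (simp_all add: jacobi_dn_def jacobi_sn_def)

lemma jacobi_dn_power2:
  assumes "0 < p" "p < 1"
  shows "(jacobi_dn p s)\<^sup>2 = 1 - p\<^sup>2 * (sin (jacobi_am p s))\<^sup>2"
  using ellF_deriv(3)[OF assms, of "jacobi_am p s"] by (simp add: jacobi_dn_def jacobi_sn_def)

lemma jacobi_dn_deriv:
  assumes "0 < p" "p < 1"
  shows "(jacobi_dn p has_real_derivative
    - p\<^sup>2 * sin (jacobi_am p s) * cos (jacobi_am p s)) (at s)"
proof -
  have dn: "sqrt (1 - p\<^sup>2 * (sin (jacobi_am p s))\<^sup>2) = jacobi_dn p s"
    by (simp add: jacobi_dn_def jacobi_sn_def)
  have "((\<lambda>s. 1 - p\<^sup>2 * (sin (jacobi_am p s))\<^sup>2) has_real_derivative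
     - p\<^sup>2 * (2 * sin (jacobi_am p s) * (cos (jacobi_am p s) * jacobi_dn p s))) (at s)"
    by (auto intro!: derivative_eq_intros jacobi_am_deriv(1)[OF assms])
  from DERIV_chain2[OF DERIV_real_sqrt[OF ellF_deriv(3)[OF assms]] this]
  have "((\<lambda>s. sqrt (1 - p\<^sup>2 * (sin (jacobi_am p s))\<^sup>2)) has_real_derivative
     - p\<^sup>2 * sin (jacobi_am p s) * cos (jacobi_am p s)) (at s)"
    unfolding dn by (rule DERIV_cong) (use jacobi_dn_bounds(1)[OF assms, of s] in \<open>simp add: field_simps\<close>)
  then show ?thesis by (simp add: jacobi_dn_def[abs_def] jacobi_sn_def)
qed

text \<open>For the characteristic \<open>p\<^sup>2\<close> the denominator of the integrand is
  \<open>dn\<^sup>2\<close>, the same function that governs \<open>r\<close>. This is why the third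
  elliptic integral appears in \<open>\<psi>\<close> with exactly this characteristic.\<close>

lemma ellPi_deriv:
  assumes "0 < p" "p < 1"
  shows "(ellPi p (p\<^sup>2) has_real_derivative 1 / (jacobi_dn p s)\<^sup>2) (at s)" "ellPi p k 0 = 0"
proof -
  have eq: "1 - p\<^sup>2 * (jacobi_sn p u)\<^sup>2 = (jacobi_dn p u)\<^sup>2" for u
    by (simp add: jacobi_dn_power2[OF assms] jacobi_sn_def)
  have "jacobi_dn p u \<noteq> 0" for u using jacobi_dn_bounds(1)[OF assms, of u] by simp
  moreover have "continuous_on UNIV (jacobi_dn p)"
    using jacobi_dn_deriv[OF assms] by (meson DERIV_isCont continuous_at_imp_continuous_on)
  ultimately have "continuous_on UNIV (\<lambda>u. 1 / (jacobi_dn p u)\<^sup>2)"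
    by (intro continuous_intros) auto
  from LBINT_has_real_derivative[OF this]
  show "(ellPi p (p\<^sup>2) has_real_derivative 1 / (jacobi_dn p s)\<^sup>2) (at s)"
    unfolding ellPi_def[abs_def] eq .
  show "ellPi p k 0 = 0" by (simp add: ellPi_def zero_ereal_def[symmetric])
qed

text \<open>The profile curve in the half-plane is parametrized by Euclidean arc length; the direction
  angle \<open>A\<close> satisfies \<open>A' = 2 / r\<close>.\<close>

lemma jacobi_profile:
  fixes H :: real
  assumes "1 < H" and p: "0 < p" "p\<^sup>2 = 2 / (H + 1)"
  defines "\<Xi> \<equiv> sqrt (H + 1)"
  shows "\<exists>A. strict_mono A \<and> surj A \<and> continuous_on UNIV A \<and> continuous_on UNIV (inv A) \<and>
    (\<forall>t. sqrt (1 / (H - 1)) * jacobi_dn p (\<Xi> * t) = 1 / sqrt (H - cos (A t)) \<and>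
      H * t - (H - 1) * (1 / \<Xi>) * ellPi p (p\<^sup>2) (\<Xi> * t) = profile_abscissa H (A t))"
proof -
  have "p\<^sup>2 < 1" unfolding p(2) using assms(1) by simp
  then have p1: "p < 1" using p(1) by (simp add: power_less_one_iff)
  define dn where "dn = jacobi_dn p"
  define S where "S t = sin (jacobi_am p (\<Xi> * t))" for t
  define K where "K t = cos (jacobi_am p (\<Xi> * t))" for t
  \<comment> \<open>\<open>y\<close> is the height \<open>1 / r\<close>. The candidates for the
    cosine and the sine of the direction are \<open>c\<close>, solved from
    \<open>y\<^sup>2 = H - cos a\<close>, and \<open>s\<close>, the derivative of
    \<open>y\<close>.\<close>
  define y where "y t = sqrt (H - 1) / dn (\<Xi> * t)" for t
  define c where "c t = H - (y t)\<^sup>2" for t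
  define s where "s t = sqrt (H - 1) * \<Xi> * p\<^sup>2 * S t * K t / (dn (\<Xi> * t))\<^sup>2" for t
  have \<Xi>: "\<Xi> > 0" "\<Xi>\<^sup>2 = H + 1" using assms by (auto simp: \<Xi>_def)
  have h: "sqrt (H - 1) > 0" "(sqrt (H - 1))\<^sup>2 = H - 1" using assms by auto
  have dn0: "0 < dn z" "dn z \<le> 1" for z unfolding dn_def using jacobi_dn_bounds[OF p(1) p1] by auto
  have dn2: "(dn (\<Xi> * t))\<^sup>2 = 1 - p\<^sup>2 * (S t)\<^sup>2" for t
    unfolding dn_def S_def using jacobi_dn_power2[OF p(1) p1] .
  have SK: "(S t)\<^sup>2 + (K t)\<^sup>2 = 1" for t by (simp add: S_def K_def)
  have dnd: "((\<lambda>t. dn (\<Xi> * t)) has_real_derivative - p\<^sup>2 * S t * K t * \<Xi>) (at t)" for t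
    unfolding dn_def S_def K_def
    by (rule DERIV_chain2[OF jacobi_dn_deriv[OF p(1) p1]]) (auto intro!: derivative_eq_intros)
  have y0: "0 < y t" "sqrt (H - 1) \<le> y t" for t
    using h dn0[of "\<Xi> * t"] mult_left_mono[of "dn (\<Xi> * t)" 1 "sqrt (H - 1)"] by (auto simp: y_def field_simps)
  have yd: "(y has_real_derivative s t) (at t)" for t
    unfolding y_def[abs_def]
    by (rule DERIV_cong[OF DERIV_divide[OF DERIV_const dnd]])
      (use dn0(1)[of "\<Xi> * t"] in \<open>auto simp: s_def power2_eq_square\<close>)
  have cd: "(c has_real_derivative - (2 * y t) * s t) (at t)" for t
    unfolding c_def[abs_def] by (auto intro!: derivative_eq_intros yd)
  \<comment> \<open>Unit speed. In terms of \<open>q = dn\<^sup>2\<close> both squares are rational,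
    and the value \<open>p\<^sup>2 = 2 / (H + 1)\<close> makes them add up to 1.\<close>
  have circ: "(c t)\<^sup>2 + (s t)\<^sup>2 = 1" for t
  proof -
    define q where "q = (dn (\<Xi> * t))\<^sup>2"
    have q: "q > 0" "q = 1 - p\<^sup>2 * (S t)\<^sup>2"
      unfolding q_def by (rule zero_less_power[OF dn0(1)], rule dn2)
    have c: "c t = H - (H - 1) / q" unfolding c_def y_def q_def by (simp add: power_divide h(2))
    have "(s t)\<^sup>2 = (sqrt (H - 1))\<^sup>2 * \<Xi>\<^sup>2 * (p\<^sup>2 * (S t)\<^sup>2) * (p\<^sup>2 * (K t)\<^sup>2) / q\<^sup>2"
      unfolding s_def q_def by (simp add: power_divide power_mult_distrib mult_ac power2_eq_square)
    also have "\<dots> = (H - 1) * (H + 1) * (p\<^sup>2 * (S t)\<^sup>2) * (p\<^sup>2 * (K t)\<^sup>2) / q\<^sup>2"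
      by (simp only: h(2) \<Xi>(2))
    also have "p\<^sup>2 * (S t)\<^sup>2 = 1 - q" using q by simp
    also have "p\<^sup>2 * (K t)\<^sup>2 = p\<^sup>2 - (1 - q)"
    proof -
      have "p\<^sup>2 * (K t)\<^sup>2 = p\<^sup>2 * ((S t)\<^sup>2 + (K t)\<^sup>2) - p\<^sup>2 * (S t)\<^sup>2" by (simp add: algebra_simps)
      then show ?thesis unfolding SK using q(2) by simp
    qed
    also have "\<dots> = 2 / (H + 1) - (1 - q)" by (simp only: p(2))
    also have "(H - 1) * (H + 1) * (1 - q) * (2 / (H + 1) - (1 - q)) = (H - 1) * (1 - q) * (2 - (H + 1) * (1 - q))"
      using assms(1) by (simp add: field_simps)
    finally have s2: "(s t)\<^sup>2 = (H - 1) * (1 - q) * (2 - (H + 1) * (1 - q)) / q\<^sup>2" .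
    have "(c t)\<^sup>2 = (H * q - (H - 1))\<^sup>2 / q\<^sup>2"
      unfolding c using q(1) by (simp add: field_simps power2_eq_square)
    then have "(c t)\<^sup>2 + (s t)\<^sup>2 = ((H * q - (H - 1))\<^sup>2 + (H - 1) * (1 - q) * (2 - (H + 1) * (1 - q))) / q\<^sup>2"
      by (simp add: s2 add_divide_distrib)
    also have "(H * q - (H - 1))\<^sup>2 + (H - 1) * (1 - q) * (2 - (H + 1) * (1 - q)) = q\<^sup>2"
      by (simp add: power2_eq_square algebra_simps)
    finally show ?thesis using q(1) by simp
  qed
  have ycont: "continuous_on UNIV (\<lambda>t. 2 * y t)"
    using yd by (intro continuous_intros) (meson DERIV_isCont continuous_at_imp_continuous_on)
  \<comment> \<open>The integral starts at 0 because \<open>dn = 1\<close> at the origin: the curve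
    is at its lowest point there and \<open>c 0 = 1\<close>.\<close>
  define A where "A t = (LBINT u=0..ereal t. 2 * y u)" for t
  have Ad: "(A has_real_derivative 2 * y t) (at t)" for t
    unfolding A_def[abs_def] by (rule LBINT_has_real_derivative[OF ycont])
  have A0: "A 0 = 0" by (simp add: A_def zero_ereal_def[symmetric])
  have am0: "jacobi_am p 0 = 0" by (rule jacobi_am_deriv(2)[OF p(1) p1])
  have c0: "c 0 = 1" using h(2) by (simp add: c_def y_def power_divide dn_def jacobi_dn_def jacobi_sn_def am0)
  \<comment> \<open>\<open>s = y'\<close> satisfies \<open>s' = A' c\<close> only after division by \<open>s\<close>; the explicit second derivative avoids this.\<close>
  have sd: "(s has_real_derivative 2 * y t * c t) (at t)" for t
  proof -
    have Sd: "(S has_real_derivative K t * (dn (\<Xi> * t) * \<Xi>)) (at t)" for t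
      unfolding S_def[abs_def] K_def dn_def
      by (auto intro!: derivative_eq_intros DERIV_chain2[OF jacobi_am_deriv(1)[OF p(1) p1]])
    have Kd: "(K has_real_derivative - S t * (dn (\<Xi> * t) * \<Xi>)) (at t)" for t
      unfolding S_def K_def[abs_def] dn_def
      by (auto intro!: derivative_eq_intros DERIV_chain2[OF jacobi_am_deriv(1)[OF p(1) p1]])
    define d where "d = dn (\<Xi> * t)"
    have d: "d > 0" "d\<^sup>2 = 1 - p\<^sup>2 * (S t)\<^sup>2" unfolding d_def by (rule dn0, rule dn2)
    let ?D = "sqrt (H - 1) * \<Xi>\<^sup>2 * p\<^sup>2 * ((K t)\<^sup>2 - (S t)\<^sup>2) / d + 2 * sqrt (H - 1) * \<Xi>\<^sup>2 * p\<^sup>2 * p\<^sup>2 * (S t)\<^sup>2 * (K t)\<^sup>2 / d^3"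
    have num: "((\<lambda>t. sqrt (H - 1) * \<Xi> * p\<^sup>2 * S t * K t) has_real_derivative
        sqrt (H - 1) * \<Xi> * p\<^sup>2 * (((K t)\<^sup>2 - (S t)\<^sup>2) * (d * \<Xi>))) (at t)"
      by (rule DERIV_cong[OF DERIV_mult[OF DERIV_cmult[OF Sd] Kd]])
        (simp add: d_def power2_eq_square algebra_simps)
    have den: "((\<lambda>t. (dn (\<Xi> * t))\<^sup>2) has_real_derivative 2 * d * (- p\<^sup>2 * S t * K t * \<Xi>)) (at t)"
      by (rule DERIV_cong[OF DERIV_power[OF dnd]]) (simp add: d_def)
    have "(s has_real_derivative ?D) (at t)"
      unfolding s_def[abs_def]
      by (rule DERIV_cong[OF DERIV_divide[OF num den]])
        (use d(1) in \<open>auto simp: d_def[symmetric] field_simps power2_eq_square power3_eq_cube\<close>)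
    moreover have "?D = 2 * y t * c t"
    proof -
      have Xp: "\<Xi>\<^sup>2 * p\<^sup>2 = 2" unfolding \<Xi>(2) p(2) using assms(1) by (simp add: field_simps)
      have pS: "p\<^sup>2 * (S t)\<^sup>2 = 1 - d\<^sup>2" using d by simp
      have "?D = sqrt (H - 1) * (\<Xi>\<^sup>2 * p\<^sup>2) * ((K t)\<^sup>2 - (S t)\<^sup>2 + 2 * (p\<^sup>2 * (S t)\<^sup>2) * (K t)\<^sup>2 / d\<^sup>2) / d"
        using d(1) by (simp add: field_simps power2_eq_square power3_eq_cube)
      also have "\<dots> = 2 * sqrt (H - 1) * (2 * (K t)\<^sup>2 / d\<^sup>2 - 1) / d"
      proof -
        have S2: "(S t)\<^sup>2 = 1 - (K t)\<^sup>2" using SK[of t] by simp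
        show ?thesis unfolding pS Xp unfolding S2 using d(1) by (simp add: field_simps)
      qed
      also have "2 * (K t)\<^sup>2 / d\<^sup>2 - 1 = H - (H - 1) / d\<^sup>2"
      proof -
        have "(H + 1) * p\<^sup>2 = 2" using Xp \<Xi>(2) by simp
        then have "(H + 1) * (1 - d\<^sup>2) = 2 * (S t)\<^sup>2" unfolding pS[symmetric] by (simp add: mult.assoc[symmetric])
        then have "2 * (K t)\<^sup>2 = (H + 1) * d\<^sup>2 - (H - 1)"
          using SK[of t] by algebra
        then show ?thesis using d(1) by (simp add: field_simps)
      qed
      also have "\<dots> = c t" by (simp add: c_def y_def d_def power_divide h(2))
      finally show ?thesis by (simp add: y_def d_def)
    qed
    ultimately show ?thesis by simp
  qed
  \<comment> \<open>Inner product of the unit vectors \<open>(c, s)\<close> and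
    \<open>(cos A, sin A)\<close>. Both rotate at rate \<open>2 * y\<close> and agree at 0, so the
    product stays 1 and the vectors coincide.\<close>
  let ?g = "\<lambda>t. c t * cos (A t) + s t * sin (A t)"
  have "(?g has_real_derivative 0) (at t)" for t
    by (rule derivative_eq_intros cd sd Ad refl)+ (simp add: algebra_simps)
  then have g1: "?g t = 1" for t
    using DERIV_isconst_all[of ?g t 0] by (simp add: A0 c0)
  have cA: "c t = cos (A t)" for t
  proof -
    have "(c t - cos (A t))\<^sup>2 + (s t - sin (A t))\<^sup>2 = 0"
      using circ[of t] sin_cos_squared_add[of "A t"] g1[of t] by (simp add: power2_eq_square algebra_simps)
    then show ?thesis by (simp add: sum_power2_eq_zero_iff)
  qed
  have yA: "y t = sqrt (H - cos (A t))" for t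
  proof (rule real_sqrt_unique[symmetric])
    show "(y t)\<^sup>2 = H - cos (A t)" unfolding cA[symmetric] by (simp add: c_def)
  qed (rule less_imp_le[OF y0(1)])
  let ?w = "\<lambda>t. H * t - (H - 1) * (1 / \<Xi>) * ellPi p (p\<^sup>2) (\<Xi> * t) - profile_abscissa H (A t)"
  have "(?w has_real_derivative 0) (at t)" for t
  proof -
    have 1: "((\<lambda>t. ellPi p (p\<^sup>2) (\<Xi> * t)) has_real_derivative 1 / (dn (\<Xi> * t))\<^sup>2 * \<Xi>) (at t)"
      unfolding dn_def
      by (rule DERIV_chain2[OF ellPi_deriv(1)[OF p(1) p1]]) (auto intro!: derivative_eq_intros)
    have "((\<lambda>t. profile_abscissa H (A t)) has_real_derivative cos (A t) / (2 * sqrt (H - cos (A t))) * (2 * y t)) (at t)"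
      by (rule DERIV_chain2[OF profile_abscissa_deriv[OF assms(1)] Ad])
    then have 2: "((\<lambda>t. profile_abscissa H (A t)) has_real_derivative c t) (at t)"
      using y0(1)[of t] by (simp add: yA[symmetric] cA)
    have c: "c t = H - (H - 1) / (dn (\<Xi> * t))\<^sup>2" unfolding c_def y_def by (simp add: power_divide h(2))
    show ?thesis
      by (rule derivative_eq_intros 1 2 refl)+ (use \<Xi>(1) in \<open>simp add: c\<close>)
  qed
  then have w: "?w t = 0" for t
    using DERIV_isconst_all[of ?w t 0] by (simp add: A0 ellPi_deriv(2)[OF p(1) p1])
  have r: "sqrt (1 / (H - 1)) * jacobi_dn p (\<Xi> * t) = 1 / sqrt (H - cos (A t))" for t
    unfolding yA[symmetric] by (simp add: y_def dn_def real_sqrt_divide)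
  \<comment> \<open>Since \<open>dn \<le> 1\<close>, the angle grows at a rate bounded away from 0,
    so it runs through the whole line.\<close>
  have m: "2 * sqrt (H - 1) \<le> 2 * y t" for t using y0(2) by simp
  have "0 < 2 * sqrt (H - 1)" using h by simp
  from increasing_real_homeomorphism[OF Ad m this] r w show ?thesis by auto
qed

section \<open>Gradients and second derivatives in the plane\<close>

text \<open>The differential is recorded through its partials \<open>p i\<close>. As
  \<open>u\<close> varies these are scalar functions to which the predicate applies again, which
  covers second derivatives, and uniqueness allows comparison of coefficients.\<close>

definition has_gradient :: "(real^2 \<Rightarrow> real) \<Rightarrow> (2 \<Rightarrow> real) \<Rightarrow> real^2 \<Rightarrow> bool" where
  "has_gradient h p u \<longleftrightarrow> (h has_derivative (\<lambda>w. \<Sum>i\<in>UNIV. p i * w $ i)) (at u)"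

lemma has_gradient_unique:
  assumes "has_gradient h p u" "has_gradient h q u"
  shows "p i = q i"
proof -
  have "(\<lambda>w. \<Sum>i\<in>UNIV. p i * w $ i) = (\<lambda>w::real^2. \<Sum>i\<in>UNIV. q i * w $ i)"
    using assms unfolding has_gradient_def by (rule has_derivative_unique)
  from fun_cong[OF this, of "axis i 1"] show ?thesis
    by (simp add: axis_def if_distrib cong: if_cong)
qed

lemma has_gradient_cong:
  "has_gradient f p u \<Longrightarrow> (\<And>i. p i = q i) \<Longrightarrow> has_gradient f q u"
  by (simp add: has_gradient_def)

lemma has_gradient_const: "has_gradient (\<lambda>_. k) (\<lambda>_. 0) u"
  by (simp add: has_gradient_def)

lemma has_gradient_diff:
  assumes "has_gradient f p u" "has_gradient g q u"
  shows "has_gradient (\<lambda>u. f u - g u) (\<lambda>i. p i - q i) u"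
  using has_derivative_diff[OF assms[unfolded has_gradient_def]]
  by (simp add: has_gradient_def sum_subtractf left_diff_distrib)

lemma has_gradient_add:
  assumes "has_gradient f p u" "has_gradient g q u"
  shows "has_gradient (\<lambda>u. f u + g u) (\<lambda>i. p i + q i) u"
  using has_derivative_add[OF assms[unfolded has_gradient_def]]
  by (simp add: has_gradient_def sum.distrib distrib_right)

lemma has_gradient_mult:
  assumes "has_gradient f p u" "has_gradient g q u"
  shows "has_gradient (\<lambda>u. f u * g u) (\<lambda>i. p i * g u + f u * q i) u"
  using has_derivative_mult[OF assms[unfolded has_gradient_def]]
  by (simp add: has_gradient_def sum.distrib sum_distrib_left sum_distrib_right algebra_simps)

lemma has_gradient_cmult:
  assumes "has_gradient f p u"
  shows "has_gradient (\<lambda>u. k * f u) (\<lambda>i. k * p i) u"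
  using has_gradient_mult[OF has_gradient_const assms, of k] by simp

lemma has_gradient_chain:
  assumes "has_gradient f p u" "(F has_real_derivative D) (at (f u))"
  shows "has_gradient (\<lambda>u. F (f u)) (\<lambda>i. D * p i) u"
  using has_derivative_compose[OF assms(1)[unfolded has_gradient_def] assms(2)[unfolded has_field_derivative_def]]
  by (simp add: has_gradient_def sum_distrib_left mult.assoc)

lemma has_gradient_divide:
  assumes "has_gradient f p u" "has_gradient g q u" "g u \<noteq> 0"
  shows "has_gradient (\<lambda>u. f u / g u) (\<lambda>i. (p i * g u - f u * q i) / (g u)\<^sup>2) u"
proof -
  have inv: "has_gradient (\<lambda>u. inverse (g u)) (\<lambda>i. - inverse ((g u)\<^sup>2) * q i) u"
    by (rule has_gradient_chain[OF assms(2)])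
      (use assms(3) in \<open>auto intro!: derivative_eq_intros simp: power2_eq_square\<close>)
  show ?thesis
    unfolding divide_inverse[of "f _" "g _"]
    by (rule has_gradient_cong[OF has_gradient_mult[OF assms(1) inv]])
      (use assms(3) in \<open>simp add: field_simps power2_eq_square\<close>)
qed

lemma has_gradient_continuous: "has_gradient h p u \<Longrightarrow> isCont h u"
  unfolding has_gradient_def by (rule has_derivative_continuous)

lemma has_gradient_continuous_on: "(\<And>u. u \<in> U \<Longrightarrow> has_gradient h (p u) u) \<Longrightarrow> continuous_on U h"
  by (meson has_gradient_continuous continuous_at_imp_continuous_on)

lemma has_gradient_transfer:
  assumes "has_gradient f p u" "open U" "u \<in> U" "\<And>z. z \<in> U \<Longrightarrow> f z = g z"
  shows "has_gradient g p u"
  using assms(1) unfolding has_gradient_def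
  by (rule has_derivative_transform_within_open) (use assms in auto)

lemma zero_gradient_constant:
  assumes "open U" "convex U" "\<And>u. u \<in> U \<Longrightarrow> has_gradient f (p u) u"
    and "\<And>u i. u \<in> U \<Longrightarrow> p u i = 0" and "x \<in> U" "y \<in> U"
  shows "f x = f y"
proof (rule has_derivative_zero_unique[OF assms(2) _ assms(5,6)])
  fix u assume "u \<in> U"
  then have "(f has_derivative (\<lambda>_. 0)) (at u)"
    using assms(3)[of u] assms(4)[of u] by (simp add: has_gradient_def)
  then show "(f has_derivative (\<lambda>_. 0)) (at u within U)" by (rule has_derivative_at_withinI)
qed

lemma has_gradient_line:
  assumes "has_gradient h p (x + s *\<^sub>R axis i 1)"
  shows "((\<lambda>s. h (x + s *\<^sub>R axis i 1)) has_real_derivative p i) (at s)"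
proof -
  have 1: "((\<lambda>s. x + s *\<^sub>R axis i 1) has_derivative (\<lambda>s. s *\<^sub>R axis i 1)) (at s)"
    by (auto intro!: derivative_eq_intros)
  have "((\<lambda>s. h (x + s *\<^sub>R axis i 1)) has_derivative (\<lambda>s. \<Sum>j\<in>UNIV. p j * (s *\<^sub>R axis i 1) $ j)) (at s)"
    by (rule has_derivative_compose[OF 1]) (use assms in \<open>simp add: has_gradient_def\<close>)
  moreover have "(\<lambda>s. \<Sum>j\<in>UNIV. p j * (s *\<^sub>R axis i 1) $ j) = (\<lambda>s. p i * s)"
    by (auto simp: axis_def if_distrib cong: if_cong)
  ultimately show ?thesis by (simp add: has_field_derivative_def)
qed

text \<open>The mean value theorem is used twice: in direction \<open>i\<close> for the increment
  over the step in direction \<open>j\<close>, then in direction \<open>j\<close> for the partial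
  \<open>p i\<close>.\<close>

lemma second_difference:
  assumes h: "\<And>u. u \<in> ball x r \<Longrightarrow> has_gradient h (\<lambda>i. p i u) u"
    and p: "\<And>u. u \<in> ball x r \<Longrightarrow> has_gradient (p i) (\<lambda>j. q j u) u"
    and t: "0 < t" "2 * t < r"
  shows "\<exists>z. dist x z < 2 * t \<and> h (x + t *\<^sub>R axis i 1 + t *\<^sub>R axis j 1) - h (x + t *\<^sub>R axis i 1)
    - h (x + t *\<^sub>R axis j 1) + h x = t\<^sup>2 * q j z"
proof -
  let ?i = "axis i 1 :: real^2" and ?j = "axis j 1 :: real^2"
  have near: "dist x (x + a *\<^sub>R ?i + b *\<^sub>R ?j) \<le> a + b" if "0 \<le> a" "0 \<le> b" for a b
  proof -
    have "norm (a *\<^sub>R ?i + b *\<^sub>R ?j) \<le> norm (a *\<^sub>R ?i) + norm (b *\<^sub>R ?j)" by (rule norm_triangle_ineq)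
    moreover have "dist x (x + a *\<^sub>R ?i + b *\<^sub>R ?j) = norm (a *\<^sub>R ?i + b *\<^sub>R ?j)"
      by (simp add: dist_norm add.assoc norm_minus_cancel[symmetric, of "a *\<^sub>R ?i + b *\<^sub>R ?j"] del: norm_minus_cancel)
    ultimately show ?thesis using that by simp
  qed
  have in_ball: "x + a *\<^sub>R ?i + b *\<^sub>R ?j \<in> ball x r" if "0 \<le> a" "0 \<le> b" "a \<le> t" "b \<le> t" for a b
    using near[OF that(1,2)] that t by auto
  let ?g = "\<lambda>s. h (x + s *\<^sub>R ?i + t *\<^sub>R ?j) - h (x + s *\<^sub>R ?i)"
  have "\<exists>s>0. s < t \<and> ?g t - ?g 0 = (t - 0) * (p i (x + s *\<^sub>R ?i + t *\<^sub>R ?j) - p i (x + s *\<^sub>R ?i))"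
  proof (rule MVT2[OF \<open>0 < t\<close>, of ?g])
    fix s assume s: "0 \<le> s" "s \<le> t"
    have "((\<lambda>s. h ((x + t *\<^sub>R ?j) + s *\<^sub>R ?i)) has_real_derivative p i ((x + t *\<^sub>R ?j) + s *\<^sub>R ?i)) (at s)"
      by (rule has_gradient_line[of _ "\<lambda>i. p i ((x + t *\<^sub>R ?j) + s *\<^sub>R ?i)"])
        (use h[OF in_ball[of s t]] s t in \<open>simp add: ac_simps\<close>)
    then have 1: "((\<lambda>s. h (x + s *\<^sub>R ?i + t *\<^sub>R ?j)) has_real_derivative p i (x + s *\<^sub>R ?i + t *\<^sub>R ?j)) (at s)"
      by (simp add: ac_simps)
    have 2: "((\<lambda>s. h (x + s *\<^sub>R ?i)) has_real_derivative p i (x + s *\<^sub>R ?i)) (at s)"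
      by (rule has_gradient_line[of _ "\<lambda>i. p i (x + s *\<^sub>R ?i)"])
        (use h[OF in_ball[of s 0]] s t in simp)
    show "(?g has_real_derivative p i (x + s *\<^sub>R ?i + t *\<^sub>R ?j) - p i (x + s *\<^sub>R ?i)) (at s)"
      by (rule DERIV_diff[OF 1 2])
  qed
  then obtain s where s: "0 < s" "s < t"
    "?g t - ?g 0 = t * (p i (x + s *\<^sub>R ?i + t *\<^sub>R ?j) - p i (x + s *\<^sub>R ?i))" by auto
  let ?k = "\<lambda>b. p i (x + s *\<^sub>R ?i + b *\<^sub>R ?j)"
  have "\<exists>b>0. b < t \<and> ?k t - ?k 0 = (t - 0) * q j (x + s *\<^sub>R ?i + b *\<^sub>R ?j)"
  proof (rule MVT2[OF \<open>0 < t\<close>, of ?k])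
    fix b assume b: "0 \<le> b" "b \<le> t"
    show "(?k has_real_derivative q j (x + s *\<^sub>R ?i + b *\<^sub>R ?j)) (at b)"
      by (rule has_gradient_line[of _ "\<lambda>j. q j (x + s *\<^sub>R ?i + b *\<^sub>R ?j)"])
        (use p[OF in_ball[of s b]] s b in simp)
  qed
  then obtain b where b: "0 < b" "b < t" "?k t - ?k 0 = t * q j (x + s *\<^sub>R ?i + b *\<^sub>R ?j)" by auto
  have "dist x (x + s *\<^sub>R ?i + b *\<^sub>R ?j) < 2 * t" using near[of s b] s b by simp
  moreover have "h (x + t *\<^sub>R ?i + t *\<^sub>R ?j) - h (x + t *\<^sub>R ?i) - h (x + t *\<^sub>R ?j) + h x
    = t\<^sup>2 * q j (x + s *\<^sub>R ?i + b *\<^sub>R ?j)"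
    using s(3) b(3) by (simp add: power2_eq_square)
  ultimately show ?thesis by blast
qed

text \<open>The second difference is symmetric in \<open>i\<close> and \<open>j\<close>. Divided by
  \<open>t\<^sup>2\<close> it equals either mixed partial at some point near \<open>x\<close>, and
  continuity carries the equality to \<open>x\<close>.\<close>

lemma second_partials_symmetric:
  assumes "open U" "x \<in> U"
    and h: "\<And>u. u \<in> U \<Longrightarrow> has_gradient h (\<lambda>i. p i u) u"
    and p: "\<And>u i. u \<in> U \<Longrightarrow> has_gradient (p i) (\<lambda>j. q i j u) u"
    and q: "\<And>i j. continuous_on U (q i j)"
  shows "q i j x = q j i x"
proof (rule ccontr)
  assume ne: "q i j x \<noteq> q j i x"
  define e where "e = \<bar>q i j x - q j i x\<bar> / 2"
  have "e > 0" using ne by (simp add: e_def)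
  have lim: "\<exists>d>0. \<forall>z. dist x z < d \<longrightarrow> \<bar>q i j z - q i j x\<bar> < e" for i j
  proof -
    have "isCont (q i j) x" using q assms(1,2) by (simp add: continuous_on_eq_continuous_at)
    then show ?thesis using \<open>e > 0\<close> unfolding continuous_at_eps_delta
      by (metis dist_commute dist_real_def)
  qed
  obtain d1 where d1: "d1 > 0" "\<And>z. dist x z < d1 \<Longrightarrow> \<bar>q i j z - q i j x\<bar> < e" using lim by blast
  obtain d2 where d2: "d2 > 0" "\<And>z. dist x z < d2 \<Longrightarrow> \<bar>q j i z - q j i x\<bar> < e" using lim by blast
  obtain r where r: "r > 0" "ball x r \<subseteq> U" using assms(1,2) openE by blast
  define t where "t = min (min d1 d2) r / 3"
  have t: "0 < t" "2 * t < r" "2 * t \<le> d1" "2 * t \<le> d2" using d1 d2 r by (auto simp: t_def)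
  obtain z1 where z1: "dist x z1 < 2 * t" "h (x + t *\<^sub>R axis i 1 + t *\<^sub>R axis j 1) - h (x + t *\<^sub>R axis i 1)
    - h (x + t *\<^sub>R axis j 1) + h x = t\<^sup>2 * q i j z1"
    using second_difference[of x r h p i "q i" t j] h p r(2) t by blast
  obtain z2 where z2: "dist x z2 < 2 * t" "h (x + t *\<^sub>R axis j 1 + t *\<^sub>R axis i 1) - h (x + t *\<^sub>R axis j 1)
    - h (x + t *\<^sub>R axis i 1) + h x = t\<^sup>2 * q j i z2"
    using second_difference[of x r h p j "q j" t i] h p r(2) t by blast
  have "t\<^sup>2 * q i j z1 = t\<^sup>2 * q j i z2" using z1(2) z2(2) by (simp add: algebra_simps)
  then have "q i j z1 = q j i z2" using t(1) by simp
  then show False using d1(2)[of z1] d2(2)[of z2] z1(1) z2(1) t(3,4) by (simp add: e_def abs_if split: if_splits)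
qed

text \<open>A nonzero partial makes the differential onto the line, with a right inverse along axis
  \<open>i\<close>; the open mapping theorem for continuous maps differentiable at a point
  applies.\<close>

lemma gradient_open_map:
  assumes "open T" "u \<in> T" "continuous_on T a" "has_gradient a p u" "p i \<noteq> 0"
  shows "a u \<in> interior (a ` T)"
proof (rule sussmann_open_mapping[of T a u "\<lambda>w. \<Sum>i\<in>UNIV. p i * w $ i" "\<lambda>z. (z / p i) *\<^sub>R axis i 1"])
  show "(\<lambda>w. \<Sum>i\<in>UNIV. p i * w $ i) \<circ> (\<lambda>z. (z / p i) *\<^sub>R axis i 1) = id"
    using assms(5) by (auto simp: fun_eq_iff axis_def if_distrib cong: if_cong)
  show "bounded_linear (\<lambda>z. (z / p i) *\<^sub>R axis i 1 :: real^2)"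
    by (intro bounded_linear_intros bounded_linear_divide)
qed (use assms in \<open>auto simp: has_gradient_def interior_open\<close>)

section \<open>The curvature equation in a chart whose image is tangent to the rulings\<close>

text \<open>Coefficients of the Euclidean metric of 3-space pulled back by a map whose three
  coordinates have the partials \<open>a\<close>, \<open>b\<close> and \<open>c\<close>.\<close>

definition euclidean_form :: "(2 \<Rightarrow> real) \<Rightarrow> (2 \<Rightarrow> real) \<Rightarrow> (2 \<Rightarrow> real) \<Rightarrow> 2 \<Rightarrow> 2 \<Rightarrow> real" where
  "euclidean_form a b c i j = a i * a j + b i * b j + c i * c j"

lemma isCont_positive_nearby:
  fixes f :: "'a::metric_space \<Rightarrow> real"
  assumes "isCont f x" "0 < f x"
  obtains r where "0 < r" "\<And>u. dist u x < r \<Longrightarrow> 0 < f u"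
proof -
  obtain r where "0 < r" "\<And>u. dist u x < r \<Longrightarrow> dist (f u) (f x) < f x"
    using assms unfolding continuous_at_eps_delta by blast
  then show ?thesis using that[of r] by (force simp: dist_real_def)
qed

text \<open>Half-space data of one chart. In \<open>cmc\<close>, \<open>(0, - s, C)\<close> is the
  Euclidean unit normal at the point in question and \<open>h\<close> the Euclidean second
  fundamental form; the equation is the conformal law for \<open>H\<close> multiplied by twice the
  Gram determinant. The normal has no component along the rulings, so \<open>th\<close> enters only
  through its first derivatives in the metric.\<close>

locale profile_chart =
  fixes U :: "(real^2) set" and H :: real and ps y :: "real^2 \<Rightarrow> real"
    and th1 ps1 y1 :: "2 \<Rightarrow> real^2 \<Rightarrow> real" and ps2 y2 :: "2 \<Rightarrow> 2 \<Rightarrow> real^2 \<Rightarrow> real"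
  assumes open_U: "open U" and H1: "1 < H" and y_pos: "u \<in> U \<Longrightarrow> 0 < y u"
    and ps1: "u \<in> U \<Longrightarrow> has_gradient ps (\<lambda>i. ps1 i u) u"
    and y1: "u \<in> U \<Longrightarrow> has_gradient y (\<lambda>i. y1 i u) u"
    and ps2: "u \<in> U \<Longrightarrow> has_gradient (ps1 i) (\<lambda>j. ps2 i j u) u"
    and y2: "u \<in> U \<Longrightarrow> has_gradient (y1 i) (\<lambda>j. y2 i j u) u"
    and cont2: "continuous_on U (ps2 i j)" "continuous_on U (y2 i j)"
    and rank_le_1: "u \<in> U \<Longrightarrow> ps1 1 u * y1 2 u = ps1 2 u * y1 1 u"
    and immersed: "u \<in> U \<Longrightarrow> th1 1 u * ps1 2 u \<noteq> th1 2 u * ps1 1 u \<or> th1 1 u * y1 2 u \<noteq> th1 2 u * y1 1 u"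
    and cmc: "u \<in> U \<Longrightarrow> \<exists>C s. C\<^sup>2 + s\<^sup>2 = 1 \<and> (\<forall>i. s * ps1 i u = C * y1 i u) \<and>
      (let g = euclidean_form (\<lambda>i. th1 i u) (\<lambda>i. ps1 i u) (\<lambda>i. y1 i u);
           h = (\<lambda>i j. C * y2 i j u - s * ps2 i j u)
       in 2 * (H - C) * (g 1 1 * g 2 2 - g 1 2 * g 1 2) =
          y u * (g 2 2 * h 1 1 - g 1 2 * (h 1 2 + h 2 1) + g 1 1 * h 2 2))"
begin

lemma rank_le_1': "u \<in> U \<Longrightarrow> ps1 i u * y1 j u = ps1 j u * y1 i u"
  using rank_le_1[of u] exhaust_2[of i] exhaust_2[of j] by auto

text \<open>Normalizing one nonzero partial derivative of \<open>(ps, y)\<close> gives a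
  differentiable direction \<open>(C0, s0)\<close>, and rank one turns the whole differential into
  this direction times a one-form \<open>t0\<close>. Symmetry of the second partials makes the
  derivative \<open>al\<close> of the angle a multiple of \<open>t0\<close>; the factor
  \<open>ka\<close> is the curvature. The pointwise normals determine the direction only up to a
  sign \<open>e\<close>, which is shown to be constant and then absorbed into all
  quantities.\<close>

lemma direction_field:
  assumes "u0 \<in> U"
  shows "\<exists>r C s \<tau> \<kappa>. 0 < r \<and> ball u0 r \<subseteq> U \<and> (\<forall>u\<in>ball u0 r. (C u)\<^sup>2 + (s u)\<^sup>2 = 1 \<and>
    (\<forall>i. ps1 i u = C u * \<tau> i u) \<and> (\<forall>i. y1 i u = s u * \<tau> i u) \<and>
    has_gradient C (\<lambda>i. - s u * \<kappa> u * \<tau> i u) u \<and> has_gradient s (\<lambda>i. C u * \<kappa> u * \<tau> i u) u \<and>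
    \<kappa> u * y u = 2 * (H - C u) \<and> (\<exists>i. \<tau> i u \<noteq> 0))"
proof -
  obtain k where k: "ps1 k u0 \<noteq> 0 \<or> y1 k u0 \<noteq> 0" using immersed[OF assms] by (metis mult_zero_right)
  define R where "R u = (ps1 k u)\<^sup>2 + (y1 k u)\<^sup>2" for u
  have cont1: "continuous_on U (ps1 i)" "continuous_on U (y1 i)" for i
    by (rule has_gradient_continuous_on[OF ps2], assumption)
      (rule has_gradient_continuous_on[OF y2], assumption)
  have "continuous_on U R" unfolding R_def[abs_def] by (intro continuous_intros cont1)
  then have "isCont R u0" using assms open_U by (simp add: continuous_on_eq_continuous_at)
  moreover have "0 < R u0" using k by (auto simp: R_def sum_power2_gt_zero_iff)
  ultimately obtain r1 where r1: "r1 > 0" "\<And>u. dist u u0 < r1 \<Longrightarrow> 0 < R u"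
    by (rule isCont_positive_nearby) blast
  obtain r2 where r2: "r2 > 0" "ball u0 r2 \<subseteq> U" using assms open_U openE by blast
  define r where "r = min r1 r2"
  define B where "B = ball u0 r"
  have r: "0 < r" "B \<subseteq> U" "\<And>u. u \<in> B \<Longrightarrow> 0 < R u" "u0 \<in> B"
    using r1 r2 by (auto simp: r_def B_def dist_commute)
  have BU: "u \<in> U" if "u \<in> B" for u using that r by auto
  define C0 where "C0 u = ps1 k u / sqrt (R u)" for u
  define s0 where "s0 u = y1 k u / sqrt (R u)" for u
  \<comment> \<open>Derivative of the polar angle of \<open>(ps1 k, y1 k)\<close>.\<close>
  define al where "al j u = (ps1 k u * y2 k j u - y1 k u * ps2 k j u) / R u" for j u
  define t0 where "t0 i u = C0 u * ps1 i u + s0 u * y1 i u" for i u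
  have unit: "(C0 u)\<^sup>2 + (s0 u)\<^sup>2 = 1" if "u \<in> B" for u
  proof -
    have "(C0 u)\<^sup>2 + (s0 u)\<^sup>2 = ((ps1 k u)\<^sup>2 + (y1 k u)\<^sup>2) / (sqrt (R u))\<^sup>2"
      by (simp only: C0_def s0_def power_divide add_divide_distrib)
    also have "\<dots> = R u / R u" using r(3)[OF that] by (simp flip: R_def)
    finally show ?thesis using r(3)[OF that] by simp
  qed
  have Rgrad: "has_gradient R (\<lambda>j. 2 * (ps1 k u * ps2 k j u + y1 k u * y2 k j u)) u" if "u \<in> B" for u
    unfolding R_def[abs_def] power2_eq_square
    by (rule has_gradient_cong[OF has_gradient_add[OF has_gradient_mult[OF ps2 ps2] has_gradient_mult[OF y2 y2]]])
      (use BU[OF that] in \<open>auto simp: algebra_simps\<close>)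
  have sqrtR: "has_gradient (\<lambda>u. sqrt (R u)) (\<lambda>j. (ps1 k u * ps2 k j u + y1 k u * y2 k j u) / sqrt (R u)) u"
    if "u \<in> B" for u
    by (rule has_gradient_cong[OF has_gradient_chain[OF Rgrad[OF that] DERIV_real_sqrt]])
      (use r(3)[OF that] in \<open>auto simp: field_simps\<close>)
  have R': "sqrt (R u) > 0" "sqrt (R u) * sqrt (R u) = (ps1 k u)\<^sup>2 + (y1 k u)\<^sup>2" "R u = sqrt (R u) * sqrt (R u)"
    if "u \<in> B" for u using r(3)[OF that] by (auto simp: R_def)
  have C0grad: "has_gradient C0 (\<lambda>j. - s0 u * al j u) u" if "u \<in> B" for u
    unfolding C0_def[abs_def]
  proof (rule has_gradient_cong[OF has_gradient_divide[OF ps2 sqrtR]])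
    fix j
    define q where "q = sqrt (R u)"
    have q: "q > 0" "R u = q * q" "q * q = (ps1 k u)\<^sup>2 + (y1 k u)\<^sup>2" using R'[OF that] by (auto simp: q_def)
    have "ps2 k j u * q - ps1 k u * ((ps1 k u * ps2 k j u + y1 k u * y2 k j u) / q)
      = (ps2 k j u * (q * q) - ps1 k u * (ps1 k u * ps2 k j u + y1 k u * y2 k j u)) / q"
      using q(1) by (simp add: field_simps)
    also have "ps2 k j u * (q * q) - ps1 k u * (ps1 k u * ps2 k j u + y1 k u * y2 k j u)
      = - y1 k u * (ps1 k u * y2 k j u - y1 k u * ps2 k j u)"
      unfolding q(3) by (simp add: power2_eq_square algebra_simps)
    finally show "(ps2 k j u * sqrt (R u) - ps1 k u * ((ps1 k u * ps2 k j u + y1 k u * y2 k j u) / sqrt (R u))) / (sqrt (R u))\<^sup>2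
      = - s0 u * al j u"
      unfolding s0_def al_def q_def[symmetric] using q(1,2) by (simp add: power2_eq_square)
  qed (use that BU[OF that] R'(1)[OF that] in auto)
  have s0grad: "has_gradient s0 (\<lambda>j. C0 u * al j u) u" if "u \<in> B" for u
    unfolding s0_def[abs_def]
  proof (rule has_gradient_cong[OF has_gradient_divide[OF y2 sqrtR]])
    fix j
    define q where "q = sqrt (R u)"
    have q: "q > 0" "R u = q * q" "q * q = (ps1 k u)\<^sup>2 + (y1 k u)\<^sup>2" using R'[OF that] by (auto simp: q_def)
    have "y2 k j u * q - y1 k u * ((ps1 k u * ps2 k j u + y1 k u * y2 k j u) / q)
      = (y2 k j u * (q * q) - y1 k u * (ps1 k u * ps2 k j u + y1 k u * y2 k j u)) / q"
      using q(1) by (simp add: field_simps)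
    also have "y2 k j u * (q * q) - y1 k u * (ps1 k u * ps2 k j u + y1 k u * y2 k j u)
      = ps1 k u * (ps1 k u * y2 k j u - y1 k u * ps2 k j u)"
      unfolding q(3) by (simp add: power2_eq_square algebra_simps)
    finally show "(y2 k j u * sqrt (R u) - y1 k u * ((ps1 k u * ps2 k j u + y1 k u * y2 k j u) / sqrt (R u))) / (sqrt (R u))\<^sup>2
      = C0 u * al j u"
      unfolding C0_def al_def q_def[symmetric] using q(1,2) by (simp add: power2_eq_square)
  qed (use that BU[OF that] R'(1)[OF that] in auto)
  have par: "s0 u * ps1 i u - C0 u * y1 i u = 0" if "u \<in> B" for u i
    using rank_le_1'[OF BU[OF that], of i k] by (simp add: s0_def C0_def diff_divide_distrib[symmetric] mult.commute)
  have psC: "ps1 i u = C0 u * t0 i u" and yS: "y1 i u = s0 u * t0 i u" if "u \<in> B" for u i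
    using unit[OF that] par[OF that, of i] unfolding t0_def by algebra+
  have h0: "C0 u * y2 i j u - s0 u * ps2 i j u = al j u * t0 i u" if "u \<in> B" for u i j
  proof -
    have "has_gradient (\<lambda>u. s0 u * ps1 i u - C0 u * y1 i u)
      (\<lambda>j. (C0 u * al j u * ps1 i u + s0 u * ps2 i j u) - (- s0 u * al j u * y1 i u + C0 u * y2 i j u)) u"
      by (intro has_gradient_diff has_gradient_mult s0grad C0grad ps2 y2 that BU)
    moreover have "has_gradient (\<lambda>u. s0 u * ps1 i u - C0 u * y1 i u) (\<lambda>_. 0) u"
      by (rule has_gradient_transfer[OF has_gradient_const[of 0], of B])
        (use that par in \<open>auto simp: B_def\<close>)
    ultimately have "(C0 u * al j u * ps1 i u + s0 u * ps2 i j u) - (- s0 u * al j u * y1 i u + C0 u * y2 i j u) = 0"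
      by (rule has_gradient_unique)
    then show ?thesis by (simp add: t0_def algebra_simps)
  qed
  \<comment> \<open>By \<open>h0\<close> the product is the second derivative of
    \<open>(ps, y)\<close> in the normal direction, hence symmetric in \<open>i\<close> and
    \<open>j\<close>.\<close>
  have sym: "al j u * t0 i u = al i u * t0 j u" if "u \<in> B" for u i j
  proof -
    have "ps2 i j u = ps2 j i u"
      by (rule second_partials_symmetric[OF open_U BU[OF that] ps1 ps2 cont2(1)])
    moreover have "y2 i j u = y2 j i u"
      by (rule second_partials_symmetric[OF open_U BU[OF that] y1 y2 cont2(2)])
    ultimately show ?thesis using h0[OF that, of i j] h0[OF that, of j i] by simp
  qed
  define ka where "ka u = al k u / t0 k u" for u
  have t0k: "t0 k u = sqrt (R u)" if "u \<in> B" for u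
  proof -
    have "t0 k u = R u / sqrt (R u)"
      by (simp add: t0_def C0_def s0_def R_def add_divide_distrib power2_eq_square)
    then show ?thesis using r(3)[OF that] by (simp add: real_div_sqrt)
  qed
  have t0k0: "t0 k u \<noteq> 0" if "u \<in> B" for u using t0k[OF that] R'(1)[OF that] by linarith
  have al: "al j u = ka u * t0 j u" if "u \<in> B" for u j
    using sym[OF that, of j k] t0k0[OF that] by (simp add: ka_def field_simps)
  \<comment> \<open>Multiplying \<open>2 * (H - e * C0) = e * ka * y\<close> by the sign
    \<open>e\<close> and solving for it gives \<open>e = (2 * C0 + ka * y) / (2 * H)\<close>. The
    sign thus becomes a continuous function of the point, although the normal was chosen point by
    point.\<close>
  have curv: "(2 * C0 u + ka u * y u) / (2 * H) \<in> {-1, 1} \<and>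
      2 * (H - (2 * C0 u + ka u * y u) / (2 * H) * C0 u) = (2 * C0 u + ka u * y u) / (2 * H) * ka u * y u"
    if "u \<in> B" for u
  proof -
    note uB = that
    obtain C s where Cs: "C\<^sup>2 + s\<^sup>2 = 1" "\<And>i. s * ps1 i u = C * y1 i u" and
      eq: "let g = euclidean_form (\<lambda>i. th1 i u) (\<lambda>i. ps1 i u) (\<lambda>i. y1 i u);
           h = (\<lambda>i j. C * y2 i j u - s * ps2 i j u)
       in 2 * (H - C) * (g 1 1 * g 2 2 - g 1 2 * g 1 2) =
          y u * (g 2 2 * h 1 1 - g 1 2 * (h 1 2 + h 2 1) + g 1 1 * h 2 2)"
      using cmc[OF BU[OF uB]] by blast
    have "(s * C0 u) * t0 k u = (C * s0 u) * t0 k u"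
      using Cs(2)[of k] unfolding psC[OF that] yS[OF that] by (simp only: mult.assoc)
    then have x: "s * C0 u = C * s0 u" using t0k0[OF that] by simp
    have "(C - C0 u) * (C + C0 u) = 0" using x Cs(1) unit[OF that] by algebra
    moreover have "(s - s0 u) * (s + s0 u) = 0" using x Cs(1) unit[OF that] by algebra
    moreover have "(C - C0 u) * (s + s0 u) = 0" using x Cs(1) unit[OF that] by algebra
    moreover have "(C + C0 u) * (s - s0 u) = 0" using x Cs(1) unit[OF that] by algebra
    ultimately have "(C = C0 u \<and> s = s0 u) \<or> (C = - C0 u \<and> s = - s0 u)"
      unfolding mult_eq_0_iff by linarith
    then obtain e where e: "e = 1 \<or> e = -1" "C = e * C0 u" "s = e * s0 u"
      by (metis mult_1 mult_minus1)
    define g where "g i j = th1 i u * th1 j u + t0 i u * t0 j u" for i j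
    have g: "euclidean_form (\<lambda>i. th1 i u) (\<lambda>i. ps1 i u) (\<lambda>i. y1 i u) i j = g i j" for i j
      unfolding euclidean_form_def g_def psC[OF that] yS[OF that] using unit[OF that] by algebra
    have h: "C * y2 i j u - s * ps2 i j u = e * ka u * t0 j u * t0 i u" for i j
      using h0[OF that, of i j] al[OF that, of j] e by (simp add: algebra_simps)
    \<comment> \<open>The induced Euclidean metric is that of the ruling coordinate and the arc
      length form \<open>t0\<close>, so its Gram determinant is the square of this minor; the
      curvature side contains the same square and it cancels.\<close>
    define D where "D = th1 1 u * t0 2 u - th1 2 u * t0 1 u"
    have "D \<noteq> 0"
    proof
      assume "D = 0"
      then have "th1 1 u * t0 2 u = th1 2 u * t0 1 u" by (simp add: D_def)
      then show False using immersed[OF BU[OF that]] by (simp add: psC[OF that] yS[OF that])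
    qed
    have "2 * (H - C) * (g 1 1 * g 2 2 - g 1 2 * g 1 2) =
          y u * (g 2 2 * (e * ka u * t0 1 u * t0 1 u) - g 1 2 * (e * ka u * t0 2 u * t0 1 u + e * ka u * t0 1 u * t0 2 u)
            + g 1 1 * (e * ka u * t0 2 u * t0 2 u))"
      using eq unfolding Let_def g h .
    then have "(2 * (H - C)) * D\<^sup>2 = (y u * e * ka u) * D\<^sup>2"
      unfolding g_def D_def by (simp add: power2_eq_square algebra_simps)
    then have "2 * (H - C) = y u * e * ka u" using \<open>D \<noteq> 0\<close> by simp
    then have eq1: "2 * (H - e * C0 u) = e * ka u * y u" using e by simp
    then have "2 * H * e = 2 * C0 u + ka u * y u" using e(1) eq1 by auto
    then have "e = (2 * C0 u + ka u * y u) / (2 * H)" using H1 by (simp add: field_simps)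
    then show ?thesis using eq1 e(1) by auto
  qed
  define ep where "ep u = (2 * C0 u + ka u * y u) / (2 * H)" for u
  have contB: "continuous_on B f" if "continuous_on U f" for f :: "real^2 \<Rightarrow> real"
    using that r(2) continuous_on_subset by blast
  have cC: "continuous_on B C0" by (rule has_gradient_continuous_on[OF C0grad])
  have cs: "continuous_on B s0" by (rule has_gradient_continuous_on[OF s0grad])
  have cy: "continuous_on B y" by (rule contB[OF has_gradient_continuous_on[OF y1]])
  have ct: "continuous_on B (t0 k)"
    unfolding t0_def[abs_def] by (intro continuous_intros cC cs contB cont1)
  have cal: "continuous_on B (al k)"
    unfolding al_def[abs_def] by (intro continuous_intros contB cont1 cont2 \<open>continuous_on U R\<close>) (use r(3) in force)
  have "continuous_on B ka"
    unfolding ka_def[abs_def] by (intro continuous_intros ct cal) (use t0k0 in blast)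
  from this have "continuous_on B ep"
    unfolding ep_def[abs_def] by (intro continuous_intros cC cy \<open>continuous_on B ka\<close>) (use H1 in auto)
  then have "is_interval (ep ` B)"
    using connected_continuous_image[of B ep] by (simp add: B_def is_interval_connected_1)
  have ep_const: "ep u = ep u0" if "u \<in> B" for u
  proof (rule ccontr)
    assume ne: "ep u \<noteq> ep u0"
    have "ep u \<in> {-1, 1}" "ep u0 \<in> {-1, 1}" using curv that r(4) by (auto simp: ep_def)
    then have "(ep u \<le> 0 \<and> 0 \<le> ep u0) \<or> (ep u0 \<le> 0 \<and> 0 \<le> ep u)" using ne by auto
    then have "0 \<in> ep ` B"
      using \<open>is_interval (ep ` B)\<close> that r(4) unfolding is_interval_1 by blast
    then obtain z where z: "z \<in> B" "ep z = 0" by auto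
    have "ep z \<in> {-1, 1}" using curv[OF z(1)] unfolding ep_def by blast
    then show False using z(2) by simp
  qed
  define e where "e = ep u0"
  have e: "e = 1 \<or> e = -1" using curv[OF r(4)] by (auto simp: e_def ep_def)
  have curv': "2 * (H - e * C0 u) = e * ka u * y u" if "u \<in> B" for u
    using curv[OF that] unfolding ep_def[symmetric] ep_const[OF that] e_def by blast
  show ?thesis
  proof (rule exI[of _ r], rule exI[of _ "\<lambda>u. e * C0 u"], rule exI[of _ "\<lambda>u. e * s0 u"],
      rule exI[of _ "\<lambda>i u. e * t0 i u"], rule exI[of _ "\<lambda>u. e * ka u"], intro conjI ballI)
    show "0 < r" by (rule r)
    show "ball u0 r \<subseteq> U" using r(2) by (simp add: B_def)
    fix u assume "u \<in> ball u0 r"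
    then have u: "u \<in> B" by (simp add: B_def)
    have ee: "e * (e * z) = z" for z using e by auto
    show "(e * C0 u)\<^sup>2 + (e * s0 u)\<^sup>2 = 1" using unit[OF u] e by auto
    show "\<forall>i. ps1 i u = e * C0 u * (e * t0 i u)" using psC[OF u] ee by (metis mult.assoc mult.left_commute)
    show "\<forall>i. y1 i u = e * s0 u * (e * t0 i u)" using yS[OF u] ee by (metis mult.assoc mult.left_commute)
    show "has_gradient (\<lambda>u. e * C0 u) (\<lambda>i. - (e * s0 u) * (e * ka u) * (e * t0 i u)) u"
      by (rule has_gradient_cong[OF has_gradient_cmult[OF C0grad[OF u]]]) (use e al[OF u] in auto)
    show "has_gradient (\<lambda>u. e * s0 u) (\<lambda>i. (e * C0 u) * (e * ka u) * (e * t0 i u)) u"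
      by (rule has_gradient_cong[OF has_gradient_cmult[OF s0grad[OF u]]]) (use e al[OF u] in auto)
    show "e * ka u * y u = 2 * (H - e * C0 u)" using curv'[OF u] by simp
    show "\<exists>i. e * t0 i u \<noteq> 0" using t0k0[OF u] e by auto
  qed
qed

text \<open>On a ball the quotient \<open>sqrt (H - C) / y\<close> and the difference of
  \<open>ps\<close> and the rescaled \<open>profile_abscissa\<close> have zero gradient, which
  integrates the curvature equation. The gradient \<open>\<kappa> * \<tau>\<close> of the angle
  never vanishes, so \<open>a\<close> maps neighbourhoods to neighbourhoods.\<close>

lemma local_profile:
  assumes "u0 \<in> U"
  shows "\<exists>N a c k. open N \<and> u0 \<in> N \<and> N \<subseteq> U \<and> 0 < c \<and> continuous_on N a \<and>
    (\<forall>u\<in>N. y u = sqrt (H - cos (a u)) / c \<and> ps u = profile_abscissa H (a u) / c + k) \<and>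
    (\<forall>T u. open T \<longrightarrow> T \<subseteq> N \<longrightarrow> u \<in> T \<longrightarrow> a u \<in> interior (a ` T))"
proof -
  obtain r0 C s \<tau> \<kappa> where r0: "0 < r0" "ball u0 r0 \<subseteq> U" and
    D': "\<forall>u\<in>ball u0 r0. (C u)\<^sup>2 + (s u)\<^sup>2 = 1 \<and>
    (\<forall>i. ps1 i u = C u * \<tau> i u) \<and> (\<forall>i. y1 i u = s u * \<tau> i u) \<and>
    has_gradient C (\<lambda>i. - s u * \<kappa> u * \<tau> i u) u \<and> has_gradient s (\<lambda>i. C u * \<kappa> u * \<tau> i u) u \<and>
    \<kappa> u * y u = 2 * (H - C u) \<and> (\<exists>i. \<tau> i u \<noteq> 0)"
    using direction_field[OF assms] by blast
  note D = bspec[OF D']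
  have "u0 \<in> ball u0 r0" using r0 by simp
  obtain a0 where a0: "C u0 = cos a0" "s u0 = sin a0"
    using sincos_total_2pi[of "C u0" "s u0"] D[OF \<open>u0 \<in> ball u0 r0\<close>] by metis
  \<comment> \<open>\<open>m\<close> and \<open>z\<close> are the cosine and the sine of the angle
    measured from \<open>a0\<close>; where \<open>m > 0\<close>, the arcsine of \<open>z\<close> is
    a differentiable choice of that angle.\<close>
  define m where "m u = C u * cos a0 + s u * sin a0" for u
  define z where "z u = s u * cos a0 - C u * sin a0" for u
  have "isCont C u0" "isCont s u0" using D[OF \<open>u0 \<in> ball u0 r0\<close>] has_gradient_continuous by blast+
  then have "isCont m u0" unfolding m_def[abs_def] by (intro continuous_intros)
  moreover have "0 < m u0" by (simp add: m_def a0 flip: power2_eq_square)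
  ultimately obtain r1 where r1: "r1 > 0" "\<And>u. dist u u0 < r1 \<Longrightarrow> 0 < m u"
    by (rule isCont_positive_nearby) blast
  define N where "N = ball u0 (min r0 r1)"
  have N: "open N" "convex N" "u0 \<in> N" "N \<subseteq> U" using r0 r1 by (auto simp: N_def)
  have mpos: "0 < m u" if "u \<in> N" for u using r1(2)[of u] that by (auto simp: N_def dist_commute)
  have inU: "u \<in> U" if "u \<in> N" for u using that N by auto
  have unit: "(C u)\<^sup>2 + (s u)\<^sup>2 = 1" and psC: "ps1 i u = C u * \<tau> i u" and yS: "y1 i u = s u * \<tau> i u"
    and Cg: "has_gradient C (\<lambda>i. - s u * \<kappa> u * \<tau> i u) u" and sg: "has_gradient s (\<lambda>i. C u * \<kappa> u * \<tau> i u) u"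
    and ky: "\<kappa> u * y u = 2 * (H - C u)" and tau: "\<exists>i. \<tau> i u \<noteq> 0" if "u \<in> N" for u i
    using D[of u] that by (auto simp: N_def)
  have mz: "(m u)\<^sup>2 = 1 - (z u)\<^sup>2" if "u \<in> N" for u
  proof -
    have "(m u)\<^sup>2 + (z u)\<^sup>2 = ((C u)\<^sup>2 + (s u)\<^sup>2) * ((cos a0)\<^sup>2 + (sin a0)\<^sup>2)"
      unfolding m_def z_def by algebra
    then show ?thesis using unit[OF that] by simp
  qed
  have z1: "\<bar>z u\<bar> < 1" if "u \<in> N" for u
  proof -
    have "(z u)\<^sup>2 < 1" using mz[OF that] zero_less_power[OF mpos[OF that], of 2] by linarith
    then show ?thesis by (simp add: abs_square_less_1)
  qed
  have msqrt: "sqrt (1 - (z u)\<^sup>2) = m u" if "u \<in> N" for u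
    using mz[OF that] mpos[OF that] by (simp flip: mz[OF that])
  define a where "a u = a0 + arcsin (z u)" for u
  have sin_a: "sin (arcsin (z u)) = z u" and cos_a: "cos (arcsin (z u)) = m u" if "u \<in> N" for u
    using z1[OF that] msqrt[OF that] by (simp_all add: cos_arcsin abs_le_iff)
  have Ca: "C u = cos (a u)" and sa: "s u = sin (a u)" if "u \<in> N" for u
  proof -
    have "cos (a u) = cos a0 * m u - sin a0 * z u" "sin (a u) = sin a0 * m u + cos a0 * z u"
      by (simp_all add: a_def cos_add sin_add sin_a[OF that] cos_a[OF that])
    moreover have "cos a0 * m u - sin a0 * z u = C u * ((cos a0)\<^sup>2 + (sin a0)\<^sup>2)"
      "sin a0 * m u + cos a0 * z u = s u * ((cos a0)\<^sup>2 + (sin a0)\<^sup>2)"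
      unfolding m_def z_def by algebra+
    ultimately show "C u = cos (a u)" "s u = sin (a u)" by simp_all
  qed
  have ag: "has_gradient a (\<lambda>i. \<kappa> u * \<tau> i u) u" if "u \<in> N" for u
  proof -
    have zg: "has_gradient z (\<lambda>i. m u * (\<kappa> u * \<tau> i u)) u"
      unfolding z_def[abs_def]
      by (rule has_gradient_cong[OF has_gradient_diff[OF has_gradient_mult[OF sg[OF that] has_gradient_const]
            has_gradient_mult[OF Cg[OF that] has_gradient_const]]])
        (simp add: m_def algebra_simps)
    have "(arcsin has_real_derivative inverse (m u)) (at (z u))"
      using DERIV_arcsin[of "z u"] z1[OF that] msqrt[OF that] by auto
    from has_gradient_add[OF has_gradient_const has_gradient_chain[OF zg this], of a0]
    show ?thesis unfolding a_def[abs_def]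
      by (rule has_gradient_cong) (use mpos[OF that] in simp)
  qed
  have pos: "0 < H - C u" if "u \<in> N" for u using cos_less[OF H1, of "a u"] Ca[OF that] by simp
  have Hg: "has_gradient (\<lambda>u. H - C u) (\<lambda>i. s u * \<kappa> u * \<tau> i u) u" if "u \<in> N" for u
    by (rule has_gradient_cong[OF has_gradient_diff[OF has_gradient_const Cg[OF that]]]) simp
  \<comment> \<open>Square root of the first integral, evaluated at the centre.\<close>
  define c where "c = sqrt (H - C u0) / y u0"
  have c: "sqrt (H - C u) / y u = c" if "u \<in> N" for u
    unfolding c_def
  proof (rule zero_gradient_constant[OF N(1,2) has_gradient_divide[OF has_gradient_chain[OF Hg DERIV_real_sqrt] y1]])
    fix u i assume u: "u \<in> N"
    have cancel2: "x * (2 * h) / (2 * q) = x * h / q" for x h q :: real by simp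
    have cancelq: "x * (q * q) / q = q * x" if "q \<noteq> 0" for x q :: real using that by simp
    have sq: "sqrt (H - C u) > 0" "sqrt (H - C u) * sqrt (H - C u) = H - C u" using pos[OF u] by auto
    have "inverse (sqrt (H - C u)) / 2 * (s u * \<kappa> u * \<tau> i u) * y u = s u * \<tau> i u * (\<kappa> u * y u) / (2 * sqrt (H - C u))"
      by (simp add: divide_simps)
    also have "\<dots> = s u * \<tau> i u * (sqrt (H - C u) * sqrt (H - C u)) / sqrt (H - C u)"
      unfolding ky[OF u] sq(2) by (rule cancel2)
    also have "\<dots> = sqrt (H - C u) * (s u * \<tau> i u)" by (rule cancelq) (use sq(1) in simp)
    finally show "(inverse (sqrt (H - C u)) / 2 * (s u * \<kappa> u * \<tau> i u) * y u - sqrt (H - C u) * y1 i u) / (y u)\<^sup>2 = 0"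
      by (simp add: yS[OF u])
  qed (use N that inU y_pos pos in \<open>auto simp: less_imp_neq[symmetric]\<close>)
  have c0: "c > 0" unfolding c_def using y_pos[OF assms] pos[OF N(3)] by simp
  have y_eq: "y u = sqrt (H - cos (a u)) / c" if "u \<in> N" for u
    using c[OF that] c0 y_pos[OF inU[OF that]] by (simp add: Ca[OF that] field_simps)
  define k where "k = ps u0 - profile_abscissa H (a u0) / c"
  have ps_eq: "ps u - profile_abscissa H (a u) * inverse c = k" if "u \<in> N" for u
    unfolding k_def divide_inverse
  proof (rule zero_gradient_constant[OF N(1,2) has_gradient_diff[OF ps1 has_gradient_mult[OF
        has_gradient_chain[OF ag profile_abscissa_deriv[OF H1]] has_gradient_const]]])
    fix u i assume u: "u \<in> N"
    have "c * y u = sqrt (H - cos (a u))" using y_eq[OF u] c0 by simp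
    moreover have "sqrt (H - cos (a u)) * sqrt (H - cos (a u)) = H - C u" using pos[OF u] Ca[OF u] by simp
    ultimately have 1: "sqrt (H - cos (a u)) * (c * y u) = H - C u" by simp
    have q: "sqrt (H - cos (a u)) > 0" using pos[OF u] Ca[OF u] by simp
    have "\<kappa> u * y u = 2 * (sqrt (H - cos (a u)) * (c * y u))" using ky[OF u] 1 by simp
    then have "\<kappa> u * y u = (2 * sqrt (H - cos (a u)) * c) * y u" by (simp add: mult_ac)
    then have ka: "\<kappa> u = 2 * sqrt (H - cos (a u)) * c" using y_pos[OF inU[OF u]] by simp
    show "ps1 i u - (cos (a u) / (2 * sqrt (H - cos (a u))) * (\<kappa> u * \<tau> i u) * inverse c + profile_abscissa H (a u) * 0) = 0"
      unfolding psC[OF u] ka Ca[OF u] using q c0 by (simp add: field_simps)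
  qed (use N that inU in auto)
  have conta: "continuous_on N a" using ag by (rule has_gradient_continuous_on)
  have aopen: "a u \<in> interior (a ` T)" if T: "open T" "T \<subseteq> N" "u \<in> T" for T u
  proof -
    have u: "u \<in> N" using T by auto
    obtain i where "\<tau> i u \<noteq> 0" using tau[OF u] by blast
    moreover have "\<kappa> u \<noteq> 0" using ky[OF u] pos[OF u] by auto
    ultimately show ?thesis
      using gradient_open_map[OF T(1,3) _ ag[OF u], of i] conta T(2) continuous_on_subset
      by (metis mult_eq_0_iff)
  qed
  have ps_eq': "ps u = profile_abscissa H (a u) / c + k" if "u \<in> N" for u
    using ps_eq[OF that] by (simp add: divide_inverse)
  show ?thesis
    by (intro exI[of _ N] exI[of _ a] exI[of _ c] exI[of _ k] conjI ballI allI impI)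
      (fact N c0 conta | erule y_eq ps_eq' | (rule aopen; assumption))+
qed

end

section \<open>Half-space coordinates and mean curvature of a chart\<close>

lemma differentiable_has_gradient:
  fixes g :: "real^2 \<Rightarrow> real^4"
  assumes "g differentiable (at u)"
  shows "has_gradient (\<lambda>u. mink (g u) z) (\<lambda>i. mink (pderiv_at g i u) z) u"
proof -
  define D where "D = frechet_derivative g (at u)"
  have D: "(g has_derivative D) (at u)" using assms by (simp add: frechet_derivative_works D_def)
  then have lin: "linear D" by (rule has_derivative_linear)
  have "((\<lambda>u. mink (g u) z) has_derivative (\<lambda>w. mink (D w) z)) (at u)"
    by (rule bounded_linear.has_derivative[OF bounded_linear_mink D])
  moreover have "mink (D w) z = (\<Sum>i\<in>UNIV. mink (pderiv_at g i u) z * w $ i)" for w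
  proof -
    have "D w = D (\<Sum>i\<in>UNIV. w $ i *\<^sub>R axis i 1)" by (simp add: basis_expansion scalar_mult_eq_scaleR[symmetric])
    also have "\<dots> = (\<Sum>i\<in>UNIV. w $ i *\<^sub>R D (axis i 1))"
      by (simp add: linear_sum[OF lin] linear_scale[OF lin])
    finally show ?thesis by (simp add: sum_2 pderiv_at_def D_def mult.commute)
  qed
  ultimately show ?thesis by (simp add: has_gradient_def)
qed

text \<open>The characteristic polynomials are compared at 0 and at 1, which isolates the linear
  coefficient.\<close>

lemma trace_from_principal_curvatures:
  fixes S :: "real^2^2"
  assumes "\<forall>x. det (S - mat x) = (k1 - x) * (k2 - x)"
  shows "S$1$1 + S$2$2 = k1 + k2"
  using assms[rule_format, of 0] assms[rule_format, of 1]
  by (simp add: det_2 mat_def algebra_simps)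

text \<open>Substituting \<open>A ** S = B\<close> for \<open>B\<close> makes this a polynomial
  identity in \<open>A\<close> and \<open>S\<close>; the entries of the inverse never
  appear.\<close>

lemma trace_matrix_inv_mult:
  fixes A B :: "real^2^2"
  assumes "det A \<noteq> 0"
  defines "S \<equiv> matrix_inv A ** B"
  shows "(S$1$1 + S$2$2) * det A = A$2$2 * B$1$1 - A$1$2 * B$2$1 - A$2$1 * B$1$2 + A$1$1 * B$2$2"
proof -
  have "A ** matrix_inv A = mat 1"
    using assms(1) unfolding invertible_det_nz[symmetric] invertible_def matrix_inv_def
    by (rule someI_ex[THEN conjunct1])
  then have "A ** S = B" by (simp add: S_def matrix_mul_assoc)
  then have "B$i$j = A$i$1 * S$1$j + A$i$2 * S$2$j" for i j
    by (auto simp: matrix_matrix_mult_def sum_2)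
  then show ?thesis by (simp add: det_2 algebra_simps)
qed

text \<open>The coordinates \<open>c\<close>, \<open>b\<close>, \<open>d\<close> along
  \<open>w\<close>, \<open>e1\<close>, \<open>e2\<close> suffice, as the one along \<open>v\<close>
  follows from \<open>mink (g u) (g u) = -1\<close>. The condition \<open>0 < v $ 4\<close> makes
  the height \<open>c\<close> positive.\<close>

locale hyperbolic_chart =
  fixes v e1 w e2 :: "real^4" and g :: "real^2 \<Rightarrow> real^4" and U :: "(real^2) set"
  assumes basis: "pseudo_orthonormal_basis v e1 w e2" and v4: "0 < v $ 4"
    and open_U: "open U" and imm: "immersion_on g U" and hyp: "g ` U \<subseteq> hyperbolic_space"
begin

definition c where "c u = - mink (g u) v"
definition b where "b u = mink (g u) e1"
definition d where "d u = mink (g u) e2"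
definition c1 where "c1 i u = - mink (pderiv_at g i u) v"
definition b1 where "b1 i u = mink (pderiv_at g i u) e1"
definition d1 where "d1 i u = mink (pderiv_at g i u) e2"
definition c2 where "c2 i j u = - mink (pderiv_at (pderiv_at g i) j u) v"
definition d2 where "d2 i j u = mink (pderiv_at (pderiv_at g i) j u) e2"

definition y where "y u = 1 / c u"
definition ps where "ps u = d u / c u"
definition th where "th u = b u / c u"
definition y1 where "y1 i u = - c1 i u / (c u)\<^sup>2"
definition ps1 where "ps1 i u = (d1 i u * c u - d u * c1 i u) / (c u)\<^sup>2"
definition th1 where "th1 i u = (b1 i u * c u - b u * c1 i u) / (c u)\<^sup>2"
text \<open>The second partials keep the unsimplified form produced by the quotient rule, so that
  the gradient rules match directly.\<close>

definition y2 where "y2 i j u = (- c2 i j u * (c u)\<^sup>2 - (- c1 i u) * (2 * c u * c1 j u)) / ((c u)\<^sup>2)\<^sup>2"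
definition ps2 where "ps2 i j u =
  (((d2 i j u * c u + d1 i u * c1 j u) - (d1 j u * c1 i u + d u * c2 i j u)) * (c u)\<^sup>2 -
   (d1 i u * c u - d u * c1 i u) * (2 * c u * c1 j u)) / ((c u)\<^sup>2)\<^sup>2"

lemmas B = pseudo_orthonormal_basis_mink[OF basis]

lemma c_pos: "u \<in> U \<Longrightarrow> 0 < c u"
  using mink_hyperbolic_lightlike_neg[OF _ B(1) v4] hyp by (force simp: c_def)

lemma diff1: "u \<in> U \<Longrightarrow> g differentiable (at u)"
  and diff2: "u \<in> U \<Longrightarrow> pderiv_at g i differentiable (at u)"
  and cont2: "continuous_on U (pderiv_at (pderiv_at g i) j)"
  and inj: "u \<in> U \<Longrightarrow> inj (frechet_derivative g (at u))"
  using imm by (auto simp: immersion_on_def C2_on_def C1_on_def)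

lemma grad:
  assumes "u \<in> U"
  shows "has_gradient c (\<lambda>i. c1 i u) u" "has_gradient b (\<lambda>i. b1 i u) u" "has_gradient d (\<lambda>i. d1 i u) u"
    "has_gradient (c1 i) (\<lambda>j. c2 i j u) u" "has_gradient (d1 i) (\<lambda>j. d2 i j u) u"
proof -
  note 1 = differentiable_has_gradient[OF diff1[OF assms]]
    and 2 = differentiable_has_gradient[OF diff2[OF assms]]
  show "has_gradient c (\<lambda>i. c1 i u) u"
    unfolding c_def[abs_def] c1_def[abs_def] using has_gradient_cmult[OF 1, of "-1"] by simp
  show "has_gradient (c1 i) (\<lambda>j. c2 i j u) u"
    unfolding c1_def[abs_def] c2_def[abs_def] using has_gradient_cmult[OF 2, of "-1"] by simp
  show "has_gradient b (\<lambda>i. b1 i u) u" "has_gradient d (\<lambda>i. d1 i u) u" "has_gradient (d1 i) (\<lambda>j. d2 i j u) u"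
    unfolding b_def[abs_def] b1_def[abs_def] d_def[abs_def] d1_def[abs_def] d2_def[abs_def]
    by (rule 1 2)+
qed

lemma half_space_gradients:
  assumes "u \<in> U"
  shows "has_gradient y (\<lambda>i. y1 i u) u" "has_gradient ps (\<lambda>i. ps1 i u) u" "has_gradient th (\<lambda>i. th1 i u) u"
    "has_gradient (y1 i) (\<lambda>j. y2 i j u) u" "has_gradient (ps1 i) (\<lambda>j. ps2 i j u) u"
proof -
  note G = grad[OF assms]
  have c0: "c u \<noteq> 0" "(c u)\<^sup>2 \<noteq> 0" using c_pos[OF assms] by auto
  have csq: "has_gradient (\<lambda>u. (c u)\<^sup>2) (\<lambda>i. 2 * c u * c1 i u) u"
    unfolding power2_eq_square by (rule has_gradient_cong[OF has_gradient_mult[OF G(1) G(1)]]) simp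
  show "has_gradient y (\<lambda>i. y1 i u) u"
    unfolding y_def[abs_def] y1_def
    by (rule has_gradient_cong[OF has_gradient_divide[OF has_gradient_const G(1) c0(1)]]) simp
  show "has_gradient ps (\<lambda>i. ps1 i u) u"
    unfolding ps_def[abs_def] ps1_def by (rule has_gradient_divide[OF G(3) G(1) c0(1)])
  show "has_gradient th (\<lambda>i. th1 i u) u"
    unfolding th_def[abs_def] th1_def by (rule has_gradient_divide[OF G(2) G(1) c0(1)])
  show "has_gradient (y1 i) (\<lambda>j. y2 i j u) u"
    unfolding y1_def[abs_def] y2_def
    by (rule has_gradient_divide[OF _ csq c0(2)]) (use has_gradient_cmult[OF G(4), of "-1"] in simp)
  show "has_gradient (ps1 i) (\<lambda>j. ps2 i j u) u"
    unfolding ps1_def[abs_def] ps2_def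
    by (rule has_gradient_divide[OF has_gradient_diff[OF has_gradient_mult[OF G(5) G(1)]
          has_gradient_mult[OF G(3) G(4)]] csq c0(2)])
qed

lemma continuous_second:
  "continuous_on U (y2 i j)" "continuous_on U (ps2 i j)"
proof -
  have "continuous_on U c" "continuous_on U d" "continuous_on U (c1 i)" "continuous_on U (d1 i)" for i
    by (rule has_gradient_continuous_on, erule grad)+
  moreover have "continuous_on U (c2 i j)" "continuous_on U (d2 i j)" for i j
    unfolding c2_def[abs_def] d2_def[abs_def]
    by (intro continuous_intros bounded_linear.continuous_on[OF bounded_linear_mink] cont2)+
  moreover have "\<forall>u\<in>U. ((c u)\<^sup>2)\<^sup>2 \<noteq> 0" using c_pos by force
  ultimately show "continuous_on U (y2 i j)" "continuous_on U (ps2 i j)"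
    unfolding y2_def[abs_def] ps2_def[abs_def] by (intro continuous_intros; blast)+
qed

lemma first_derivatives:
  assumes "u \<in> U"
  shows "c1 i u = - (c u)\<^sup>2 * y1 i u" "b1 i u = c u * th1 i u + th u * c1 i u"
    "d1 i u = c u * ps1 i u + ps u * c1 i u"
  using c_pos[OF assms] by (simp_all add: y1_def th1_def ps1_def th_def ps_def power2_eq_square field_simps)

lemma mink_g: "u \<in> U \<Longrightarrow> mink (g u) (g u) = -1"
  using hyp by (auto simp: hyperbolic_space_def)

lemma mink_coordinates:
  "mink x z = - (- mink x w) * (- mink z v) - (- mink x v) * (- mink z w) + mink x e1 * mink z e1 + mink x e2 * mink z e2"
  by (subst pseudo_orthonormal_expansion[OF basis, of z]) (simp add: mink_commute algebra_simps)

lemma has_gradient_mink: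
  fixes p q :: "real^2 \<Rightarrow> real^4"
  assumes "p differentiable (at u)" "q differentiable (at u)"
  shows "has_gradient (\<lambda>u. mink (p u) (q u)) (\<lambda>i. mink (pderiv_at p i u) (q u) + mink (p u) (pderiv_at q i u)) u"
proof -
  note P = differentiable_has_gradient[OF assms(1)] and Q = differentiable_has_gradient[OF assms(2)]
  have e: "mink x z = (mink x e1 * mink z e1 + mink x e2 * mink z e2) - (mink x w * mink z v + mink x v * mink z w)" for x z
    using mink_coordinates[of x z] by simp
  have fe: "(\<lambda>u. mink (p u) (q u)) = (\<lambda>u. (mink (p u) e1 * mink (q u) e1 + mink (p u) e2 * mink (q u) e2)
      - (mink (p u) w * mink (q u) v + mink (p u) v * mink (q u) w))"
    by (rule ext) (rule e)
  show ?thesis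
    unfolding fe
    by (rule has_gradient_cong[OF has_gradient_diff[OF
          has_gradient_add[OF has_gradient_mult[OF P Q] has_gradient_mult[OF P Q]]
          has_gradient_add[OF has_gradient_mult[OF P Q] has_gradient_mult[OF P Q]]]])
      (simp add: e[of "pderiv_at p _ u" "q u"] e[of "p u" "pderiv_at q _ u"])
qed

text \<open>Differentiating the equation of the hyperboloid once and twice; the second result
  expresses the position component of the second derivatives through the metric.\<close>

lemma mink_g_deriv:
  assumes "u \<in> U"
  shows "mink (pderiv_at g i u) (g u) = 0"
    "mink (pderiv_at (pderiv_at g i) j u) (g u) = - mink (pderiv_at g i u) (pderiv_at g j u)"
proof -
  have zero: "mink (pderiv_at g i u) (g u) = 0" if "u \<in> U" for u i
  proof -
    have "has_gradient (\<lambda>u. mink (g u) (g u)) (\<lambda>_. 0) u"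
      by (rule has_gradient_transfer[OF has_gradient_const[of "-1"] open_U that]) (simp add: mink_g)
    from has_gradient_unique[OF has_gradient_mink[OF diff1 diff1] this, OF that that]
    show ?thesis by (simp add: mink_commute)
  qed
  then show "mink (pderiv_at g i u) (g u) = 0" using assms .
  have "has_gradient (\<lambda>u. mink (pderiv_at g i u) (g u)) (\<lambda>_. 0) u"
    by (rule has_gradient_transfer[OF has_gradient_const[of "0"] open_U assms]) (simp add: zero)
  from has_gradient_unique[OF has_gradient_mink[OF diff2 diff1] this, OF assms assms, of j]
  show "mink (pderiv_at (pderiv_at g i) j u) (g u) = - mink (pderiv_at g i u) (pderiv_at g j u)"
    by simp
qed

text \<open>The half-space form of the hyperbolic metric, since \<open>c = 1 / y\<close>. The
  coordinate \<open>a\<close> along \<open>v\<close> and its derivatives are eliminated by the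
  equation of the hyperboloid and its derivative.\<close>

lemma metric:
  assumes "u \<in> U"
  shows "mink (pderiv_at g i u) (pderiv_at g j u) =
    (c u)\<^sup>2 * euclidean_form (\<lambda>i. th1 i u) (\<lambda>i. ps1 i u) (\<lambda>i. y1 i u) i j"
proof -
  define a where "a = - mink (g u) w"
  define a1 where "a1 i = - mink (pderiv_at g i u) w" for i
  have c: "c u \<noteq> 0" using c_pos[OF assms] by simp
  have a: "2 * a * c u = 1 + (b u)\<^sup>2 + (d u)\<^sup>2"
    using mink_g[OF assms] mink_coordinates[of "g u" "g u"] unfolding a_def b_def c_def d_def by algebra
  have a1: "c u * a1 i = b u * b1 i u + d u * d1 i u - a * c1 i u" for i
    using mink_g_deriv(1)[OF assms, of i] mink_coordinates[of "pderiv_at g i u" "g u"]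
    by (simp add: a_def a1_def b_def b1_def c_def c1_def d_def d1_def mult.commute)
  have bd: "b u = th u * c u" "d u = ps u * c u" using c by (simp_all add: th_def ps_def)
  have "mink (pderiv_at g i u) (pderiv_at g j u) = - a1 i * c1 j u - c1 i u * a1 j + b1 i u * b1 j u + d1 i u * d1 j u"
    using mink_coordinates[of "pderiv_at g i u" "pderiv_at g j u"] by (simp add: a1_def b1_def c1_def d1_def)
  then have "(c u) * mink (pderiv_at g i u) (pderiv_at g j u) = - (c u * a1 i) * c1 j u - c1 i u * (c u * a1 j)
      + c u * (b1 i u * b1 j u + d1 i u * d1 j u)"
    by algebra
  also have "\<dots> = c u * ((c u)\<^sup>2 * euclidean_form (\<lambda>i. th1 i u) (\<lambda>i. ps1 i u) (\<lambda>i. y1 i u) i j)"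
    using a unfolding a1 bd euclidean_form_def first_derivatives(2,3)[OF assms] first_derivatives(1)[OF assms]
    by algebra
  finally show ?thesis using c by simp
qed

text \<open>If all three minors of the Jacobian of \<open>(th, ps, y)\<close> vanished, a nontrivial
  combination \<open>D\<close> of the partials of \<open>g\<close> would be orthogonal to
  \<open>v\<close>, \<open>e1\<close> and \<open>e2\<close>. Orthogonality to the position vector,
  whose height is nonzero, then gives \<open>mink D w = 0\<close>, so \<open>D = 0\<close> against
  injectivity.\<close>

lemma immersed:
  assumes "u \<in> U" and rank: "ps1 1 u * y1 2 u = ps1 2 u * y1 1 u"
  shows "th1 1 u * ps1 2 u \<noteq> th1 2 u * ps1 1 u \<or> th1 1 u * y1 2 u \<noteq> th1 2 u * y1 1 u"
proof (rule ccontr)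
  assume "\<not> ?thesis"
  then have m: "th1 1 u * ps1 2 u = th1 2 u * ps1 1 u" "th1 1 u * y1 2 u = th1 2 u * y1 1 u" by auto
  have "\<exists>k l. (k \<noteq> 0 \<or> l \<noteq> 0) \<and> k * th1 1 u + l * th1 2 u = 0 \<and> k * ps1 1 u + l * ps1 2 u = 0
    \<and> k * y1 1 u + l * y1 2 u = 0"
  \<comment> \<open>A kernel vector is read off from the first nonzero row of the Jacobian; if all
    rows vanish, any vector will do.\<close>
  proof (cases "th1 1 u \<noteq> 0 \<or> th1 2 u \<noteq> 0")
    case True
    then show ?thesis using m by (intro exI[of _ "th1 2 u"] exI[of _ "- th1 1 u"]) auto
  next
    case False
    show ?thesis
    proof (cases "ps1 1 u \<noteq> 0 \<or> ps1 2 u \<noteq> 0")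
      case True
      then show ?thesis using False rank by (intro exI[of _ "ps1 2 u"] exI[of _ "- ps1 1 u"]) auto
    next
      case ps0: False
      show ?thesis
      proof (cases "y1 1 u \<noteq> 0 \<or> y1 2 u \<noteq> 0")
        case True
        then show ?thesis using False ps0 by (intro exI[of _ "y1 2 u"] exI[of _ "- y1 1 u"]) auto
      next
        case y0: False
        then show ?thesis using False ps0 by (intro exI[of _ 1]) auto
      qed
    qed
  qed
  then obtain k l where kl: "k \<noteq> 0 \<or> l \<noteq> 0" "k * th1 1 u + l * th1 2 u = 0" "k * ps1 1 u + l * ps1 2 u = 0"
    "k * y1 1 u + l * y1 2 u = 0" by blast
  define D where "D = k *\<^sub>R pderiv_at g 1 u + l *\<^sub>R pderiv_at g 2 u"
  have dc: "k * c1 1 u + l * c1 2 u = 0"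
  proof -
    have "k * c1 1 u + l * c1 2 u = - (c u)\<^sup>2 * (k * y1 1 u + l * y1 2 u)"
      unfolding first_derivatives[OF assms(1)] by (simp add: algebra_simps)
    then show ?thesis using kl by simp
  qed
  have db: "k * b1 1 u + l * b1 2 u = 0"
  proof -
    have "k * b1 1 u + l * b1 2 u = c u * (k * th1 1 u + l * th1 2 u) + th u * (k * c1 1 u + l * c1 2 u)"
      unfolding first_derivatives(2)[OF assms(1)] by (simp add: algebra_simps)
    then show ?thesis using kl dc by simp
  qed
  have dd: "k * d1 1 u + l * d1 2 u = 0"
  proof -
    have "k * d1 1 u + l * d1 2 u = c u * (k * ps1 1 u + l * ps1 2 u) + ps u * (k * c1 1 u + l * c1 2 u)"
      unfolding first_derivatives(3)[OF assms(1)] by (simp add: algebra_simps)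
    then show ?thesis using kl dc by simp
  qed
  have Dv: "mink D v = 0" using dc by (simp add: D_def c1_def)
  have De1: "mink D e1 = 0" using db by (simp add: D_def b1_def)
  have De2: "mink D e2 = 0" using dd by (simp add: D_def d1_def)
  have "mink D (g u) = 0" by (simp add: D_def mink_g_deriv[OF assms(1)])
  then have "mink D w * c u = 0"
    using mink_coordinates[of D "g u"] by (simp add: Dv De1 De2 c_def)
  then have Dw: "mink D w = 0" using c_pos[OF assms(1)] by simp
  have "D = 0" using pseudo_orthonormal_expansion[OF basis, of D] by (simp add: Dv De1 De2 Dw)
  define F where "F = frechet_derivative g (at u)"
  have lin: "linear F"
    using diff1[OF assms(1)] unfolding F_def by (rule linear_frechet_derivative)
  have "F (k *\<^sub>R axis 1 1 + l *\<^sub>R axis 2 1) = k *\<^sub>R F (axis 1 1) + l *\<^sub>R F (axis 2 1)"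
    by (simp add: linear_add[OF lin] linear_scale[OF lin])
  also have "\<dots> = D" by (simp add: D_def pderiv_at_def F_def)
  also have "\<dots> = F 0" using \<open>D = 0\<close> linear_0[OF lin] by simp
  finally have "k *\<^sub>R axis 1 1 + l *\<^sub>R axis 2 1 = (0 :: real^2)"
    using inj[OF assms(1)] by (simp add: F_def inj_eq)
  then have "(k *\<^sub>R axis 1 1 + l *\<^sub>R axis 2 1 :: real^2) $ 1 = 0" "(k *\<^sub>R axis 1 1 + l *\<^sub>R axis 2 1 :: real^2) $ 2 = 0"
    by simp_all
  then show False using kl(1) by (simp add: axis_def)
qed

lemma lagrange_identity:
  "euclidean_form p q r 1 1 * euclidean_form p q r 2 2 - euclidean_form p q r 1 2 * euclidean_form p q r 1 2
   = (p 1 * q 2 - p 2 * q 1)\<^sup>2 + (p 1 * r 2 - p 2 * r 1)\<^sup>2 + (q 1 * r 2 - q 2 * r 1)\<^sup>2"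
  unfolding euclidean_form_def by algebra

text \<open>A unit normal has the form \<open>n = - C g + \<mu> v - s e2\<close>, where \<open>(- s, C)\<close> is the Euclidean unit
  normal of the profile curve in the half-plane \<open>(ps, y)\<close>.\<close>

lemma mean_curvature_equation:
  assumes u: "u \<in> U" and rank: "ps1 1 u * y1 2 u = ps1 2 u * y1 1 u"
    and n: "unit_normal g u n" and k: "principal_curvatures g n u k1 k2" and H: "H = (k1 + k2) / 2"
  shows "\<exists>C s. C\<^sup>2 + s\<^sup>2 = 1 \<and> (\<forall>i. s * ps1 i u = C * y1 i u) \<and>
      (let G = euclidean_form (\<lambda>i. th1 i u) (\<lambda>i. ps1 i u) (\<lambda>i. y1 i u);
           h = (\<lambda>i j. C * y2 i j u - s * ps2 i j u)
       in 2 * (H - C) * (G 1 1 * G 2 2 - G 1 2 * G 1 2) =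
          y u * (G 2 2 * h 1 1 - G 1 2 * (h 1 2 + h 2 1) + G 1 1 * h 2 2))"
proof -
  have n': "mink n n = 1" "mink n (g u) = 0" "\<And>i. mink n (pderiv_at g i u) = 0"
    using n by (auto simp: unit_normal_def)
  have c: "0 < c u" by (rule c_pos[OF u])
  have yc: "y u * c u = 1" using c by (simp add: y_def)
  \<comment> \<open>Chosen so that \<open>n + C *\<^sub>R g u\<close> becomes orthogonal to
    \<open>v\<close>, that is, loses its \<open>w\<close> component.\<close>
  define C where "C = y u * mink n v"
  define m where "m = n + C *\<^sub>R g u"
  define \<mu> where "\<mu> = - mink m w"
  define \<beta> where "\<beta> = mink m e1"
  define s where "s = - mink m e2"
  have mv: "mink m v = 0"
  proof -
    have "mink m v = mink n v - (y u * c u) * mink n v" by (simp add: m_def C_def c_def algebra_simps)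
    then show ?thesis unfolding yc by simp
  qed
  have m: "m = \<mu> *\<^sub>R v + \<beta> *\<^sub>R e1 - s *\<^sub>R e2"
    using pseudo_orthonormal_expansion[OF basis, of m] by (simp add: mv \<mu>_def \<beta>_def s_def)
  have mg: "mink m (g u) = - C" using n'(2) mink_g[OF u] by (simp add: m_def)
  then have eq0: "- \<mu> * c u + \<beta> * b u - s * d u = - C"
    by (simp add: m c_def b_def d_def mink_commute[of _ "g u"])
  have mgi: "mink m (pderiv_at g i u) = 0" for i
    using n'(3) mink_g_deriv(1)[OF u, of i] by (simp add: m_def mink_commute)
  then have eqi: "- \<mu> * c1 i u + \<beta> * b1 i u - s * d1 i u = 0" for i
    using mgi[of i] by (simp add: m c1_def b1_def d1_def mink_commute[of _ "pderiv_at g i u"])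
  have bd: "b u = th u * c u" "d u = ps u * c u" using c by (simp_all add: th_def ps_def)
  have \<beta>i: "\<beta> * th1 i u = s * ps1 i u - C * y1 i u" for i
  proof -
    have "c u * (\<beta> * th1 i u - s * ps1 i u + C * y1 i u) = 0"
      using eqi[of i] eq0 unfolding bd first_derivatives(2,3)[OF u] first_derivatives(1)[OF u]
      by algebra
    then show ?thesis using c by simp
  qed
  \<comment> \<open>\<open>\<beta>\<close> is the component of the normal along the rulings. It
    annihilates the two minors of which one is nonzero, so it vanishes.\<close>
  have "\<beta> * (th1 1 u * ps1 2 u - th1 2 u * ps1 1 u) = 0"
    using \<beta>i[of 1] \<beta>i[of 2] rank by algebra
  moreover have "\<beta> * (th1 1 u * y1 2 u - th1 2 u * y1 1 u) = 0"
    using \<beta>i[of 1] \<beta>i[of 2] rank by algebra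
  ultimately have "\<beta> = 0" using immersed[OF u rank] by auto
  have par: "s * ps1 i u = C * y1 i u" for i using \<beta>i[of i] \<open>\<beta> = 0\<close> by simp
  have m': "m = \<mu> *\<^sub>R v - s *\<^sub>R e2" using m \<open>\<beta> = 0\<close> by simp
  have "mink m m = s\<^sup>2" by (simp add: m' B power2_eq_square)
  moreover have "mink m m = 1 - C\<^sup>2"
    using n' mink_g[OF u] by (simp add: m_def mink_commute[of "g u" n] power2_eq_square)
  ultimately have unit: "C\<^sup>2 + s\<^sup>2 = 1" by simp
  have \<mu>: "\<mu> = C * y u - s * ps u"
  proof -
    have "c u * (\<mu> - (C * y u - s * ps u)) = 0" using eq0 \<open>\<beta> = 0\<close> yc unfolding bd by algebra
    then show ?thesis using c by simp
  qed
  define G where "G = euclidean_form (\<lambda>i. th1 i u) (\<lambda>i. ps1 i u) (\<lambda>i. y1 i u)"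
  define h where "h i j = C * y2 i j u - s * ps2 i j u" for i j
  \<comment> \<open>The \<open>g\<close> part of the normal contributes \<open>C\<close> times the
    metric, which is the vertical term of the conformal law; the rest is \<open>c\<close> times the
    Euclidean second fundamental form.\<close>
  have II: "mink (pderiv_at (pderiv_at g i) j u) n = C * ((c u)\<^sup>2 * G i j) + c u * h i j" for i j
  proof -
    have "mink (pderiv_at (pderiv_at g i) j u) n = mink (pderiv_at (pderiv_at g i) j u) (m - C *\<^sub>R g u)"
      by (simp add: m_def)
    also have "\<dots> = C * ((c u)\<^sup>2 * G i j) - \<mu> * c2 i j u - s * d2 i j u"
      by (simp add: mink_g_deriv(2)[OF u] metric[OF u] m' c2_def d2_def G_def)
    also have "\<dots> = C * ((c u)\<^sup>2 * G i j) + (- \<mu> * c2 i j u - s * d2 i j u)" by simp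
    also have "- \<mu> * c2 i j u - s * d2 i j u = c u * h i j"
    proof -
      have e: "(c u)^4 * y2 i j u = - c2 i j u * (c u)\<^sup>2 + 2 * c u * c1 i u * c1 j u"
        using c by (simp add: y2_def field_simps)
      have f: "(c u)^4 * ps2 i j u = ((d2 i j u * c u + d1 i u * c1 j u) - (d1 j u * c1 i u + d u * c2 i j u)) * (c u)\<^sup>2 -
          (d1 i u * c u - d u * c1 i u) * (2 * c u * c1 j u)"
        using c by (simp add: ps2_def field_simps)
      \<comment> \<open>Clearing denominators leaves products of first derivatives, which cancel
        because the normal is orthogonal to the curve (\<open>par\<close>).\<close>
      have "(c u)^4 * (- \<mu> * c2 i j u - s * d2 i j u - c u * h i j) = 0"
        using e f par[of i] par[of j] yc unfolding h_def \<mu> bd first_derivatives(2,3)[OF u] first_derivatives(1)[OF u]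
        by algebra
      then show ?thesis using c by simp
    qed
    finally show ?thesis .
  qed
  let ?I = "first_fundamental_form g u" and ?II = "second_fundamental_form g n u"
  have Iij: "?I $ i $ j = (c u)\<^sup>2 * G i j" for i j by (simp add: first_fundamental_form_def metric[OF u] G_def)
  have IIij: "?II $ i $ j = C * ((c u)\<^sup>2 * G i j) + c u * h i j" for i j
    by (simp add: second_fundamental_form_def II)
  have Gs: "G 2 1 = G 1 2" by (simp add: G_def euclidean_form_def)
  define D where "D = G 1 1 * G 2 2 - G 1 2 * G 1 2"
  have D: "D \<noteq> 0"
    unfolding D_def G_def lagrange_identity
    using immersed[OF u rank] by (smt (verit, best) power2_eq_square zero_le_power2 zero_eq_power2)
  have det: "det ?I = (c u)^4 * D"
    by (simp add: det_2 Iij Gs D_def power4_eq_xxxx power2_eq_square algebra_simps)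
  then have "det ?I \<noteq> 0" using D c by simp
  note tr = trace_matrix_inv_mult[OF this, of ?II]
  have "2 * H = shape_operator g n u $ 1 $ 1 + shape_operator g n u $ 2 $ 2"
    using trace_from_principal_curvatures[OF k[unfolded principal_curvatures_def]] H by simp
  then have "2 * H * ((c u)^4 * D) = ?I$2$2 * ?II$1$1 - ?I$1$2 * ?II$2$1 - ?I$2$1 * ?II$1$2 + ?I$1$1 * ?II$2$2"
    using tr unfolding shape_operator_def det by simp
  also have "\<dots> = 2 * C * (c u)^4 * D + (c u)^3 * (G 2 2 * h 1 1 - G 1 2 * (h 1 2 + h 2 1) + G 1 1 * h 2 2)"
    unfolding Iij IIij Gs D_def by algebra
  finally have "(c u)^4 * (2 * (H - C) * D - y u * (G 2 2 * h 1 1 - G 1 2 * (h 1 2 + h 2 1) + G 1 1 * h 2 2)) = 0"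
    using yc by algebra
  then have "2 * (H - C) * D = y u * (G 2 2 * h 1 1 - G 1 2 * (h 1 2 + h 2 1) + G 1 1 * h 2 2)"
    using c by simp
  then show ?thesis
    unfolding Let_def G_def[symmetric] using unit par by (intro exI[of _ C] exI[of _ s]) (simp add: D_def h_def)
qed

lemma is_profile_chart:
  assumes "1 < H" and rank: "\<And>u. u \<in> U \<Longrightarrow> ps1 1 u * y1 2 u = ps1 2 u * y1 1 u"
    and cmc: "\<And>u. u \<in> U \<Longrightarrow> \<exists>n k1 k2. unit_normal g u n \<and> principal_curvatures g n u k1 k2 \<and> H = (k1 + k2) / 2"
  shows "profile_chart U H ps y th1 ps1 y1 ps2 y2"
proof (rule profile_chart.intro)
  show "0 < y u" if "u \<in> U" for u using c_pos[OF that] by (simp add: y_def)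
  show "\<exists>C s. C\<^sup>2 + s\<^sup>2 = 1 \<and> (\<forall>i. s * ps1 i u = C * y1 i u) \<and>
      (let G = euclidean_form (\<lambda>i. th1 i u) (\<lambda>i. ps1 i u) (\<lambda>i. y1 i u);
           h = (\<lambda>i j. C * y2 i j u - s * ps2 i j u)
       in 2 * (H - C) * (G 1 1 * G 2 2 - G 1 2 * G 1 2) =
          y u * (G 2 2 * h 1 1 - G 1 2 * (h 1 2 + h 2 1) + G 1 1 * h 2 2))" if "u \<in> U" for u
    using cmc[OF that] mean_curvature_equation[OF that rank[OF that]] by blast
qed (fact open_U assms(1) continuous_second | erule half_space_gradients rank | (rule immersed; (assumption | erule rank)))+

end

section \<open>Comparing and gluing the local angles\<close>

text \<open>The local profile without reference to a chart: continuity of \<open>a\<close> on the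
  open set \<open>N\<close> is stated through preimages, and the last clause makes \<open>a\<close>
  an open map. The constants are arguments because overlapping lifts have to be compared by
  them.\<close>

definition profile_lift ::
    "'a topology \<Rightarrow> ('a \<Rightarrow> real) \<Rightarrow> ('a \<Rightarrow> real) \<Rightarrow> real \<Rightarrow> 'a set \<Rightarrow> ('a \<Rightarrow> real) \<Rightarrow> real \<Rightarrow> real \<Rightarrow> bool" where
  "profile_lift X Y Ps H N a c k \<longleftrightarrow> openin X N \<and> 0 < c \<and>
     (\<forall>S. open S \<longrightarrow> openin X {x \<in> N. a x \<in> S}) \<and>
     (\<forall>x\<in>N. Y x = sqrt (H - cos (a x)) / c \<and> Ps x = profile_abscissa H (a x) / c + k) \<and>
     (\<forall>M x. openin X M \<longrightarrow> M \<subseteq> N \<longrightarrow> x \<in> M \<longrightarrow> a x \<in> interior (a ` M))"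

text \<open>Computed with \<open>a2\<close>, the support function in direction \<open>a2 x\<close>
  has a local minimum at \<open>x\<close>. Written in \<open>Y\<close> and \<open>Ps\<close> it
  changes between the lifts only by a positive factor and a constant, so it also has a minimum when
  computed with \<open>a1\<close>, where openness supplies all angles near \<open>a1 x\<close>.
  Hence the directions agree; equal heights give \<open>c1 = c2\<close>, and the abscissas relate
  \<open>k1\<close> to \<open>k2\<close>.\<close>

lemma profile_lift_unique:
  assumes H: "1 < H" and L1: "profile_lift X Y Ps H N1 a1 c1 k1" and L2: "profile_lift X Y Ps H N2 a2 c2 k2"
    and x: "x \<in> N1" "x \<in> N2"
  shows "c1 = c2 \<and> (\<exists>n::int. a2 x = a1 x + 2 * pi * n \<and> k1 = k2 + n * profile_period H / c1)"
proof -
  let ?W = "profile_abscissa H" and ?V = "\<lambda>a. sqrt (H - cos a)"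
  \<comment> \<open>Angles within \<open>pi\<close> of \<open>a2 x\<close> form the range in which
    \<open>support_function_min\<close> is valid.\<close>
  define M where "M = N1 \<inter> {x' \<in> N2. a2 x' \<in> ball (a2 x) pi}"
  have M: "openin X M" "M \<subseteq> N1" "x \<in> M"
    using L1 L2 x unfolding M_def profile_lift_def by (auto intro!: openin_Int)
  have c: "0 < c1" "0 < c2" using L1 L2 by (auto simp: profile_lift_def)
  have eq1: "?V (a1 z) = c1 * Y z" "?W (a1 z) = c1 * (Ps z - k1)" if "z \<in> N1" for z
    using L1 that c unfolding profile_lift_def by (auto simp: field_simps)
  have eq2: "?V (a2 z) = c2 * Y z" "?W (a2 z) = c2 * (Ps z - k2)" if "z \<in> N2" for z
    using L2 that c unfolding profile_lift_def by (auto simp: field_simps)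
  have "a1 x \<in> interior (a1 ` M)" using L1 M unfolding profile_lift_def by blast
  then obtain e where e: "0 < e" "ball (a1 x) e \<subseteq> a1 ` M" using mem_interior by blast
  have trig: "cos (a2 x) = cos (a1 x) \<and> sin (a2 x) = sin (a1 x)"
  proof (rule support_direction_unique[OF H e(1)])
    fix a assume "\<bar>a - a1 x\<bar> < e"
    then have "a \<in> ball (a1 x) e" by (simp add: dist_real_def abs_minus_commute)
    then obtain z where z: "z \<in> M" "a = a1 z" using e(2) by blast
    then have zN: "z \<in> N1" "z \<in> N2" "\<bar>a2 z - a2 x\<bar> < pi"
      by (auto simp: M_def dist_real_def abs_minus_commute)
    have "cos (a2 x) * (c2 * Y x) - sin (a2 x) * (c2 * (Ps x - k2)) \<le>
        cos (a2 x) * (c2 * Y z) - sin (a2 x) * (c2 * (Ps z - k2))"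
      using support_function_min[OF H zN(3)] unfolding eq2[OF x(2)] eq2[OF zN(2)] .
    then have "c2 * (cos (a2 x) * Y x - sin (a2 x) * Ps x) \<le> c2 * (cos (a2 x) * Y z - sin (a2 x) * Ps z)"
      by (simp add: algebra_simps)
    then have "c1 * (cos (a2 x) * Y x - sin (a2 x) * Ps x) \<le> c1 * (cos (a2 x) * Y z - sin (a2 x) * Ps z)"
      using c by simp
    then show "cos (a2 x) * ?V (a1 x) - sin (a2 x) * ?W (a1 x) \<le> cos (a2 x) * ?V a - sin (a2 x) * ?W a"
      unfolding z(2) eq1[OF x(1)] eq1[OF zN(1)] by (simp add: algebra_simps)
  qed
  obtain n :: int where n: "a2 x = a1 x + 2 * pi * n"
    using trig sin_cos_eq_iff[of "a2 x" "a1 x"] by blast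
  have "c1 * Y x = c2 * Y x" using eq1(1)[OF x(1)] eq2(1)[OF x(2)] trig by simp
  moreover have "0 < ?V (a1 x)" using cos_less[OF H] by simp
  then have "Y x \<noteq> 0" using eq1(1)[OF x(1)] by auto
  ultimately have cc: "c1 = c2" by simp
  have "c1 * (Ps x - k2) = c1 * (Ps x - k1) + n * profile_period H"
    using eq2(2)[OF x(2)] eq1(2)[OF x(1)] profile_abscissa_shift_int[OF H, of "a1 x" n]
    unfolding n cc by simp
  then have "k1 = k2 + n * profile_period H / c1" using c by (simp add: field_simps)
  then show ?thesis using cc n by blast
qed

lemma profile_lift_shift:
  assumes H: "1 < H" and L: "profile_lift X Y Ps H N a c k"
  shows "profile_lift X Y Ps H N (\<lambda>x. a x + 2 * pi * of_int n) c (k - of_int n * profile_period H / c)"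
  unfolding profile_lift_def
proof (intro conjI allI impI ballI)
  show "openin X N" "0 < c" using L by (auto simp: profile_lift_def)
next
  fix S :: "real set" assume "open S"
  then have "open ((\<lambda>z. z + 2 * pi * of_int n) -` S)"
    by (intro continuous_open_vimage) (auto intro!: continuous_intros)
  then have "openin X {x \<in> N. a x \<in> (\<lambda>z. z + 2 * pi * of_int n) -` S}"
    using L unfolding profile_lift_def by blast
  then show "openin X {x \<in> N. a x + 2 * pi * of_int n \<in> S}" by simp
next
  fix x assume "x \<in> N"
  then have "Y x = sqrt (H - cos (a x)) / c" "Ps x = profile_abscissa H (a x) / c + k" "0 < c"
    using L by (auto simp: profile_lift_def)
  moreover have "cos (a x + 2 * pi * of_int n) = cos (a x)"
    using sin_cos_eq_iff[of "a x + 2 * pi * of_int n" "a x"] by blast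
  ultimately show "Y x = sqrt (H - cos (a x + 2 * pi * of_int n)) / c"
    "Ps x = profile_abscissa H (a x + 2 * pi * of_int n) / c + (k - of_int n * profile_period H / c)"
    by (simp_all add: profile_abscissa_shift_int[OF H] add_divide_distrib)
next
  fix M x assume "openin X M" "M \<subseteq> N" "x \<in> M"
  then have "a x \<in> interior (a ` M)" using L unfolding profile_lift_def by blast
  then have "2 * pi * of_int n + a x \<in> (+) (2 * pi * of_int n) ` interior (a ` M)" by blast
  moreover have "(\<lambda>x. a x + 2 * pi * of_int n) ` M = (+) (2 * pi * of_int n) ` (a ` M)"
    by (simp add: image_image add.commute)
  ultimately show "a x + 2 * pi * of_int n \<in> interior ((\<lambda>x. a x + 2 * pi * of_int n) ` M)"
    by (simp only: interior_translation add.commute[of "a x"])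
qed

text \<open>The domains of lifts with one fixed pair \<open>c\<close>, \<open>k\<close> have a
  clopen union, as any lift that meets one of them can be shifted by full turns to the same pair.
  The period being nonzero, equal constants force equal angles, so the angles glue and no loop in
  \<open>X\<close> can produce monodromy.\<close>

lemma profile_lift_global:
  assumes "connected_space X" "topspace X \<noteq> {}" and H: "1 < H"
    and lift: "\<And>x. x \<in> topspace X \<Longrightarrow> \<exists>N a c k. x \<in> N \<and> profile_lift X Y Ps H N a c k"
  shows "\<exists>\<alpha> c k. 0 < c \<and> continuous_map X euclideanreal \<alpha> \<and> open (\<alpha> ` topspace X) \<and>
    (\<forall>x\<in>topspace X. Y x = sqrt (H - cos (\<alpha> x)) / c \<and> Ps x = profile_abscissa H (\<alpha> x) / c + k)"
proof -
  obtain x0 where x0: "x0 \<in> topspace X" using assms(2) by blast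
  obtain N0 a0 c k where L0: "x0 \<in> N0" "profile_lift X Y Ps H N0 a0 c k" using lift[OF x0] by blast
  have c: "0 < c" using L0 by (simp add: profile_lift_def)
  let ?L = "\<lambda>N a. profile_lift X Y Ps H N a c k"
  define T where "T = \<Union>{N. \<exists>a. ?L N a}"
  have openN: "openin X N" if "profile_lift X Y Ps H N a c' k'" for N a c' k'
    using that by (simp add: profile_lift_def)
  have "openin X T" unfolding T_def using openN by blast
  moreover have "openin X (topspace X - T)"
  proof (subst openin_subopen, intro ballI)
    fix x assume x: "x \<in> topspace X - T"
    then obtain N a c' k' where L: "x \<in> N" "profile_lift X Y Ps H N a c' k'" using lift by blast
    have "N \<inter> T = {}"
    proof (rule ccontr)
      assume "N \<inter> T \<noteq> {}"
      then obtain z N' a' where z: "z \<in> N" "z \<in> N'" "?L N' a'" by (auto simp: T_def)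
      obtain n :: int where n: "c = c'" "k = k' + n * profile_period H / c"
        using profile_lift_unique[OF H z(3) L(2) z(2,1)] by blast
      then have "?L N (\<lambda>x. a x + 2 * pi * of_int (- n))"
        using profile_lift_shift[OF H L(2), of "- n"] by simp
      then have "x \<in> T" using L(1) by (auto simp: T_def)
      with x show False by simp
    qed
    then show "\<exists>T'. openin X T' \<and> x \<in> T' \<and> T' \<subseteq> topspace X - T"
      using L openN openin_subset by (intro exI[of _ N]) blast
  qed
  ultimately have "T = {} \<or> T = topspace X"
    using assms(1) openin_subset unfolding connected_space_clopen_in closedin_def by blast
  moreover have "x0 \<in> T" using L0 by (auto simp: T_def)
  ultimately have T: "T = topspace X" by blast
  have unique: "a x = a' x" if L: "?L N a" "?L N' a'" and x: "x \<in> N" "x \<in> N'" for N a N' a' x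
  proof -
    obtain n :: int where n: "a' x = a x + 2 * pi * n" "k = k + n * profile_period H / c"
      using profile_lift_unique[OF H L x] by blast
    then have "n = 0" using profile_period_pos[OF H] c by simp
    then show ?thesis using n by simp
  qed
  define \<alpha> where "\<alpha> x = (SOME z. \<exists>N a. ?L N a \<and> x \<in> N \<and> z = a x)" for x
  have \<alpha>: "\<alpha> x = a x" if "?L N a" "x \<in> N" for N a x
  proof -
    have "\<exists>z. \<exists>N a. ?L N a \<and> x \<in> N \<and> z = a x" using that by blast
    from someI_ex[OF this] obtain N' a' where "?L N' a'" "x \<in> N'" "\<alpha> x = a' x" unfolding \<alpha>_def by blast
    then show ?thesis using unique[of N' a' N a x] that by simp
  qed
  have cover: "\<exists>N a. ?L N a \<and> x \<in> N" if "x \<in> topspace X" for x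
    using that unfolding T[symmetric] T_def by blast
  have "continuous_map X euclideanreal \<alpha>"
    unfolding continuous_map_def
  proof (intro conjI allI impI)
    fix S :: "real set" assume "openin euclideanreal S"
    then have "open S" by simp
    show "openin X {x \<in> topspace X. \<alpha> x \<in> S}"
    proof (subst openin_subopen, intro ballI)
      fix x assume x: "x \<in> {x \<in> topspace X. \<alpha> x \<in> S}"
      then obtain N a where L: "?L N a" "x \<in> N" using cover by blast
      have "openin X {x \<in> N. a x \<in> S}" using L(1) \<open>open S\<close> by (simp add: profile_lift_def)
      moreover have "{x \<in> N. a x \<in> S} \<subseteq> {x \<in> topspace X. \<alpha> x \<in> S}"
        using \<alpha>[OF L(1)] openin_subset[OF openN[OF L(1)]] by auto
      ultimately show "\<exists>T. openin X T \<and> x \<in> T \<and> T \<subseteq> {x \<in> topspace X. \<alpha> x \<in> S}"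
        using x L \<alpha>[OF L] by (intro exI[of _ "{x \<in> N. a x \<in> S}"]) auto
    qed
  qed simp
  moreover have "open (\<alpha> ` topspace X)"
    unfolding interior_eq[symmetric]
  proof (rule subset_antisym[OF interior_subset], rule subsetI)
    fix z assume "z \<in> \<alpha> ` topspace X"
    then obtain x where x: "x \<in> topspace X" "z = \<alpha> x" by blast
    then obtain N a where L: "?L N a" "x \<in> N" using cover by blast
    then have ax: "a x \<in> interior (a ` N)" using openN[OF L(1)] unfolding profile_lift_def by blast
    have "a ` N \<subseteq> \<alpha> ` topspace X"
      using \<alpha>[OF L(1)] openin_subset[OF openN[OF L(1)]] by force
    then show "z \<in> interior (\<alpha> ` topspace X)"
      unfolding x(2) \<alpha>[OF L] using ax by (rule subsetD[OF interior_mono])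
  qed
  moreover have "Y x = sqrt (H - cos (\<alpha> x)) / c \<and> Ps x = profile_abscissa H (\<alpha> x) / c + k"
    if "x \<in> topspace X" for x
  proof -
    obtain N a where L: "?L N a" "x \<in> N" using cover \<open>x \<in> topspace X\<close> by blast
    then show ?thesis using \<alpha>[OF L] unfolding profile_lift_def by simp
  qed
  ultimately show ?thesis using c by blast
qed

section \<open>Charts, rulings and the global profile of a surface\<close>

lemma chart_open_image:
  assumes "local_parametrization X f U \<phi>" "open V" "V \<subseteq> U"
  shows "openin X (\<phi> ` V)"
proof -
  have "homeomorphic_map (top_of_set U) (subtopology X (\<phi> ` U)) \<phi>" "openin X (\<phi> ` U)"
    using assms(1) by (auto simp: local_parametrization_def)
  moreover have "openin (top_of_set U) V" using assms(2,3) by (simp add: open_subset)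
  ultimately have "openin (subtopology X (\<phi> ` U)) (\<phi> ` V)"
    using homeomorphic_map_openness assms(3) by fastforce
  then show ?thesis using \<open>openin X (\<phi> ` U)\<close> by (rule openin_trans_full)
qed

lemma chart_open_preimage:
  assumes "local_parametrization X f U \<phi>" "openin X M"
  shows "open {u \<in> U. \<phi> u \<in> M}"
proof -
  have "open U" "homeomorphic_map (top_of_set U) (subtopology X (\<phi> ` U)) \<phi>"
    using assms(1) by (auto simp: local_parametrization_def)
  then have "continuous_map (top_of_set U) X \<phi>"
    using homeomorphic_imp_continuous_map continuous_map_in_subtopology by blast
  from openin_continuous_map_preimage[OF this assms(2)] have "openin (top_of_set U) {u \<in> U. \<phi> u \<in> M}"
    by simp
  then show ?thesis using \<open>open U\<close> openin_open_trans by blast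
qed

lemma chart_inj:
  assumes "local_parametrization X f U \<phi>"
  shows "inj_on \<phi> U"
  using assms by (auto simp: local_parametrization_def homeomorphic_map_def)

text \<open>Differentiability in charts gives continuity there, and charts are homeomorphisms onto
  open sets. Continuity of the parameters in the final statement rests on this.\<close>

lemma surface_continuous:
  assumes "hyperbolic_surface X f"
  shows "continuous_map X euclidean f"
  unfolding continuous_map_def
proof (intro conjI allI impI)
  fix S :: "(real^4) set" assume "openin euclidean S"
  then have "open S" by simp
  show "openin X {x \<in> topspace X. f x \<in> S}"
  proof (subst openin_subopen, intro ballI)
    fix x assume x: "x \<in> {x \<in> topspace X. f x \<in> S}"
    then obtain U \<phi> where P: "local_parametrization X f U \<phi>" "x \<in> \<phi> ` U"
      using assms unfolding hyperbolic_surface_def by blast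
    then have U: "open U" "immersion_on (f \<circ> \<phi>) U" "openin X (\<phi> ` U)" by (auto simp: local_parametrization_def)
    then have "\<forall>u\<in>U. (f \<circ> \<phi>) differentiable (at u)"
      unfolding immersion_on_def C2_on_def C1_on_def by blast
    then have "continuous_on U (f \<circ> \<phi>)"
      using differentiable_imp_continuous_within continuous_at_imp_continuous_on by blast
    then have "open {u \<in> U. (f \<circ> \<phi>) u \<in> S}"
      using continuous_open_preimage[OF _ U(1) \<open>open S\<close>, of "f \<circ> \<phi>"] by (simp add: vimage_def Int_def)
    then have "openin X (\<phi> ` {u \<in> U. (f \<circ> \<phi>) u \<in> S})"
      by (rule chart_open_image[OF P(1)]) auto
    then show "\<exists>T. openin X T \<and> x \<in> T \<and> T \<subseteq> {x \<in> topspace X. f x \<in> S}"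
      using x P(2) openin_subset[OF U(3)] by (intro exI[of _ "\<phi> ` {u \<in> U. (f \<circ> \<phi>) u \<in> S}"]) auto
  qed
qed simp

text \<open>\<open>ruled\<close> is all that is kept of the group: a translate of an image point is
  again an image point. The point \<open>z\<close> need not lie near \<open>x\<close> in
  \<open>X\<close>.\<close>

locale parabolic_surface =
  fixes X :: "'a topology" and f :: "'a \<Rightarrow> real^4" and H :: real and v e1 w e2 :: "real^4"
  assumes surface: "hyperbolic_surface X f" and H1: "1 < H" and cmc: "constant_mean_curvature X f H"
    and basis: "pseudo_orthonormal_basis v e1 w e2" and v4: "0 < v $ 4"
    and ruled: "x \<in> topspace X \<Longrightarrow> \<exists>z\<in>topspace X. mink (f z) v = mink (f x) v \<and>
      mink (f z) e2 = mink (f x) e2 \<and> mink (f z) e1 = mink (f x) e1 - t * mink (f x) v"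
begin

definition Y where "Y x = 1 / (- mink (f x) v)"
definition Ps where "Ps x = mink (f x) e2 / (- mink (f x) v)"
definition Th where "Th x = mink (f x) e1 / (- mink (f x) v)"

lemma height_pos: "x \<in> topspace X \<Longrightarrow> mink (f x) v < 0"
  using surface mink_hyperbolic_lightlike_neg[OF _ pseudo_orthonormal_basis_mink(1)[OF basis] v4]
  by (auto simp: hyperbolic_surface_def)

lemma chart:
  assumes "local_parametrization X f U \<phi>"
  shows "hyperbolic_chart v e1 w e2 (f \<circ> \<phi>) U" "\<phi> ` U \<subseteq> topspace X"
proof -
  show "\<phi> ` U \<subseteq> topspace X" using assms openin_subset by (auto simp: local_parametrization_def)
  then have "(f \<circ> \<phi>) ` U \<subseteq> hyperbolic_space" using surface by (auto simp: hyperbolic_surface_def)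
  then show "hyperbolic_chart v e1 w e2 (f \<circ> \<phi>) U"
    using assms basis v4 by (simp add: hyperbolic_chart_def local_parametrization_def)
qed

text \<open>Second countability reduces the claim to countably many charts, each a differentiable
  image of a planar set in 3-space.\<close>

lemma negligible_half_space_image:
  "negligible ((\<lambda>x. (Th x, Ps x, Y x)) ` topspace X)"
proof -
  let ?T = "\<lambda>x. (Th x, Ps x, Y x)"
  let ?C = "{V. \<exists>U \<phi>. local_parametrization X f U \<phi> \<and> V = \<phi> ` U}"
  have "Lindelof_space X"
    using surface second_countable_imp_Lindelof_space by (auto simp: hyperbolic_surface_def)
  moreover have "\<forall>V\<in>?C. openin X V" by (auto simp: local_parametrization_def)
  moreover have "\<Union>?C = topspace X"
  proof (intro subset_antisym subsetI)
    show "x \<in> topspace X" if "x \<in> \<Union>?C" for x using that chart(2) by blast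
    show "x \<in> \<Union>?C" if x: "x \<in> topspace X" for x
    proof -
      obtain U \<phi> where "local_parametrization X f U \<phi>" "x \<in> \<phi> ` U"
        using surface x unfolding hyperbolic_surface_def by blast
      then show ?thesis by blast
    qed
  qed
  ultimately obtain \<V> where \<V>: "countable \<V>" "\<V> \<subseteq> ?C" "\<Union>\<V> = topspace X"
    unfolding Lindelof_space_def by meson
  have "negligible (?T ` V)" if V: "V \<in> \<V>" for V
  proof -
    obtain U \<phi> where P: "local_parametrization X f U \<phi>" "V = \<phi> ` U" using V \<V>(2) by blast
    interpret hyperbolic_chart v e1 w e2 "f \<circ> \<phi>" U by (rule chart[OF P(1)])
    have "(\<lambda>u. (th u, ps u, y u)) differentiable_on U"
      unfolding differentiable_on_def
    proof
      fix u assume u: "u \<in> U"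
      note G = half_space_gradients(1-3)[OF u, unfolded has_gradient_def]
      show "(\<lambda>u. (th u, ps u, y u)) differentiable (at u within U)"
        using has_derivative_at_withinI[OF has_derivative_Pair[OF G(3) has_derivative_Pair[OF G(2) G(1)]]]
        unfolding differentiable_def by blast
    qed
    then have "negligible ((\<lambda>u. (th u, ps u, y u)) ` U)"
      by (intro negligible_differentiable_image_lowdim) simp_all
    moreover have "?T ` V = (\<lambda>u. (th u, ps u, y u)) ` U"
      unfolding P(2) image_image
      by (simp add: th_def ps_def y_def c_def b_def d_def Th_def Ps_def Y_def)
    ultimately show ?thesis by simp
  qed
  then have "negligible (\<Union>((\<lambda>V. ?T ` V) ` \<V>))"
    using \<V>(1) by (intro negligible_countable_Union) auto
  then show ?thesis using \<V>(3) by (simp add: image_Union[symmetric])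
qed

text \<open>Near a point where the rulings are transversal, the translates of the surface would fill an open
  set of the half-space.\<close>

lemma rulings_tangent:
  assumes P: "local_parametrization X f U \<phi>" and u: "u \<in> U"
  shows "hyperbolic_chart.ps1 v e2 (f \<circ> \<phi>) 1 u * hyperbolic_chart.y1 v (f \<circ> \<phi>) 2 u =
    hyperbolic_chart.ps1 v e2 (f \<circ> \<phi>) 2 u * hyperbolic_chart.y1 v (f \<circ> \<phi>) 1 u"
proof (rule ccontr)
  interpret hyperbolic_chart v e1 w e2 "f \<circ> \<phi>" U by (rule chart[OF P])
  assume ne: "ps1 1 u * y1 2 u \<noteq> ps1 2 u * y1 1 u"
  define D where "D = ps1 1 u * y1 2 u - ps1 2 u * y1 1 u"
  have D: "D \<noteq> 0" using ne by (simp add: D_def)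
  let ?q = "\<lambda>u. (ps u, y u)"
  let ?q' = "\<lambda>w. (\<Sum>i\<in>UNIV. ps1 i u * w $ i, \<Sum>i\<in>UNIV. y1 i u * w $ i)"
  \<comment> \<open>Inverse of the Jacobian of \<open>(ps, y)\<close> by Cramer's rule.\<close>
  let ?r = "\<lambda>z. ((y1 2 u / D) *\<^sub>R fst z - (ps1 2 u / D) *\<^sub>R snd z) *\<^sub>R axis 1 1 +
    ((ps1 1 u / D) *\<^sub>R snd z - (y1 1 u / D) *\<^sub>R fst z) *\<^sub>R (axis 2 1 :: real^2)"
  have "?q u \<in> interior (?q ` U)"
  proof (rule sussmann_open_mapping[OF open_U _ u, where f' = ?q' and g' = ?r])
    show "continuous_on U ?q"
      using half_space_gradients(1,2) by (intro continuous_intros has_gradient_continuous_on)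
    show "(?q has_derivative ?q') (at u)"
      using half_space_gradients(1,2)[OF u] unfolding has_gradient_def by (intro has_derivative_Pair)
    show "bounded_linear ?r"
      by (intro bounded_linear_intros bounded_linear_fst bounded_linear_snd)
    have "?q' (?r z) = z" for z
    proof -
      have "ps1 1 u * (y1 2 u / D * fst z - ps1 2 u / D * snd z) + ps1 2 u * (ps1 1 u / D * snd z - y1 1 u / D * fst z)
        = D * fst z / D"
        unfolding D_def by (simp add: diff_divide_distrib algebra_simps)
      moreover have "y1 1 u * (y1 2 u / D * fst z - ps1 2 u / D * snd z) + y1 2 u * (ps1 1 u / D * snd z - y1 1 u / D * fst z)
        = D * snd z / D"
        unfolding D_def by (simp add: diff_divide_distrib algebra_simps)
      ultimately show ?thesis using D by (simp add: sum_2 axis_def prod_eq_iff)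
    qed
    then show "?q' \<circ> ?r = id" by (auto simp: fun_eq_iff)
  qed (use open_U u in \<open>auto simp: interior_open\<close>)
  then obtain S where S: "open S" "?q u \<in> S" "S \<subseteq> ?q ` U" by (meson interiorE)
  \<comment> \<open>Over each point of \<open>S\<close> lies a surface point, and translating it by
    \<open>t - Th x\<close> reaches any prescribed \<open>t\<close>.\<close>
  have "UNIV \<times> S \<subseteq> (\<lambda>x. (Th x, Ps x, Y x)) ` topspace X"
  proof (clarify)
    fix t p h assume "(p, h) \<in> S"
    then obtain u' where u': "u' \<in> U" "p = ps u'" "h = y u'" using S(3) by auto
    define x where "x = \<phi> u'"
    have x: "x \<in> topspace X" "p = Ps x" "h = Y x"
      using u' chart(2)[OF P] by (auto simp: x_def ps_def y_def c_def d_def Ps_def Y_def)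
    obtain z where z: "z \<in> topspace X" "mink (f z) v = mink (f x) v" "mink (f z) e2 = mink (f x) e2"
      "mink (f z) e1 = mink (f x) e1 - (t - Th x) * mink (f x) v"
      using ruled[OF x(1)] by blast
    have "Th z = t" using z(2,4) height_pos[OF x(1)] by (simp add: Th_def field_simps)
    moreover have "Ps z = p" "Y z = h" using z x by (simp_all add: Ps_def Y_def)
    ultimately show "(t, p, h) \<in> (\<lambda>x. (Th x, Ps x, Y x)) ` topspace X" using z(1) by force
  qed
  then have "negligible (UNIV \<times> S :: (real \<times> real \<times> real) set)"
    using negligible_half_space_image negligible_subset by blast
  moreover have "open (UNIV \<times> S :: (real \<times> real \<times> real) set)" using S(1) by (intro open_Times) auto
  moreover have "UNIV \<times> S \<noteq> ({} :: (real \<times> real \<times> real) set)" using S(2) by auto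
  ultimately show False using open_not_negligible by blast
qed

lemma local_lift:
  assumes "x \<in> topspace X"
  shows "\<exists>N a c k. x \<in> N \<and> profile_lift X Y Ps H N a c k"
proof -
  obtain U \<phi> where P: "local_parametrization X f U \<phi>" "x \<in> \<phi> ` U"
    using surface assms unfolding hyperbolic_surface_def by blast
  then obtain u0 where u0: "u0 \<in> U" "x = \<phi> u0" by blast
  interpret hyperbolic_chart v e1 w e2 "f \<circ> \<phi>" U by (rule chart[OF P(1)])
  have "\<exists>n k1 k2. unit_normal (f \<circ> \<phi>) u n \<and> principal_curvatures (f \<circ> \<phi>) n u k1 k2 \<and> H = (k1 + k2) / 2"
    if "u \<in> U" for u
    using cmc P(1) that unfolding constant_mean_curvature_def by blast
  then have "profile_chart U H ps y th1 ps1 y1 ps2 y2"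
    using rulings_tangent[OF P(1)] by (intro is_profile_chart[OF H1])
  from profile_chart.local_profile[OF this u0(1)] obtain N a c' k where
    N: "open N" "u0 \<in> N" "N \<subseteq> U" "0 < c'" "continuous_on N a" and
    eq: "\<forall>u\<in>N. y u = sqrt (H - cos (a u)) / c' \<and> ps u = profile_abscissa H (a u) / c' + k" and
    op: "\<forall>T u. open T \<longrightarrow> T \<subseteq> N \<longrightarrow> u \<in> T \<longrightarrow> a u \<in> interior (a ` T)"
    by (elim exE conjE) (rule that)
  define \<psi> where "\<psi> = inv_into U \<phi>"
  have \<psi>: "\<psi> (\<phi> u) = u" if "u \<in> U" for u
    using chart_inj[OF P(1)] that by (simp add: \<psi>_def)
  have Y_eq: "Y (\<phi> u) = y u" "Ps (\<phi> u) = ps u" for u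
    by (simp_all add: ps_def y_def c_def d_def Ps_def Y_def)
  have "profile_lift X Y Ps H (\<phi> ` N) (a \<circ> \<psi>) c' k"
    unfolding profile_lift_def
  proof (intro conjI allI impI)
    show "openin X (\<phi> ` N)" by (rule chart_open_image[OF P(1) N(1,3)])
    show "0 < c'" by (rule N)
    show "\<forall>x\<in>\<phi> ` N. Y x = sqrt (H - cos ((a \<circ> \<psi>) x)) / c' \<and> Ps x = profile_abscissa H ((a \<circ> \<psi>) x) / c' + k"
      using eq \<psi> N(3) by (auto simp: Y_eq subset_iff)
  next
    fix S :: "real set" assume "open S"
    then have "open {u \<in> N. a u \<in> S}"
      using continuous_open_preimage[OF N(5,1), of S] by (simp add: vimage_def Int_def)
    then have "openin X (\<phi> ` {u \<in> N. a u \<in> S})" using N(3) by (intro chart_open_image[OF P(1)]) auto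
    moreover have "{x \<in> \<phi> ` N. (a \<circ> \<psi>) x \<in> S} = \<phi> ` {u \<in> N. a u \<in> S}"
      using \<psi> N(3) by (auto simp: subset_iff)
    ultimately show "openin X {x \<in> \<phi> ` N. (a \<circ> \<psi>) x \<in> S}" by simp
  next
    fix M z assume M: "openin X M" "M \<subseteq> \<phi> ` N" "z \<in> M"
    define T where "T = {u \<in> U. \<phi> u \<in> M} \<inter> N"
    have T: "open T" "T \<subseteq> N" unfolding T_def using chart_open_preimage[OF P(1) M(1)] N(1) by auto
    obtain u where u: "u \<in> N" "z = \<phi> u" using M by blast
    then have "u \<in> T" using M N(3) by (auto simp: T_def)
    moreover have "(a \<circ> \<psi>) ` M = a ` T"
    proof -
      have "M = \<phi> ` T" using M(2) N(3) by (auto simp: T_def)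
      then have "(a \<circ> \<psi>) ` M = (\<lambda>u. a (\<psi> (\<phi> u))) ` T" by (simp add: image_image)
      also have "\<dots> = a ` T"
      proof (rule image_cong[OF refl])
        fix u assume "u \<in> T"
        then have "u \<in> U" using T(2) N(3) by blast
        then show "a (\<psi> (\<phi> u)) = a u" by (simp add: \<psi>)
      qed
      finally show ?thesis .
    qed
    ultimately show "(a \<circ> \<psi>) z \<in> interior ((a \<circ> \<psi>) ` M)"
      using op[rule_format, OF T, of u] u \<psi> N(3) by (simp add: subset_iff)
  qed
  then show ?thesis using u0 N(2) by blast
qed

lemma global_profile:
  assumes "topspace X \<noteq> {}"
  shows "\<exists>\<alpha> c k. 0 < c \<and> continuous_map X euclideanreal \<alpha> \<and> open (\<alpha> ` topspace X) \<and>
    (\<forall>x\<in>topspace X. Y x = sqrt (H - cos (\<alpha> x)) / c \<and> Ps x = profile_abscissa H (\<alpha> x) / c + k)"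
  using profile_lift_global[OF _ assms H1 local_lift] surface by (simp add: hyperbolic_surface_def)

end

section \<open>Choice and normalization of the basis\<close>

text \<open>The dimension of \<open>P\<close> forces \<open>v0 \<noteq> 0\<close>, and a sign makes
  \<open>v\<close> future-pointing. The vectors \<open>v\<close> and \<open>e2\<close> are
  orthogonal to \<open>P\<close>, hence fixed by the group, which therefore acts on the image by
  translations along the rulings.\<close>

lemma parabolic_rotational_basis:
  assumes "parabolic_rotational X f"
  shows "\<exists>v e1 w e2. pseudo_orthonormal_basis v e1 w e2 \<and> 0 < v $ 4 \<and>
    (\<forall>t. \<forall>x\<in>topspace X. \<exists>z\<in>topspace X. mink (f z) v = mink (f x) v \<and>
      mink (f z) e2 = mink (f x) e2 \<and> mink (f z) e1 = mink (f x) e1 - t * mink (f x) v)"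
proof -
  obtain P G where P: "plane_signature_plus_zero P" and G: "one_parameter_isometry_group G"
    and fixed: "\<And>s x. x \<in> mink_orthogonal P \<Longrightarrow> G s x = x"
    and inv: "\<And>s. G s ` (f ` topspace X) = f ` topspace X"
    using assms unfolding parabolic_rotational_def by blast
  obtain v0 e where ve: "dim P = 2" "P = span {v0, e}" "mink v0 v0 = 0" "mink v0 e = 0" "mink e e = 1"
    using P unfolding plane_signature_plus_zero_def by blast
  have "v0 \<noteq> 0"
  proof
    assume "v0 = 0"
    then have "dim P \<le> card {e}" unfolding ve(2) by (simp add: dim_le_card')
    with ve(1) show False by simp
  qed
  define v where "v = (if 0 < v0 $ 4 then v0 else - v0)"
  have v: "mink v v = 0" "0 < v $ 4" "mink v e = 0"
    using ve lightlike_4_nonzero[OF ve(3) \<open>v0 \<noteq> 0\<close>] by (auto simp: v_def)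
  obtain e1 w e2 where B: "pseudo_orthonormal_basis v e1 w e2" and e2: "mink e2 e = 0"
    using pseudo_orthonormal_basis_exists[OF v(1,2,3) ve(5)] by blast
  have orth: "x \<in> mink_orthogonal P" if "mink x v0 = 0" "mink x e = 0" for x
  proof -
    have "mink x z = 0" if "z \<in> span {v0, e}" for z
      using that by (induction rule: span_induct_alt) (use \<open>mink x v0 = 0\<close> \<open>mink x e = 0\<close> in auto)
    then show ?thesis by (simp add: mink_orthogonal_def ve(2))
  qed
  have "mink v v0 = 0" "mink e2 v0 = 0"
    using ve(3) pseudo_orthonormal_basis_mink(12)[OF B] by (auto simp: v_def split: if_splits)
  then have "G s v = v" "G s e2 = e2" for s
    using orth v(3) e2 fixed by auto
  note tr = parabolic_group_translations[OF B G this]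
  have "\<exists>z\<in>topspace X. mink (f z) v = mink (f x) v \<and>
      mink (f z) e2 = mink (f x) e2 \<and> mink (f z) e1 = mink (f x) e1 - t * mink (f x) v"
    if x: "x \<in> topspace X" for t x
  proof -
    obtain s where s: "mink (G s (f x)) v = mink (f x) v" "mink (G s (f x)) e2 = mink (f x) e2"
      "mink (G s (f x)) e1 = mink (f x) e1 - t * mink (f x) v"
      using tr[of t] by blast
    have "G s (f x) \<in> f ` topspace X" using inv[of s] x by blast
    then obtain z where "z \<in> topspace X" "G s (f x) = f z" by blast
    then show ?thesis using s by auto
  qed
  then show ?thesis using B v(2) by blast
qed

lemma mink_self_coordinates:
  assumes B: "pseudo_orthonormal_basis v e1 w e2"
  shows "mink x x = 2 * mink x w * (- mink x v) + (mink x e1)\<^sup>2 + (mink x e2)\<^sup>2"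
  by (subst (2) pseudo_orthonormal_expansion[OF B, of x]) (simp add: power2_eq_square)

text \<open>Only the coordinate along \<open>v\<close> is not prescribed, and as
  \<open>r t > 0\<close> it is determined by \<open>mink x x = -1\<close>.\<close>

lemma parabolic_parametrization_eq:
  assumes B: "pseudo_orthonormal_basis v e1 w e2" and x: "mink x x = -1"
    and r: "0 < r t" "- mink x v = r t" and \<psi>: "mink x e2 = r t * \<psi> t"
  shows "parabolic_parametrization v e1 w e2 r \<psi> (mink x e1 / r t, t) = x"
proof -
  define b where "b = mink x e1"
  have x_eq: "x = (- mink x w) *\<^sub>R v + b *\<^sub>R e1 + r t *\<^sub>R w + (r t * \<psi> t) *\<^sub>R e2"
    using pseudo_orthonormal_expansion[OF B, of x] unfolding r(2) \<psi> b_def .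
  have eq: "-1 = 2 * mink x w * r t + b\<^sup>2 + (r t * \<psi> t)\<^sup>2"
    using mink_self_coordinates[OF B, of x] unfolding r(2) x \<psi> b_def .
  have mw: "- mink x w = (1 + (r t)\<^sup>2 * ((\<psi> t)\<^sup>2 + (b / r t)\<^sup>2)) / (2 * r t)"
  proof -
    have "(r t)\<^sup>2 * ((\<psi> t)\<^sup>2 + (b / r t)\<^sup>2) = (r t * \<psi> t)\<^sup>2 + b\<^sup>2"
      using r(1) by (simp add: power_divide power_mult_distrib distrib_left)
    then have "- mink x w * (2 * r t) = 1 + (r t)\<^sup>2 * ((\<psi> t)\<^sup>2 + (b / r t)\<^sup>2)"
      using eq by algebra
    then show ?thesis using r(1) by (simp add: eq_divide_eq)
  qed
  have rb: "r t * (b / r t) = b" using r(1) by simp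
  show ?thesis
    unfolding parabolic_parametrization_def prod.case b_def[symmetric] mw[symmetric] rb
    by (rule x_eq[symmetric])
qed

text \<open>A null rotation fixing \<open>v\<close>, followed by a boost. In the half-plane it acts
  by \<open>ps \<mapsto> c * (ps - k)\<close> and \<open>y \<mapsto> c * y\<close>, which removes
  both constants of the global profile.\<close>

lemma pseudo_orthonormal_basis_parabolic_change:
  assumes B: "pseudo_orthonormal_basis v e1 w e2" and "0 < c"
  shows "pseudo_orthonormal_basis ((1 / c) *\<^sub>R v) e1 (c *\<^sub>R (w + k *\<^sub>R e2 + (k\<^sup>2 / 2) *\<^sub>R v)) (e2 + k *\<^sub>R v)"
  using assms(2) unfolding pseudo_orthonormal_basis_def
  by (simp add: pseudo_orthonormal_basis_mink[OF B] power2_eq_square)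

theorem theorem4p8:
  fixes X :: "'a topology" and f :: "'a \<Rightarrow> real^4" and H :: real
  assumes "hyperbolic_surface X f"
    and "parabolic_rotational X f"
    and "H \<ge> 0"
    and "constant_mean_curvature X f H"
    and "H\<^sup>2 > 1"
  shows "\<exists>v e1 w e2 C p. pseudo_orthonormal_basis v e1 w e2 \<and> C > 0 \<and>
     0 < p \<and> p\<^sup>2 = 2 / (H + 1) \<and> p\<^sup>2 \<in> {0<..<1} \<and>
     (let Cm = C / (H - 1);
          \<Xi> = sqrt (C * (H + 1));
          r = (\<lambda>t. sqrt Cm * jacobi_dn p (\<Xi> * t));
          \<psi> = (\<lambda>t. H * t - (C / Cm) * (1 / \<Xi>) * ellPi p (p\<^sup>2) (\<Xi> * t));
          F = parabolic_parametrization v e1 w e2 r \<psi>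
      in \<exists>J \<sigma>. open J \<and> is_interval J \<and>
           f ` topspace X = F ` (UNIV \<times> J) \<and>
           continuous_map X (top_of_set (UNIV \<times> J)) \<sigma> \<and>
           (\<forall>x\<in>topspace X. f x = F (\<sigma> x)))"
proof -
  have H1: "1 < H"
  proof (rule ccontr)
    assume "\<not> 1 < H"
    then have "H\<^sup>2 \<le> 1" using assms(3) by (simp add: power_le_one)
    with assms(5) show False by simp
  qed
  define p where "p = sqrt (2 / (H + 1))"
  have p: "0 < p" "p\<^sup>2 = 2 / (H + 1)" using H1 by (auto simp: p_def)
  have p1: "p\<^sup>2 \<in> {0<..<1}" unfolding p(2) using H1 by simp
  obtain v e1 w e2 where B: "pseudo_orthonormal_basis v e1 w e2" and v4: "0 < v $ 4"
    and ruled: "\<And>t x. x \<in> topspace X \<Longrightarrow> \<exists>z\<in>topspace X. mink (f z) v = mink (f x) v \<and>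
      mink (f z) e2 = mink (f x) e2 \<and> mink (f z) e1 = mink (f x) e1 - t * mink (f x) v"
    using parabolic_rotational_basis[OF assms(2)] by blast
  show ?thesis
  proof (cases "topspace X = {}")
    case True
    \<comment> \<open>Gluing starts from a point of the surface; the empty surface is matched with
      the empty interval.\<close>
    have ex: "\<exists>J \<sigma>. open J \<and> is_interval J \<and> f ` topspace X = F ` (UNIV \<times> J) \<and>
        continuous_map X (top_of_set (UNIV \<times> J)) \<sigma> \<and> (\<forall>x\<in>topspace X. f x = F (\<sigma> x))"
      for F :: "real \<times> real \<Rightarrow> real^4"
      by (intro exI[of _ "{}"] exI[of _ "\<lambda>_. (0, 0)"]) (use True in \<open>simp add: continuous_map_def\<close>)
    show ?thesis
      by (rule exI[of _ v], rule exI[of _ e1], rule exI[of _ w], rule exI[of _ e2],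
          rule exI[of _ 1], rule exI[of _ p], intro conjI, rule B, rule zero_less_one, rule p, rule p,
          rule p1, unfold Let_def, rule ex)
  next
    case False
    interpret parabolic_surface X f H v e1 w e2
      using assms(1,4) H1 B v4 ruled by unfold_locales
    obtain \<alpha> c k where c: "0 < c" and \<alpha>: "continuous_map X euclideanreal \<alpha>" "open (\<alpha> ` topspace X)"
      and profile: "\<And>x. x \<in> topspace X \<Longrightarrow> Y x = sqrt (H - cos (\<alpha> x)) / c \<and> Ps x = profile_abscissa H (\<alpha> x) / c + k"
      using global_profile[OF False] by blast
    define r where "r t = sqrt (1 / (H - 1)) * jacobi_dn p (sqrt (H + 1) * t)" for t
    define \<psi> where "\<psi> t = H * t - (H - 1) * (1 / sqrt (H + 1)) * ellPi p (p\<^sup>2) (sqrt (H + 1) * t)" for t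
    obtain A where A: "strict_mono A" "surj A" "continuous_on UNIV A" "continuous_on UNIV (inv A)"
      and rA: "\<And>t. r t = 1 / sqrt (H - cos (A t))" and \<psi>A: "\<And>t. \<psi> t = profile_abscissa H (A t)"
      using jacobi_profile[OF H1 p] unfolding r_def \<psi>_def by blast
    have injA: "inj A" using A(1) by (simp add: strict_mono_imp_inj_on)
    define v' where "v' = (1 / c) *\<^sub>R v"
    define e2' where "e2' = e2 + k *\<^sub>R v"
    define w' where "w' = c *\<^sub>R (w + k *\<^sub>R e2 + (k\<^sup>2 / 2) *\<^sub>R v)"
    have B': "pseudo_orthonormal_basis v' e1 w' e2'"
      unfolding v'_def e2'_def w'_def by (rule pseudo_orthonormal_basis_parabolic_change[OF B c])
    define F where "F = parabolic_parametrization v' e1 w' e2' r \<psi>"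
    \<comment> \<open>The parameters whose direction angle occurs on the surface. A surface may be
      only a strip of the complete one, so \<open>J\<close> can be a proper subinterval.\<close>
    define J where "J = A -` (\<alpha> ` topspace X)"
    define \<tau> where "\<tau> x = inv A (\<alpha> x)" for x
    have A\<tau>: "A (\<tau> x) = \<alpha> x" for x by (simp add: \<tau>_def surj_f_inv_f[OF A(2)])
    have rpos: "0 < r t" for t unfolding rA using cos_less[OF H1] by simp
    have coord: "- mink (f x) v' = r (\<tau> x)" "mink (f x) e2' = r (\<tau> x) * \<psi> (\<tau> x)" if x: "x \<in> topspace X" for x
    proof -
      define q where "q = sqrt (H - cos (\<alpha> x))"
      have q: "0 < q" using cos_less[OF H1] by (simp add: q_def)
      have h: "mink (f x) v < 0" by (rule height_pos[OF x])
      have "1 / (- mink (f x) v) = q / c" using profile[OF x] by (simp add: Y_def q_def)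
      then have mv: "mink (f x) v = - c / q" using h q c by (simp add: field_simps)
      then show "- mink (f x) v' = r (\<tau> x)"
        unfolding v'_def rA A\<tau> q_def[symmetric] using c by simp
      have "mink (f x) e2 / (- mink (f x) v) = \<psi> (\<tau> x) / c + k"
        using profile[OF x] by (simp add: Ps_def \<psi>A A\<tau>)
      then have "mink (f x) e2 = (\<psi> (\<tau> x) / c + k) * (- mink (f x) v)" using h by (simp add: field_simps)
      then have "mink (f x) e2' = \<psi> (\<tau> x) / c * (- mink (f x) v)"
        unfolding e2'_def by (simp add: algebra_simps)
      then show "mink (f x) e2' = r (\<tau> x) * \<psi> (\<tau> x)"
        unfolding mv rA A\<tau> q_def[symmetric] using c q by simp
    qed
    have unit: "mink (f x) (f x) = -1" if "x \<in> topspace X" for x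
      using assms(1) that by (auto simp: hyperbolic_surface_def hyperbolic_space_def)
    define \<sigma> where "\<sigma> x = (mink (f x) e1 / (- mink (f x) v'), \<tau> x)" for x
    have fF: "f x = F (\<sigma> x)" if x: "x \<in> topspace X" for x
      unfolding F_def \<sigma>_def coord(1)[OF x]
      by (rule parabolic_parametrization_eq[OF B' unit[OF x], of r "\<tau> x" \<psi>, OF rpos coord[OF x], symmetric])
    have \<tau>J: "\<tau> x \<in> J" if "x \<in> topspace X" for x using that by (simp add: J_def A\<tau>)
    have "open J"
      unfolding J_def using A(3) \<alpha>(2) by (simp add: continuous_open_vimage continuous_on_eq_continuous_at)
    moreover have "is_interval J"
    proof -
      have "connectedin euclideanreal (\<alpha> ` topspace X)"
        using surface by (intro connectedin_continuous_map_image[OF \<alpha>(1)])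
          (simp add: hyperbolic_surface_def connectedin_topspace)
      then have "connected (\<alpha> ` topspace X)" by simp
      then have "connected (inv A ` (\<alpha> ` topspace X))"
        by (rule connected_continuous_image[OF continuous_on_subset[OF A(4) subset_UNIV]])
      moreover have "J = inv A ` (\<alpha> ` topspace X)"
        unfolding J_def by (rule bij_vimage_eq_inv_image[OF bijI[OF injA A(2)]])
      ultimately show ?thesis by (simp add: is_interval_connected_1)
    qed
    moreover have "f ` topspace X = F ` (UNIV \<times> J)"
    proof (intro subset_antisym subsetI)
      fix z assume "z \<in> f ` topspace X"
      then obtain x where x: "x \<in> topspace X" "z = f x" by blast
      have "\<sigma> x \<in> UNIV \<times> J" using \<tau>J[OF x(1)] by (simp add: \<sigma>_def)
      then show "z \<in> F ` (UNIV \<times> J)" unfolding x(2) fF[OF x(1)] by (rule imageI)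
    next
      fix z assume "z \<in> F ` (UNIV \<times> J)"
      then obtain s t where st: "t \<in> J" "z = F (s, t)" by auto
      then obtain x where x: "x \<in> topspace X" "A t = \<alpha> x" by (auto simp: J_def)
      then have t: "t = \<tau> x" using injA by (metis A\<tau> injD)
      \<comment> \<open>The shift is chosen to turn the product of \<open>f x\<close> with
        \<open>e1\<close> into \<open>r t * s\<close>.\<close>
      obtain x' where x': "x' \<in> topspace X" "mink (f x') v = mink (f x) v" "mink (f x') e2 = mink (f x) e2"
        "mink (f x') e1 = mink (f x) e1 - ((mink (f x) e1 - r t * s) / mink (f x) v) * mink (f x) v"
        using ruled[OF x(1)] by blast
      have "mink (f x') e1 = r t * s" using x'(4) height_pos[OF x(1)] by simp
      then have "s = mink (f x') e1 / r t" using rpos[of t] by simp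
      moreover have "- mink (f x') v' = r t" "mink (f x') e2' = r t * \<psi> t"
        using coord[OF x(1)] x'(2,3) by (simp_all add: t v'_def e2'_def)
      ultimately have "z = f x'"
        unfolding st(2) F_def using parabolic_parametrization_eq[OF B' unit[OF x'(1)], of r t \<psi>] rpos[of t] by simp
      then show "z \<in> f ` topspace X" using x'(1) by blast
    qed
    moreover have "continuous_map X (top_of_set (UNIV \<times> J)) \<sigma>"
    proof -
      have mink_cont: "continuous_map X euclideanreal (\<lambda>x. mink (f x) z)" for z
        using continuous_map_compose[OF surface_continuous[OF surface], of euclideanreal "\<lambda>x. mink x z"]
        by (simp add: comp_def linear_continuous_on)
      have "continuous_map X euclideanreal \<tau>"
        unfolding \<tau>_def[abs_def] using continuous_map_compose[OF \<alpha>(1), of euclideanreal "inv A"] A(4)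
        by (simp add: comp_def)
      moreover have "continuous_map X euclideanreal (\<lambda>x. mink (f x) e1 / (- mink (f x) v'))"
      proof (rule continuous_map_real_divide[OF mink_cont])
        show "continuous_map X euclideanreal (\<lambda>x. - mink (f x) v')" using mink_cont[of "- v'"] by simp
        show "- mink (f x) v' \<noteq> 0" if "x \<in> topspace X" for x
          unfolding coord(1)[OF that] using rpos[of "\<tau> x"] by simp
      qed
      ultimately have "continuous_map X euclidean \<sigma>"
        unfolding \<sigma>_def[abs_def] prod_topology_euclidean[symmetric] by (intro continuous_map_pairedI)
      then show ?thesis
        using \<tau>J by (intro continuous_map_into_subtopology) (auto simp: \<sigma>_def)
    qed
    ultimately have ex: "\<exists>J \<sigma>. open J \<and> is_interval J \<and> f ` topspace X = F ` (UNIV \<times> J) \<and>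
        continuous_map X (top_of_set (UNIV \<times> J)) \<sigma> \<and> (\<forall>x\<in>topspace X. f x = F (\<sigma> x))"
      using fF by blast
    \<comment> \<open>The functions of the statement at \<open>C = 1\<close>.\<close>
    have r_eq: "(\<lambda>t. sqrt (1 / (H - 1)) * jacobi_dn p (sqrt (1 * (H + 1)) * t)) = r"
      by (simp add: r_def[abs_def])
    have \<psi>_eq: "(\<lambda>t. H * t - 1 / (1 / (H - 1)) * (1 / sqrt (1 * (H + 1))) * ellPi p (p\<^sup>2) (sqrt (1 * (H + 1)) * t)) = \<psi>"
      by (simp add: \<psi>_def[abs_def])
    show ?thesis
      by (rule exI[of _ v'], rule exI[of _ e1], rule exI[of _ w'], rule exI[of _ e2'],
          rule exI[of _ 1], rule exI[of _ p], intro conjI, rule B', rule zero_less_one, rule p, rule p,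
          rule p1, unfold Let_def r_eq \<psi>_eq, rule ex[unfolded F_def])
  qed
qed

end
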